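(* Let $\mathbf{X}=\{X_i, i\geq 1\}$ be a collection of centered independent random variables with unit variance. Assume, moreover, that $\beta:=\sup_{i}E(X_i^4)<\infty$ and let $\alpha:=\max\{3;\beta\}$. Fix $N,d\geq 1$, and let $f: [N]^{d}\rightarrow\mathbb{R}$ be symmetric and vanishing on diagonals. Let $Q_d(\mathbf{X})=Q_{d}(N,f,\mathbf{X})$ be the associated homogeneous sum and assume that $E[Q_d(\mathbf{X})^2]=1$. Let $\varphi:\mathbb{R}\to\mathbb{R}$ be a thrice differentiable function such that $\|\varphi'''\|_\infty\leq B$. Then, for $Z\sim\mathscr{N}(0,1)$, $$\begin{aligned}|E[\varphi(Q_d(\mathbf{X}))]-E[\varphi(Z)]|\leq{}& B(30\beta)^d d!\sqrt{\max_{1\leq i\leq N}\operatorname{Inf}_i(f)}\\&+C_*\sqrt{\frac{d-1}{3d}}\Bigl[\sqrt{|E[Q_d(\mathbf{X})^4]-3|}+4\sqrt{2}\times 144^{d-1/2}\alpha^{d/2}\sqrt{d}\,d!\Bigl(\max_{1\leq i\leq N}\operatorname{Inf}_i(f)\Bigr)^{1/4}\Bigr],\end{aligned}$$ where $$C_{*}=4\sqrt{2}\,\bigl(1+5^{3d/2}\bigr)\times\max\left\{\frac32|\varphi''(0)|+\frac{\Vert\varphi'''\Vert_{\infty}}{3}\frac{2\sqrt{2}}{\sqrt{\pi}}\,;\;2|\varphi'(0)|+\frac13\Vert\varphi'''\Vert_{\infty}\right\}.$$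
   Context: Notation: $[N]=\{1,\ldots,N\}$. A symmetric function $f:[N]^d\to\mathbb{R}$ vanishes on diagonals if $f(i_1,\ldots,i_d)=0$ whenever $i_k=i_j$ for some $k\neq j$. The homogeneous sum is $$Q_d(N,f,\mathbf{X})=\sum_{1\leq i_1,\ldots,i_d\leq N} f(i_1,\ldots,i_d)X_{i_1}\cdots X_{i_d},$$ and the influence of the variable $i$ is $$\operatorname{Inf}_i(f)=\frac1{(d-1)!}\sum_{1\leq i_2,\ldots,i_d\leq N}f(i,i_2,\ldots,i_d)^2.$$ $\|\cdot\|_\infty$ is the supremum norm. *)

theory Defs
  imports "HOL-Probability.Probability" "HOL-Combinatorics.Combinatorics"
begin

text \<open>A kernel \<open>f : [N]\<^sup>d \<rightarrow> \<real>\<close> is represented by a function on lists of indices; only its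
  values on \<open>index_tuples N d\<close> are ever used.\<close>

definition index_tuples :: "nat \<Rightarrow> nat \<Rightarrow> nat list set" where
  "index_tuples N d = {is. set is \<subseteq> {1..N} \<and> length is = d}"

definition symmetric_kernel :: "nat \<Rightarrow> nat \<Rightarrow> (nat list \<Rightarrow> real) \<Rightarrow> bool" where
  "symmetric_kernel N d f \<longleftrightarrow>
     (\<forall>is\<in>index_tuples N d. \<forall>\<pi>. \<pi> permutes {..<d} \<longrightarrow> f (permute_list \<pi> is) = f is)"

definition vanishes_on_diagonals :: "nat \<Rightarrow> nat \<Rightarrow> (nat list \<Rightarrow> real) \<Rightarrow> bool" where
  "vanishes_on_diagonals N d f \<longleftrightarrow>
     (\<forall>is\<in>index_tuples N d. (\<exists>k<d. \<exists>j<d. k \<noteq> j \<and> is ! k = is ! j) \<longrightarrow> f is = 0)"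

definition homogeneous_sum ::
    "nat \<Rightarrow> nat \<Rightarrow> (nat list \<Rightarrow> real) \<Rightarrow> (nat \<Rightarrow> 'a \<Rightarrow> real) \<Rightarrow> 'a \<Rightarrow> real" where
  "homogeneous_sum d N f X \<omega> = (\<Sum>is\<in>index_tuples N d. f is * (\<Prod>k<d. X (is ! k) \<omega>))"

definition influence :: "nat \<Rightarrow> nat \<Rightarrow> (nat list \<Rightarrow> real) \<Rightarrow> nat \<Rightarrow> real" where
  "influence d N f i = 1 / fact (d - 1) * (\<Sum>is\<in>index_tuples N (d - 1). (f (i # is))\<^sup>2)"

definition max_influence :: "nat \<Rightarrow> nat \<Rightarrow> (nat list \<Rightarrow> real) \<Rightarrow> real" where
  "max_influence d N f = Max (influence d N f ` {1..N})"

definition thrice_differentiable :: "(real \<Rightarrow> real) \<Rightarrow> bool" where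
  "thrice_differentiable \<phi> \<longleftrightarrow> (\<forall>k<3. \<forall>x. (deriv ^^ k) \<phi> differentiable (at x))"

text \<open>As a supremum in \<^typ>\<open>real\<close>, this is meaningful only for bounded \<open>g\<close>.\<close>

definition sup_norm :: "(real \<Rightarrow> real) \<Rightarrow> real" where
  "sup_norm g = (SUP x. \<bar>g x\<bar>)"

definition C_star :: "nat \<Rightarrow> (real \<Rightarrow> real) \<Rightarrow> real" where
  "C_star d \<phi> =
     4 * sqrt 2 * (1 + 5 powr (3 * real d / 2)) *
     max (3 / 2 * \<bar>(deriv ^^ 2) \<phi> 0\<bar> + sup_norm ((deriv ^^ 3) \<phi>) / 3 * (2 * sqrt 2 / sqrt pi))
         (2 * \<bar>deriv \<phi> 0\<bar> + 1 / 3 * sup_norm ((deriv ^^ 3) \<phi>))"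

end

theory Submission imports Defs "HOL-Real_Asymp.Real_Asymp" begin

text \<open>
  Write \<open>F\<close> for the homogeneous sum, a polynomial of degree \<open>d\<close> in the independent variables in which no
  variable is repeated, \<open>D i\<close> for its partial derivatives and \<open>S\<close> for the supremum norm of the third
  derivative of \<open>\<phi>\<close>.  The proof works with the given variables directly and combines an approximate Stein
  identity with a fourth moment estimate, in place of a Lindeberg replacement by Gaussian variables and
  Malliavin calculus on the Gaussian side.

  Stein identity.  Since \<open>d F\<close> is the sum of the \<open>X i D i\<close> (\<open>euler_identity\<close>) and each \<open>D i\<close> is independent of
  \<open>X i\<close>, a Taylor expansion in \<open>X i\<close> gives \<open>E (F h(F)) \<approx> E (h'(F) G)\<close> with \<open>G = \<Gamma> / d\<close>, where \<open>\<Gamma>\<close> is half the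
  sum of the \<open>(1 + (X i)\<^sup>2) (D i)\<^sup>2\<close> (\<open>stein_bound\<close>).  The error is a sum of the third absolute moments of the
  \<open>D i\<close>.  Along the path \<open>cos \<theta> F + sin \<theta> Z\<close> this identity and Gaussian integration by parts bound
  \<open>\<bar>E \<phi>(F) - E \<phi>(Z)\<bar>\<close> by that error times \<open>S\<close> plus a multiple of
  \<open>(\<bar>\<phi>''(0)\<bar> + S) sqrt (E (1 - G)\<^sup>2)\<close> (\<open>smart_path_bound\<close>).

  Fourth moments.  The function \<open>\<Gamma>\<close> is the carre du champ of \<open>F\<close> for the generator \<open>L\<close> that resamples the
  variables one at a time, and \<open>\<Gamma> = (L + 2 d) (F\<^sup>2) / 2\<close>.  Since \<open>F\<^sup>2\<close> has degree at most \<open>2 d\<close>, the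
  eigenvalues of \<open>L + 2 d\<close> that occur lie in \<open>[0, 2 d]\<close>, so \<open>E \<Gamma>\<^sup>2 \<le> d E (\<Gamma> F\<^sup>2)\<close>
  (\<open>carre_du_champ_spectral_bound\<close>).  An exact computation shows that \<open>3 E (\<Gamma> F\<^sup>2)\<close> equals \<open>d E (F ^ 4)\<close> plus a
  weighted sum of the \<open>E ((D i) ^ 4)\<close> (\<open>carre_du_champ_fourth_moment\<close>).  Hence \<open>E (1 - G)\<^sup>2\<close> is at most
  \<open>(E (F ^ 4) - 3) / 3\<close> plus a multiple of that sum (\<open>carre_du_champ_variance_bound\<close>).

  Influences.  The second moment of \<open>D i\<close> is \<open>(d!)\<^sup>2\<close> times the influence of \<open>i\<close>, and these moments add up to
  \<open>d\<close>.  Together with \<open>hypercontractivity\<close>, which bounds fourth moments by squares of second moments, the sums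
  of third and fourth moments are bounded by powers of the maximal influence.

  In degree one the bound must not involve \<open>\<phi>''(0)\<close>.  There \<open>G\<close> is replaced by the sum of the \<open>(D i)\<^sup>2\<close>,
  which also satisfies the Stein identity and is the constant \<open>1\<close>.
\<close>

section \<open>Square integrable and fourth power integrable functions\<close>

lemmas integrable_plus = Bochner_Integration.integrable_add
lemmas expectation_sum = Bochner_Integration.integral_sum

definition sq_integrable :: "'a measure \<Rightarrow> ('a \<Rightarrow> real) \<Rightarrow> bool" where
  "sq_integrable M f \<longleftrightarrow> f \<in> borel_measurable M \<and> integrable M (\<lambda>x. (f x)\<^sup>2)"

definition L4_integrable :: "'a measure \<Rightarrow> ('a \<Rightarrow> real) \<Rightarrow> bool" where
  "L4_integrable M f \<longleftrightarrow> f \<in> borel_measurable M \<and> integrable M (\<lambda>x. (f x) ^ 4)"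

lemma integrable_dominated:
  fixes f g :: "'a \<Rightarrow> real"
  assumes "integrable M g" "f \<in> borel_measurable M" "\<And>x. \<bar>f x\<bar> \<le> g x"
  shows "integrable M f"
proof (rule Bochner_Integration.integrable_bound[OF assms(1,2)])
  have "norm (f x) \<le> norm (g x)" for x
    using order.trans[OF assms(3)[of x] abs_ge_self[of "g x"]] by simp
  then show "AE x in M. norm (f x) \<le> norm (g x)" by simp
qed

lemma sq_integrable_add:
  assumes "sq_integrable M f" "sq_integrable M g"
  shows "sq_integrable M (\<lambda>x. f x + g x)"
proof -
  have [measurable]: "f \<in> borel_measurable M" "g \<in> borel_measurable M"
    using assms by (auto simp: sq_integrable_def)
  have "integrable M (\<lambda>x. 2 * (f x)\<^sup>2 + 2 * (g x)\<^sup>2)"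
    using assms by (auto simp: sq_integrable_def)
  moreover have "(f x + g x)\<^sup>2 \<le> 2 * (f x)\<^sup>2 + 2 * (g x)\<^sup>2" for x
    using sum_squares_bound[of "f x" "g x"] by (simp add: power2_sum)
  ultimately have "integrable M (\<lambda>x. (f x + g x)\<^sup>2)"
    by (elim integrable_dominated) auto
  then show ?thesis by (simp add: sq_integrable_def)
qed

lemma sq_integrable_scale: "sq_integrable M f \<Longrightarrow> sq_integrable M (\<lambda>x. c * f x)"
  by (auto simp: sq_integrable_def power_mult_distrib)

lemma sq_integrable_zero: "sq_integrable M (\<lambda>x. 0)"
  by (simp add: sq_integrable_def)

lemma sq_integrable_sum:
  "(\<And>j. j \<in> J \<Longrightarrow> sq_integrable M (f j)) \<Longrightarrow> sq_integrable M (\<lambda>x. \<Sum>j\<in>J. f j x)"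
  by (induction J rule: infinite_finite_induct) (simp_all add: sq_integrable_zero sq_integrable_add)

lemma integrable_mult_of_sq_integrable:
  assumes "sq_integrable M f" "sq_integrable M g"
  shows "integrable M (\<lambda>x. f x * g x)"
proof -
  have [measurable]: "f \<in> borel_measurable M" "g \<in> borel_measurable M"
    using assms by (auto simp: sq_integrable_def)
  have "integrable M (\<lambda>x. (f x)\<^sup>2 + (g x)\<^sup>2)"
    using assms by (auto simp: sq_integrable_def)
  moreover have "\<bar>f x * g x\<bar> \<le> (f x)\<^sup>2 + (g x)\<^sup>2" for x
  proof -
    have "2 * (\<bar>f x\<bar> * \<bar>g x\<bar>) \<le> (f x)\<^sup>2 + (g x)\<^sup>2"
      using sum_squares_bound[of "\<bar>f x\<bar>" "\<bar>g x\<bar>"] by simp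
    moreover have "0 \<le> \<bar>f x\<bar> * \<bar>g x\<bar>" by simp
    ultimately show ?thesis unfolding abs_mult by linarith
  qed
  ultimately show ?thesis
    by (elim integrable_dominated) auto
qed

lemma add_power4_le: "(a + b) ^ 4 \<le> 8 * a ^ 4 + 8 * b ^ 4" for a b :: real
proof -
  have 1: "(x + y)\<^sup>2 \<le> 2 * x\<^sup>2 + 2 * y\<^sup>2" for x y :: real
    using sum_squares_bound[of x y] by (simp add: power2_sum)
  have "((a + b)\<^sup>2)\<^sup>2 \<le> (2 * a\<^sup>2 + 2 * b\<^sup>2)\<^sup>2" by (intro power_mono 1) simp
  also have "\<dots> \<le> 2 * (2 * a\<^sup>2)\<^sup>2 + 2 * (2 * b\<^sup>2)\<^sup>2" by (rule 1)
  finally show ?thesis by simp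
qed

lemma L4_integrable_add:
  assumes "L4_integrable M f" "L4_integrable M g"
  shows "L4_integrable M (\<lambda>x. f x + g x)"
proof -
  have [measurable]: "f \<in> borel_measurable M" "g \<in> borel_measurable M"
    using assms by (auto simp: L4_integrable_def)
  have "integrable M (\<lambda>x. 8 * (f x)^4 + 8 * (g x)^4)"
    using assms by (auto simp: L4_integrable_def)
  then have "integrable M (\<lambda>x. (f x + g x)^4)"
    by (rule integrable_dominated) (auto intro: add_power4_le)
  then show ?thesis by (simp add: L4_integrable_def)
qed

lemma L4_integrable_scale: "L4_integrable M f \<Longrightarrow> L4_integrable M (\<lambda>x. c * f x)"
  by (auto simp: L4_integrable_def power_mult_distrib)

lemma L4_integrable_zero: "L4_integrable M (\<lambda>x. 0)"
  by (simp add: L4_integrable_def)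

lemma L4_integrable_sum:
  "(\<And>j. j \<in> J \<Longrightarrow> L4_integrable M (f j)) \<Longrightarrow> L4_integrable M (\<lambda>x. \<Sum>j\<in>J. f j x)"
  by (induction J rule: infinite_finite_induct) (simp_all add: L4_integrable_zero L4_integrable_add)

lemma sq_integrable_mult_of_L4:
  assumes "L4_integrable M f" "L4_integrable M g"
  shows "sq_integrable M (\<lambda>x. f x * g x)"
proof -
  have "sq_integrable M (\<lambda>x. (f x)\<^sup>2)" "sq_integrable M (\<lambda>x. (g x)\<^sup>2)"
    using assms by (auto simp: sq_integrable_def L4_integrable_def)
  from integrable_mult_of_sq_integrable[OF this] show ?thesis
    using assms by (auto simp: sq_integrable_def L4_integrable_def power_mult_distrib)
qed

lemma sq_integrable_power2_of_L4: "L4_integrable M f \<Longrightarrow> sq_integrable M (\<lambda>x. (f x)\<^sup>2)"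
  using sq_integrable_mult_of_L4[of M f f] by (simp add: power2_eq_square)

text \<open>The quadratic form \<open>s\<^sup>2 p - 2 s t r + t\<^sup>2 q\<close>, with \<open>r\<close> the integral of \<open>\<bar>f g\<bar>\<close>, is
  nonnegative; evaluating it at \<open>s = q\<close>, \<open>t = r\<close> gives \<open>r\<^sup>2 \<le> p q\<close> unless \<open>q = 0\<close>.\<close>

lemma integral_Cauchy_Schwarz:
  assumes "sq_integrable M f" "sq_integrable M g"
  shows "(\<integral>x. \<bar>f x * g x\<bar> \<partial>M) \<le> sqrt (\<integral>x. (f x)\<^sup>2 \<partial>M) * sqrt (\<integral>x. (g x)\<^sup>2 \<partial>M)"
proof -
  have [measurable]: "f \<in> borel_measurable M" "g \<in> borel_measurable M"
    and f: "integrable M (\<lambda>x. (f x)\<^sup>2)" and g: "integrable M (\<lambda>x. (g x)\<^sup>2)"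
    using assms by (auto simp: sq_integrable_def)
  define p q r where "p = (\<integral>x. (f x)\<^sup>2 \<partial>M)" and "q = (\<integral>x. (g x)\<^sup>2 \<partial>M)"
    and "r = (\<integral>x. \<bar>f x * g x\<bar> \<partial>M)"
  have pq: "p \<ge> 0" "q \<ge> 0" "r \<ge> 0" by (auto simp: p_def q_def r_def)
  have fg: "integrable M (\<lambda>x. \<bar>f x * g x\<bar>)"
    using integrable_mult_of_sq_integrable[OF assms] by simp
  have quad: "0 \<le> s\<^sup>2 * p - 2 * s * t * r + t\<^sup>2 * q" for s t
  proof -
    have "0 \<le> (\<integral>x. (s * \<bar>f x\<bar> - t * \<bar>g x\<bar>)\<^sup>2 \<partial>M)" by simp
    also have "\<dots> = (\<integral>x. s\<^sup>2 * (f x)\<^sup>2 - 2 * s * t * \<bar>f x * g x\<bar> + t\<^sup>2 * (g x)\<^sup>2 \<partial>M)"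
      by (intro Bochner_Integration.integral_cong) (auto simp: power2_diff power_mult_distrib abs_mult)
    also have "\<dots> = s\<^sup>2 * p - 2 * s * t * r + t\<^sup>2 * q"
      using f g fg by (simp add: p_def q_def r_def)
    finally show ?thesis .
  qed
  have "r\<^sup>2 \<le> p * q"
  proof (cases "q = 0")
    case True
    show ?thesis
    proof (rule ccontr)
      assume "\<not> ?thesis"
      then have r: "r > 0" using True pq by (auto simp: less_le)
      from quad[of 1 "(p + 1) / r"] r True show False
        using r mult_nonneg_nonneg[OF pq(1,3)] by (simp add: field_simps)
    qed
  next
    case False
    from quad[of q r] have "0 \<le> q * (q * p - r\<^sup>2)" by (simp add: algebra_simps power2_eq_square)
    with False pq show ?thesis by (simp add: zero_le_mult_iff mult.commute)
  qed
  then have "r \<le> sqrt (p * q)" using pq by (simp add: real_le_rsqrt)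
  then show ?thesis by (simp add: p_def q_def r_def real_sqrt_mult)
qed

context prob_space
begin

lemma sq_integrable_const: "sq_integrable M (\<lambda>x. c)"
  by (simp add: sq_integrable_def)

lemma L4_integrable_const: "L4_integrable M (\<lambda>x. c)"
  by (simp add: L4_integrable_def)

lemma L4_integrable_imp_sq_integrable: "L4_integrable M f \<Longrightarrow> sq_integrable M f"
  using sq_integrable_mult_of_L4[OF _ L4_integrable_const[of 1], of f] by simp

lemma sq_integrable_imp_integrable: "sq_integrable M f \<Longrightarrow> integrable M f"
  using integrable_mult_of_sq_integrable[OF _ sq_integrable_const[of 1], of f] by simp

end

section \<open>Gaussian integration by parts and smooth paths\<close>

lemma abs_le_one_plus_abs_power:
  fixes x :: real
  shows "\<bar>x\<bar> \<le> 1 + \<bar>x\<bar> ^ Suc n"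
proof (cases "\<bar>x\<bar> \<le> 1")
  case False
  then show ?thesis using power_increasing[of 1 "Suc n" "\<bar>x\<bar>"] by simp
qed (simp add: add_increasing2)

lemma abs_le_of_derivative_growth:
  fixes f f' :: "real \<Rightarrow> real"
  assumes deriv: "\<And>x. (f has_real_derivative f' x) (at x)"
    and growth: "\<And>x. \<bar>f' x\<bar> \<le> C * (1 + \<bar>x\<bar> ^ n)"
  shows "\<bar>f x\<bar> \<le> (\<bar>f 0\<bar> + 2 * C) * (1 + \<bar>x\<bar> ^ Suc n)"
proof -
  have C: "0 \<le> C" using order.trans[OF abs_ge_zero growth[of 1]] by simp
  have "norm (f x - f 0) \<le> C * (1 + \<bar>x\<bar> ^ n) * norm (x - 0)"
  proof (rule field_differentiable_bound[where S = "{-\<bar>x\<bar>..\<bar>x\<bar>}" and f' = f'])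
    fix z assume "z \<in> {-\<bar>x\<bar>..\<bar>x\<bar>}"
    then have "\<bar>z\<bar> ^ n \<le> \<bar>x\<bar> ^ n" by (intro power_mono) auto
    then have "C * (1 + \<bar>z\<bar> ^ n) \<le> C * (1 + \<bar>x\<bar> ^ n)" using C by (intro mult_left_mono) auto
    then show "norm (f' z) \<le> C * (1 + \<bar>x\<bar> ^ n)" using growth[of z] by simp
  qed (use deriv in \<open>auto intro: has_field_derivative_at_within\<close>)
  then have "\<bar>f x\<bar> \<le> \<bar>f 0\<bar> + C * (\<bar>x\<bar> + \<bar>x\<bar> ^ Suc n)" by (simp add: algebra_simps)
  also have "\<dots> \<le> \<bar>f 0\<bar> + C * (2 * (1 + \<bar>x\<bar> ^ Suc n))"
  proof -
    have "\<bar>x\<bar> + \<bar>x\<bar> ^ Suc n \<le> 2 * (1 + \<bar>x\<bar> ^ Suc n)"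
      using abs_le_one_plus_abs_power[of x n] by simp
    from mult_left_mono[OF this C] show ?thesis by simp
  qed
  also have "\<dots> \<le> (\<bar>f 0\<bar> + 2 * C) * (1 + \<bar>x\<bar> ^ Suc n)" by (simp add: algebra_simps)
  finally show ?thesis .
qed

lemma lipschitz_linear_growth:
  fixes g :: "real \<Rightarrow> real"
  assumes lip: "\<And>x y. \<bar>g x - g y\<bar> \<le> S * \<bar>x - y\<bar>"
  shows "\<bar>g x\<bar> \<le> (\<bar>g 0\<bar> + S) * (1 + \<bar>x\<bar> ^ 1)"
proof -
  have "0 \<le> S" using order.trans[OF abs_ge_zero lip[of 1 0]] by simp
  moreover have "\<bar>g x\<bar> \<le> \<bar>g 0\<bar> + S * \<bar>x\<bar>" using lip[of x 0] by simp
  moreover have "(\<bar>g 0\<bar> + S) * (1 + \<bar>x\<bar> ^ 1) = \<bar>g 0\<bar> + S * \<bar>x\<bar> + (S + \<bar>g 0\<bar> * \<bar>x\<bar>)"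
    by (simp add: algebra_simps)
  moreover have "0 \<le> \<bar>g 0\<bar> * \<bar>x\<bar>" by simp
  ultimately show ?thesis by linarith
qed

lemma integrable_std_normal_poly:
  fixes g :: "real \<Rightarrow> real"
  assumes "g \<in> borel_measurable borel" "\<And>x. \<bar>g x\<bar> \<le> C * (1 + \<bar>x\<bar> ^ n)"
  shows "integrable lborel (\<lambda>x. std_normal_density x * g x)"
proof (rule integrable_dominated)
  show "integrable lborel (\<lambda>x. C * (std_normal_density x * \<bar>x\<bar> ^ 0) + C * (std_normal_density x * \<bar>x\<bar> ^ n))"
    by (intro integrable_plus integrable_mult_right integrable_std_normal_moment_abs)
  show "\<bar>std_normal_density x * g x\<bar>
     \<le> C * (std_normal_density x * \<bar>x\<bar> ^ 0) + C * (std_normal_density x * \<bar>x\<bar> ^ n)" for x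
    using mult_left_mono[OF assms(2) normal_density_nonneg[of 0 1 x], of x]
    by (simp add: abs_mult algebra_simps)
qed (use assms in measurable)

text \<open>The standard normal density \<open>n\<close> satisfies \<open>n' x = - x * n x\<close>, so the difference of the two
  integrands is the derivative of \<open>n g\<close>, which vanishes at both ends of the line.\<close>

lemma std_normal_integration_by_parts:
  fixes g g' :: "real \<Rightarrow> real"
  assumes deriv: "\<And>x. (g has_real_derivative g' x) (at x)"
    and cont: "continuous_on UNIV g'"
    and growth: "\<And>x. \<bar>g' x\<bar> \<le> K * (1 + \<bar>x\<bar> ^ k)"
  shows "(\<integral>x. std_normal_density x * (x * g x) \<partial>lborel) = (\<integral>x. std_normal_density x * g' x \<partial>lborel)"
proof -
  define C n where "C = \<bar>g 0\<bar> + 2 * K" and "n = Suc k"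
  have bound: "\<bar>g x\<bar> \<le> C * (1 + \<bar>x\<bar> ^ n)" for x
    unfolding C_def n_def by (rule abs_le_of_derivative_growth[OF deriv growth])
  have C: "0 \<le> C" using order.trans[OF abs_ge_zero bound[of 1]] by simp
  have cg: "continuous_on UNIV g"
    using deriv by (meson DERIV_isCont continuous_at_imp_continuous_on)
  have [measurable]: "g \<in> borel_measurable borel" "g' \<in> borel_measurable borel"
    using cont cg by (auto intro: borel_measurable_continuous_onI)
  have i1: "integrable lborel (\<lambda>x. std_normal_density x * (x * g x))"
  proof (rule integrable_std_normal_poly[where C = "2 * C" and n = "Suc n"])
    fix x :: real
    have *: "\<bar>x\<bar> * (1 + \<bar>x\<bar> ^ n) \<le> 2 * (1 + \<bar>x\<bar> ^ Suc n)"
      using abs_le_one_plus_abs_power[of x n] by (simp add: algebra_simps)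
    have "\<bar>x * g x\<bar> \<le> \<bar>x\<bar> * (C * (1 + \<bar>x\<bar> ^ n))"
      using bound[of x] by (simp add: abs_mult mult_left_mono)
    also have "\<dots> \<le> C * (2 * (1 + \<bar>x\<bar> ^ Suc n))"
      using mult_left_mono[OF * C] by (simp add: algebra_simps)
    finally show "\<bar>x * g x\<bar> \<le> 2 * C * (1 + \<bar>x\<bar> ^ Suc n)" by (simp add: algebra_simps)
  qed measurable
  have i2: "integrable lborel (\<lambda>x. std_normal_density x * g' x)"
    by (rule integrable_std_normal_poly[OF _ growth]) measurable
  let ?n = std_normal_density
  have dn: "(?n has_real_derivative - x * ?n x) (at x)" for x
  proof -
    have "((\<lambda>x. 1 / sqrt (2 * pi) * exp (- x\<^sup>2 / 2)) has_real_derivative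
        1 / sqrt (2 * pi) * (exp (- x\<^sup>2 / 2) * (- x))) (at x)"
      by (intro DERIV_cmult) (auto intro!: derivative_eq_intros)
    then show ?thesis by (simp add: std_normal_density_def[abs_def] mult_ac)
  qed
  have F: "((\<lambda>x. ?n x * g x) has_vector_derivative (?n x * g' x - ?n x * (x * g x))) (at x)" for x
    unfolding has_real_derivative_iff_has_vector_derivative[symmetric]
    by (auto intro!: derivative_eq_intros dn deriv simp: algebra_simps)
  have lim: "((\<lambda>x. ?n x * g x) \<longlongrightarrow> 0) F"
    if "F = at_top \<or> F = at_bot" for F
  proof (rule tendsto_0_le[where K = C])
    show "((\<lambda>x. ?n x * (1 + \<bar>x\<bar> ^ n)) \<longlongrightarrow> 0) F"
    proof -
      have t: "((\<lambda>x. ?n x * (1 + \<bar>x\<bar> ^ n)) \<longlongrightarrow> 0) at_top"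
        unfolding std_normal_density_def[abs_def] by real_asymp
      have "((\<lambda>x. ?n x * (1 + \<bar>x\<bar> ^ n)) \<longlongrightarrow> 0) at_bot"
        using t unfolding filterlim_at_bot_mirror by (simp add: std_normal_density_def)
      with t that show ?thesis by auto
    qed
    show "\<forall>\<^sub>F x in F. norm (?n x * g x) \<le> norm (?n x * (1 + \<bar>x\<bar> ^ n)) * C"
    proof (intro always_eventually allI)
      fix x :: real
      have "\<bar>?n x * g x\<bar> \<le> ?n x * (C * (1 + \<bar>x\<bar> ^ n))"
        using mult_left_mono[OF bound normal_density_nonneg[of 0 1]] by (simp add: abs_mult)
      then show "norm (?n x * g x) \<le> norm (?n x * (1 + \<bar>x\<bar> ^ n)) * C"
        using normal_density_nonneg[of 0 1 x] by (simp add: abs_mult mult_ac)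
    qed
  qed
  have "(LBINT x=-\<infinity>..\<infinity>. ?n x * g' x - ?n x * (x * g x)) = 0 - 0"
  proof (rule interval_integral_FTC_integrable[where F = "\<lambda>x. ?n x * g x"])
    show "isCont (\<lambda>x. ?n x * g' x - ?n x * (x * g x)) x" for x
      using cont cg by (auto intro!: continuous_intros simp: std_normal_density_def[abs_def] continuous_on_eq_continuous_at)
    show "set_integrable lborel (einterval (-\<infinity>) \<infinity>) (\<lambda>x. ?n x * g' x - ?n x * (x * g x))"
      using i1 i2 by (simp add: set_integrable_def)
    show "(((\<lambda>x. ?n x * g x) \<circ> real_of_ereal) \<longlongrightarrow> 0) (at_right (-\<infinity>))"
      using lim[of at_bot] by (simp add: ereal_tendsto_simps1)
    show "(((\<lambda>x. ?n x * g x) \<circ> real_of_ereal) \<longlongrightarrow> 0) (at_left \<infinity>)"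
      using lim[of at_top] by (simp add: ereal_tendsto_simps1)
  qed (use F in auto)
  then show ?thesis using i1 i2 by (simp add: set_lebesgue_integral_def interval_lebesgue_integral_def)
qed


text \<open>By the mean value inequality the bound \<open>K\<close> on the derivative dominates all difference quotients,
  so dominated convergence applies along every sequence of increments.\<close>

lemma has_real_derivative_parametric_integral:
  fixes g g' :: "real \<Rightarrow> 'a \<Rightarrow> real"
  assumes int: "\<And>t. integrable M (g t)"
    and deriv: "\<And>t x. x \<in> space M \<Longrightarrow> ((\<lambda>t. g t x) has_real_derivative g' t x) (at t)"
    and meas: "g' t \<in> borel_measurable M"
    and bound: "\<And>t x. x \<in> space M \<Longrightarrow> \<bar>g' t x\<bar> \<le> K x" and K: "integrable M K"
  shows "((\<lambda>t. \<integral>x. g t x \<partial>M) has_real_derivative (\<integral>x. g' t x \<partial>M)) (at t)"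
  unfolding DERIV_def
proof (subst LIMSEQ_SEQ_conv[symmetric], intro allI impI)
  fix S :: "nat \<Rightarrow> real" assume S: "(\<forall>n. S n \<noteq> 0) \<and> S \<longlonglongrightarrow> 0"
  have "(\<lambda>n. \<integral>x. (g (t + S n) x - g t x) / S n \<partial>M) \<longlonglongrightarrow> (\<integral>x. g' t x \<partial>M)"
  proof (rule integral_dominated_convergence[where w = K])
    show "AE x in M. (\<lambda>n. (g (t + S n) x - g t x) / S n) \<longlonglongrightarrow> g' t x"
    proof (rule AE_I2)
      fix x assume "x \<in> space M"
      from deriv[OF this, of t, unfolded DERIV_def] S
      show "(\<lambda>n. (g (t + S n) x - g t x) / S n) \<longlonglongrightarrow> g' t x"
        by (subst (asm) LIMSEQ_SEQ_conv[symmetric]) blast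
    qed
    show "AE x in M. norm ((g (t + S n) x - g t x) / S n) \<le> K x" for n
    proof (rule AE_I2)
      fix x assume x: "x \<in> space M"
      have "norm (g (t + S n) x - g t x) \<le> K x * norm (t + S n - t)"
        using deriv[OF x] bound[OF x]
        by (intro field_differentiable_bound[of UNIV "\<lambda>t. g t x" "\<lambda>t. g' t x"]) auto
      then show "norm ((g (t + S n) x - g t x) / S n) \<le> K x"
        using S by (simp add: divide_le_eq)
    qed
  qed (use int meas K in \<open>auto intro!: borel_measurable_integrable\<close>)
  then show "(\<lambda>n. ((\<integral>x. g (t + S n) x \<partial>M) - (\<integral>x. g t x \<partial>M)) / S n) \<longlonglongrightarrow> (\<integral>x. g' t x \<partial>M)"
    using int by simp
qed

lemma (in prob_space) integrable_pair_fst: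
  fixes f :: "'a \<Rightarrow> real"
  assumes "prob_space N" and f: "integrable M f"
  shows "integrable (M \<Otimes>\<^sub>M N) (\<lambda>p. f (fst p))" "(\<integral>p. f (fst p) \<partial>(M \<Otimes>\<^sub>M N)) = expectation f"
proof -
  interpret N: prob_space N by fact
  interpret P: pair_prob_space M N ..
  have [measurable]: "f \<in> borel_measurable M" using f by simp
  show i: "integrable (M \<Otimes>\<^sub>M N) (\<lambda>p. f (fst p))"
    by (rule P.Fubini_integrable) (use f in \<open>auto simp: N.prob_space\<close>)
  show "(\<integral>p. f (fst p) \<partial>(M \<Otimes>\<^sub>M N)) = expectation f"
    using P.integral_fst'[OF i] by (simp add: N.prob_space)
qed

lemma (in prob_space) integrable_pair_snd:
  fixes g :: "'b \<Rightarrow> real"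
  assumes "prob_space N" and g: "integrable N g"
  shows "integrable (M \<Otimes>\<^sub>M N) (\<lambda>p. g (snd p))" "(\<integral>p. g (snd p) \<partial>(M \<Otimes>\<^sub>M N)) = (\<integral>y. g y \<partial>N)"
proof -
  interpret N: prob_space N by fact
  interpret P: pair_prob_space M N ..
  have [measurable]: "g \<in> borel_measurable N" using g by simp
  show i: "integrable (M \<Otimes>\<^sub>M N) (\<lambda>p. g (snd p))"
    by (rule P.Fubini_integrable) (use g in \<open>auto simp: prob_space\<close>)
  show "(\<integral>p. g (snd p) \<partial>(M \<Otimes>\<^sub>M N)) = (\<integral>y. g y \<partial>N)"
    using P.integral_fst'[OF i] by (simp add: prob_space)
qed

lemma power_le_one_plus_power4:
  fixes u :: real
  assumes "0 \<le> u" "k \<le> 4"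
  shows "u ^ k \<le> 1 + u ^ 4"
proof (cases "u \<le> 1")
  case True
  then have "u ^ k \<le> 1" using assms by (simp add: power_le_one)
  then show ?thesis using zero_le_power[OF assms(1), of 4] by linarith
next
  case False
  then have "u ^ k \<le> u ^ 4" using assms by (intro power_increasing) auto
  then show ?thesis by simp
qed

lemma abs_add_power_le:
  fixes x z :: real
  assumes "k \<le> 4"
  shows "(\<bar>x\<bar> + \<bar>z\<bar>) ^ k \<le> 1 + 8 * x ^ 4 + 8 * z ^ 4"
  using power_le_one_plus_power4[OF _ assms, of "\<bar>x\<bar> + \<bar>z\<bar>"] add_power4_le[of "\<bar>x\<bar>" "\<bar>z\<bar>"]
  by simp

lemma sq_integrable_dominated:
  assumes "f \<in> borel_measurable M" "integrable M K" "\<And>x. (f x)\<^sup>2 \<le> K x"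
  shows "sq_integrable M f"
  using integrable_dominated[OF assms(2), of "\<lambda>x. (f x)\<^sup>2"] assms(1,3) by (simp add: sq_integrable_def)

lemma lipschitz_imp_continuous:
  fixes g :: "real \<Rightarrow> real"
  assumes lip: "\<And>x y. \<bar>g x - g y\<bar> \<le> S * \<bar>x - y\<bar>"
  shows "continuous_on UNIV g"
proof (intro continuous_at_imp_continuous_on ballI)
  fix x
  have "((\<lambda>h. g (x + h) - g x) \<longlongrightarrow> 0) (at 0)"
  proof (rule tendsto_0_le[of "\<lambda>h::real. h" _ _ S])
    have "norm (g (x + h) - g x) \<le> norm h * S" for h
      using lip[of "x + h" x] by (simp add: mult.commute)
    then show "\<forall>\<^sub>F h in at 0. norm (g (x + h) - g x) \<le> norm h * S" by simp
  qed simp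
  then show "isCont g x" unfolding isCont_iff by (rule LIM_zero_cancel)
qed

text \<open>The rotation \<open>Y \<theta> = cos \<theta> F + sin \<theta> Z\<close>, with \<open>Z\<close> standard normal and independent of \<open>F\<close>,
  moves from \<open>F\<close> to \<open>Z\<close> as \<open>\<theta>\<close> runs from \<open>0\<close> to \<open>\<pi>/2\<close> and keeps the second moment equal to \<open>1\<close>.
  The derivative of \<open>E \<phi>(Y \<theta>)\<close> is
  \<open>cos \<theta> E(Z \<phi>'(Y \<theta>)) - sin \<theta> E(F \<phi>'(Y \<theta>))\<close>.  Gaussian integration by parts turns the first
  expectation into \<open>sin \<theta> E(\<phi>''(Y \<theta>))\<close>, and the approximate Stein identity for \<open>F\<close>, applied for each
  fixed value of \<open>Z\<close>, turns the second one into \<open>cos \<theta> E(\<phi>''(Y \<theta>) G)\<close> up to an error.  What remains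
  is \<open>E(\<phi>''(Y \<theta>) (1 - G))\<close>.  Since \<open>\<phi>''\<close> grows at most linearly, it is controlled by the
  Cauchy-Schwarz inequality.  The angle as parameter, in place of the usual \<open>sqrt (1 - t)\<close> and \<open>sqrt t\<close>,
  avoids singular derivatives at the end points.\<close>

lemma (in prob_space) smart_path_bound:
  fixes F G :: "'a \<Rightarrow> real" and \<phi> \<phi>1 \<phi>2 :: "real \<Rightarrow> real"
  assumes F: "L4_integrable M F" "expectation (\<lambda>\<omega>. (F \<omega>)\<^sup>2) = 1"
    and G: "sq_integrable M G"
    and d0: "\<And>x. (\<phi> has_real_derivative \<phi>1 x) (at x)"
    and d1: "\<And>x. (\<phi>1 has_real_derivative \<phi>2 x) (at x)"
    and lip: "\<And>x y. \<bar>\<phi>2 x - \<phi>2 y\<bar> \<le> S * \<bar>x - y\<bar>"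
    and stein: "\<And>h h' L. (\<And>x. (h has_real_derivative h' x) (at x)) \<Longrightarrow>
        (\<And>x y. \<bar>h' x - h' y\<bar> \<le> L * \<bar>x - y\<bar>) \<Longrightarrow>
        \<bar>expectation (\<lambda>\<omega>. F \<omega> * h (F \<omega>)) - expectation (\<lambda>\<omega>. h' (F \<omega>) * G \<omega>)\<bar> \<le> L * e"
  shows "\<bar>expectation (\<lambda>\<omega>. \<phi> (F \<omega>)) - (\<integral>z. \<phi> z \<partial>std_normal_distribution)\<bar>
    \<le> pi / 2 * (S * e + (\<bar>\<phi>2 0\<bar> + S) * sqrt (expectation (\<lambda>\<omega>. (1 - G \<omega>)\<^sup>2)))"
proof -
  let ?\<nu> = std_normal_distribution
  interpret N: prob_space ?\<nu> by (rule prob_space_normal_density) simp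
  interpret P: pair_prob_space M ?\<nu> ..
  let ?P = "M \<Otimes>\<^sub>M ?\<nu>"
  note pair_fst = integrable_pair_fst[OF N.prob_space_axioms]
  note pair_snd = integrable_pair_snd[OF N.prob_space_axioms]
  have S: "0 \<le> S" using order.trans[OF abs_ge_zero lip[of 1 0]] by simp
  have e: "0 \<le> e" using stein[of "\<lambda>_. 0" "\<lambda>_. 0" 1] by simp
  have [measurable]: "F \<in> borel_measurable M" "G \<in> borel_measurable M"
    using F G by (auto simp: L4_integrable_def sq_integrable_def)
  have cont2: "continuous_on UNIV \<phi>2" by (rule lipschitz_imp_continuous[OF lip])
  have cont1: "continuous_on UNIV \<phi>1" and cont0: "continuous_on UNIV \<phi>"
    using d0 d1 by (meson DERIV_isCont continuous_at_imp_continuous_on)+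
  note [measurable] = cont0[THEN borel_measurable_continuous_onI] cont1[THEN borel_measurable_continuous_onI]
    cont2[THEN borel_measurable_continuous_onI]
  \<comment> \<open>Polynomial growth of \<open>\<phi>\<close> and its derivatives.\<close>
  define C where "C = \<bar>\<phi> 0\<bar> + 2 * (\<bar>\<phi>1 0\<bar> + 2 * (\<bar>\<phi>2 0\<bar> + S))"
  note g2 = lipschitz_linear_growth[OF lip]
  note g1 = abs_le_of_derivative_growth[OF d1 g2]
  note g0 = abs_le_of_derivative_growth[OF d0 g1]
  have C: "0 \<le> C" using S by (simp add: C_def)
  have c2: "\<bar>\<phi>2 x\<bar> \<le> C * (1 + \<bar>x\<bar>)" for x
  proof -
    have "(\<bar>\<phi>2 0\<bar> + S) * (1 + \<bar>x\<bar>) \<le> C * (1 + \<bar>x\<bar>)" using S by (intro mult_right_mono) (auto simp: C_def)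
    then show ?thesis using g2[of x] by simp
  qed
  have c1: "\<bar>\<phi>1 x\<bar> \<le> C * (1 + \<bar>x\<bar> ^ 2)" for x
  proof -
    have "(\<bar>\<phi>1 0\<bar> + 2 * (\<bar>\<phi>2 0\<bar> + S)) * (1 + \<bar>x\<bar>^2) \<le> C * (1 + \<bar>x\<bar>^2)"
      using S by (intro mult_right_mono) (auto simp: C_def)
    then show ?thesis using g1[of x] by (simp add: numeral_2_eq_2)
  qed
  have c0: "\<bar>\<phi> x\<bar> \<le> C * (1 + \<bar>x\<bar> ^ 3)" for x
    using g0[of x] by (simp add: C_def eval_nat_numeral)
  \<comment> \<open>One dominating function, of degree four, for all integrands on the path.\<close>
  define K where "K p = 2 * C * (1 + 8 * (F (fst p))^4 + 8 * (snd p)^4)" for p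
  have intZ: "integrable ?\<nu> (\<lambda>z. z ^ k)" for k
    using integrable_std_normal_moment[of k] by (subst integrable_density) auto
  have intB: "integrable ?P (\<lambda>p. 1 + 8 * (F (fst p))^4 + 8 * (snd p)^4)"
    using pair_fst(1)[of "\<lambda>\<omega>. (F \<omega>)^4"] pair_snd(1)[OF intZ[of 4]] F
    by (intro integrable_plus) (auto simp: L4_integrable_def)
  have intK: "integrable ?P K" unfolding K_def[abs_def] by (rule integrable_mult_right[OF intB])
  define Y where "Y \<theta> p = cos \<theta> * F (fst p) + sin \<theta> * snd p" for \<theta> p
  define u where "u p = \<bar>F (fst p)\<bar> + \<bar>snd p\<bar>" for p
  have u0: "0 \<le> u p" for p by (simp add: u_def)
  have [measurable]: "Y \<theta> \<in> borel_measurable ?P" "u \<in> borel_measurable ?P" for \<theta>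
    unfolding Y_def[abs_def] u_def[abs_def] by measurable
  have trig: "\<bar>cos \<theta> * a\<bar> \<le> \<bar>a\<bar>" "\<bar>sin \<theta> * a\<bar> \<le> \<bar>a\<bar>" for \<theta> a :: real
    unfolding abs_mult by (rule mult_left_le_one_le; simp)+
  have Yu: "\<bar>Y \<theta> p\<bar> \<le> u p" for \<theta> p
    unfolding Y_def u_def by (intro order.trans[OF abs_triangle_ineq] add_mono trig)
  have Kpow: "C * (u p ^ j + u p ^ k) \<le> K p" if "j \<le> 4" "k \<le> 4" for p j k
  proof -
    have "u p ^ j + u p ^ k \<le> 2 * (1 + 8 * (F (fst p))^4 + 8 * (snd p)^4)"
      using add_mono[OF abs_add_power_le[OF that(1), of "F (fst p)" "snd p"]
        abs_add_power_le[OF that(2), of "F (fst p)" "snd p"]] unfolding u_def mult_2 .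
    from mult_left_mono[OF this C] show ?thesis by (simp add: K_def mult_ac)
  qed
  have b0: "\<bar>\<phi> (Y \<theta> p)\<bar> \<le> K p" for \<theta> p
  proof -
    have "\<bar>\<phi> (Y \<theta> p)\<bar> \<le> C * (1 + u p ^ 3)"
      by (rule order.trans[OF c0]) (intro mult_left_mono add_left_mono power_mono Yu C abs_ge_zero)
    also have "\<dots> = C * (u p ^ 0 + u p ^ 3)" by simp
    also have "\<dots> \<le> K p" by (rule Kpow) auto
    finally show ?thesis .
  qed
  have b1: "\<bar>\<phi>1 (Y \<theta> p) * v\<bar> \<le> K p" if "\<bar>v\<bar> \<le> u p" for \<theta> p v
  proof -
    have "\<bar>\<phi>1 (Y \<theta> p)\<bar> \<le> C * (1 + u p ^ 2)"
      by (rule order.trans[OF c1]) (intro mult_left_mono add_left_mono power_mono Yu C abs_ge_zero)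
    then have "\<bar>\<phi>1 (Y \<theta> p) * v\<bar> \<le> C * (1 + u p ^ 2) * u p"
      unfolding abs_mult using that u0 C by (intro mult_mono) auto
    also have "\<dots> = C * (u p ^ 1 + u p ^ 3)" by (simp add: algebra_simps eval_nat_numeral)
    also have "\<dots> \<le> K p" by (rule Kpow) auto
    finally show ?thesis .
  qed
  have b2: "(\<phi>2 (Y \<theta> p))\<^sup>2 \<le> 2 * C * K p" for \<theta> p
  proof -
    have "\<bar>\<phi>2 (Y \<theta> p)\<bar> \<le> C * (1 + u p)"
      by (rule order.trans[OF c2]) (intro mult_left_mono add_left_mono Yu C)
    then have "(\<phi>2 (Y \<theta> p))\<^sup>2 \<le> (C * (1 + u p))\<^sup>2"
      using abs_le_square_iff[of "\<phi>2 (Y \<theta> p)" "C * (1 + u p)"] u0 C by simp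
    also have "\<dots> \<le> 2 * C * (C * (u p ^ 0 + u p ^ 2))"
    proof -
      have "(1 + u p)\<^sup>2 \<le> 2 * (1 + u p ^ 2)" using sum_squares_bound[of 1 "u p"] by (simp add: power2_sum)
      from mult_left_mono[OF this, of "C\<^sup>2"] show ?thesis by (simp add: power_mult_distrib power2_eq_square mult_ac)
    qed
    also have "\<dots> \<le> 2 * C * K p" using C by (intro mult_left_mono Kpow) auto
    finally show ?thesis .
  qed
  have bY: "(Y \<theta> p)\<^sup>2 \<le> 1 + 8 * (F (fst p))^4 + 8 * (snd p)^4" for \<theta> p
    using abs_add_power_le[of 2 "F (fst p)" "snd p"] power_mono[OF Yu[of \<theta> p], of 2] by (simp add: u_def)
  have sqY: "sq_integrable ?P (Y \<theta>)" for \<theta>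
    by (rule sq_integrable_dominated[OF _ intB bY]) measurable
  have sq2: "sq_integrable ?P (\<lambda>p. \<phi>2 (Y \<theta> p))" for \<theta>
    by (rule sq_integrable_dominated[OF _ integrable_mult_right[OF intK, of "2 * C"] b2]) measurable
  have sqG: "sq_integrable ?P (\<lambda>p. G (fst p))"
    using pair_fst(1)[of "\<lambda>\<omega>. (G \<omega>)\<^sup>2"] G by (auto simp: sq_integrable_def)
  have sq1: "sq_integrable ?P (\<lambda>p. 1 - G (fst p))"
    using sq_integrable_add[OF P.sq_integrable_const[of 1] sq_integrable_scale[OF sqG, of "-1"]] by simp
  have sq1M: "sq_integrable M (\<lambda>\<omega>. 1 - G \<omega>)"
    using sq_integrable_add[OF sq_integrable_const[of 1] sq_integrable_scale[OF G, of "-1"]] by simp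
  have int0: "integrable ?P (\<lambda>p. \<phi> (Y \<theta> p))" for \<theta>
    by (rule integrable_dominated[OF intK _ b0]) measurable
  have intF1: "integrable ?P (\<lambda>p. \<phi>1 (Y \<theta> p) * F (fst p))" for \<theta>
    by (rule integrable_dominated[OF intK _ b1]) (auto simp: u_def)
  have intZ1: "integrable ?P (\<lambda>p. \<phi>1 (Y \<theta> p) * snd p)" for \<theta>
    by (rule integrable_dominated[OF intK _ b1]) (auto simp: u_def)
  define \<Psi> where "\<Psi> \<theta> = (\<integral>p. \<phi> (Y \<theta> p) \<partial>?P)" for \<theta>
  define \<Psi>' where "\<Psi>' \<theta> = (\<integral>p. \<phi>1 (Y \<theta> p) * (- sin \<theta> * F (fst p) + cos \<theta> * snd p) \<partial>?P)" for \<theta>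
  have der: "(\<Psi> has_real_derivative \<Psi>' \<theta>) (at \<theta>)" for \<theta>
    unfolding \<Psi>_def[abs_def] \<Psi>'_def
  proof (rule has_real_derivative_parametric_integral[OF int0 _ _ _ intK])
    show "((\<lambda>t. \<phi> (Y t p)) has_real_derivative \<phi>1 (Y t p) * (- sin t * F (fst p) + cos t * snd p)) (at t)" for t p
      unfolding Y_def by (rule DERIV_chain2[OF d0]) (auto intro!: derivative_eq_intros)
    show "\<bar>\<phi>1 (Y t p) * (- sin t * F (fst p) + cos t * snd p)\<bar> \<le> K p" for t p
    proof (rule b1)
      have "\<bar>- sin t * F (fst p) + cos t * snd p\<bar> \<le> \<bar>sin t * F (fst p)\<bar> + \<bar>cos t * snd p\<bar>"
        by (rule order.trans[OF abs_triangle_ineq]) simp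
      then show "\<bar>- sin t * F (fst p) + cos t * snd p\<bar> \<le> u p"
        using trig(2)[of t "F (fst p)"] trig(1)[of t "snd p"] unfolding u_def by linarith
    qed
  qed measurable
  have ibp: "(\<integral>p. \<phi>1 (Y \<theta> p) * snd p \<partial>?P) = sin \<theta> * (\<integral>p. \<phi>2 (Y \<theta> p) \<partial>?P)" for \<theta>
  proof -
    have *: "(\<integral>z. \<phi>1 (Y \<theta> (\<omega>, z)) * z \<partial>?\<nu>) = (\<integral>z. sin \<theta> * \<phi>2 (Y \<theta> (\<omega>, z)) \<partial>?\<nu>)" for \<omega>
    proof -
      let ?g = "\<lambda>z. \<phi>1 (cos \<theta> * F \<omega> + sin \<theta> * z)" and ?g' = "\<lambda>z. sin \<theta> * \<phi>2 (cos \<theta> * F \<omega> + sin \<theta> * z)"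
      have dg: "(?g has_real_derivative ?g' z) (at z)" for z
        by (rule DERIV_cong[OF DERIV_chain2[OF d1, where s = UNIV]]) (auto intro!: derivative_eq_intros)
      have cg: "continuous_on UNIV ?g'"
        by (intro continuous_intros continuous_on_compose2[OF cont2]) auto
      have bg': "\<bar>?g' z\<bar> \<le> C * (1 + \<bar>F \<omega>\<bar>) * (1 + \<bar>z\<bar> ^ 1)" for z
      proof -
        have "\<bar>?g' z\<bar> \<le> \<bar>\<phi>2 (cos \<theta> * F \<omega> + sin \<theta> * z)\<bar>" by (rule trig)
        also have "\<dots> \<le> C * (1 + u (\<omega>, z))"
          using order.trans[OF c2 mult_left_mono[OF add_left_mono[OF Yu[of \<theta> "(\<omega>, z)"]] C]] by (simp add: Y_def)
        also have "\<dots> \<le> C * ((1 + \<bar>F \<omega>\<bar>) * (1 + \<bar>z\<bar> ^ 1))"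
          using C by (intro mult_left_mono) (auto simp: u_def algebra_simps)
        finally show ?thesis by (simp add: mult.assoc)
      qed
      have "(\<integral>z. std_normal_density z * (z * ?g z) \<partial>lborel) = (\<integral>z. std_normal_density z * ?g' z \<partial>lborel)"
        by (rule std_normal_integration_by_parts[OF dg cg bg'])
      then show ?thesis
        by (simp add: Y_def integral_density mult_ac)
    qed
    have int2: "integrable ?P (\<lambda>p. \<phi>2 (Y \<theta> p))" by (rule P.sq_integrable_imp_integrable[OF sq2])
    have "(\<integral>p. \<phi>1 (Y \<theta> p) * snd p \<partial>?P) = (\<integral>\<omega>. \<integral>z. \<phi>1 (Y \<theta> (\<omega>, z)) * z \<partial>?\<nu> \<partial>M)"
      using P.integral_fst'[OF intZ1] by simp
    also have "\<dots> = (\<integral>\<omega>. \<integral>z. sin \<theta> * \<phi>2 (Y \<theta> (\<omega>, z)) \<partial>?\<nu> \<partial>M)" by (simp only: *)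
    also have "\<dots> = (\<integral>p. sin \<theta> * \<phi>2 (Y \<theta> p) \<partial>?P)"
      by (rule P.integral_fst'[OF integrable_mult_right[OF int2]])
    finally show ?thesis by simp
  qed
  have step: "\<bar>(\<integral>p. cos \<theta> * (\<phi>2 (Y \<theta> p) * G (fst p)) \<partial>?P) - (\<integral>p. \<phi>1 (Y \<theta> p) * F (fst p) \<partial>?P)\<bar> \<le> (cos \<theta>)\<^sup>2 * S * e" for \<theta>
  proof -
    define A where "A z = (\<integral>\<omega>. cos \<theta> * (\<phi>2 (Y \<theta> (\<omega>, z)) * G \<omega>) \<partial>M)" for z
    define B where "B z = (\<integral>\<omega>. \<phi>1 (Y \<theta> (\<omega>, z)) * F \<omega> \<partial>M)" for z
    have i2G: "integrable ?P (\<lambda>p. cos \<theta> * (\<phi>2 (Y \<theta> p) * G (fst p)))"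
      by (intro integrable_mult_right integrable_mult_of_sq_integrable sq2 sqG)
    have bnd: "\<bar>A z - B z\<bar> \<le> (cos \<theta>)\<^sup>2 * S * e" for z
    proof -
      let ?y = "\<lambda>x. cos \<theta> * x + sin \<theta> * z"
      have "\<bar>expectation (\<lambda>\<omega>. F \<omega> * \<phi>1 (?y (F \<omega>))) -
           expectation (\<lambda>\<omega>. (cos \<theta> * \<phi>2 (?y (F \<omega>))) * G \<omega>)\<bar> \<le> (cos \<theta>)\<^sup>2 * S * e"
      proof (rule stein)
        fix x y
        show "((\<lambda>x. \<phi>1 (?y x)) has_real_derivative cos \<theta> * \<phi>2 (?y x)) (at x)"
          by (rule DERIV_cong[OF DERIV_chain2[OF d1, where s = UNIV]]) (auto intro!: derivative_eq_intros)
        have "\<bar>cos \<theta> * \<phi>2 (?y x) - cos \<theta> * \<phi>2 (?y y)\<bar>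
          = \<bar>cos \<theta>\<bar> * \<bar>\<phi>2 (?y x) - \<phi>2 (?y y)\<bar>"
          by (simp flip: abs_mult add: right_diff_distrib)
        also have "\<dots> \<le> \<bar>cos \<theta>\<bar> * (S * \<bar>(?y x) - (?y y)\<bar>)"
          by (intro mult_left_mono lip) auto
        also have "\<dots> = \<bar>cos \<theta>\<bar> * (S * (\<bar>cos \<theta>\<bar> * \<bar>x - y\<bar>))" by (simp flip: abs_mult add: right_diff_distrib)
        also have "\<dots> = \<bar>cos \<theta>\<bar> * \<bar>cos \<theta>\<bar> * S * \<bar>x - y\<bar>" by simp
        also have "\<dots> = (cos \<theta>)\<^sup>2 * S * \<bar>x - y\<bar>" by (simp add: power2_eq_square)
        finally show "\<bar>cos \<theta> * \<phi>2 (?y x) - cos \<theta> * \<phi>2 (?y y)\<bar>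
          \<le> (cos \<theta>)\<^sup>2 * S * \<bar>x - y\<bar>" .
      qed
      then show ?thesis by (subst abs_minus_commute) (simp add: A_def B_def Y_def mult_ac)
    qed
    have swap: "integrable ?\<nu> (\<lambda>z. \<integral>\<omega>. q (\<omega>, z) \<partial>M)"
        "(\<integral>z. \<integral>\<omega>. q (\<omega>, z) \<partial>M \<partial>?\<nu>) = (\<integral>p. q p \<partial>?P)"
      if "integrable ?P q" for q :: "'a \<times> real \<Rightarrow> real"
      using P.integrable_snd[of "\<lambda>x y. q (x, y)"] P.integral_snd[of "\<lambda>x y. q (x, y)"] that
      by (simp_all only: case_prod_eta)
    have i1: "integrable ?\<nu> A"
      using swap(1)[OF i2G] by (simp only: fst_conv A_def[abs_def])
    have s1: "(\<integral>z. A z \<partial>?\<nu>) = (\<integral>p. cos \<theta> * (\<phi>2 (Y \<theta> p) * G (fst p)) \<partial>?P)"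
      using swap(2)[OF i2G] by (simp only: fst_conv A_def)
    have i2: "integrable ?\<nu> B"
      using swap(1)[OF intF1] by (simp only: fst_conv B_def[abs_def])
    have s2: "(\<integral>z. B z \<partial>?\<nu>) = (\<integral>p. \<phi>1 (Y \<theta> p) * F (fst p) \<partial>?P)"
      using swap(2)[OF intF1] by (simp only: fst_conv B_def)
    have "A z \<le> B z + (cos \<theta>)\<^sup>2 * S * e" "B z \<le> A z + (cos \<theta>)\<^sup>2 * S * e" for z
      using bnd[of z] by linarith+
    then have "(\<integral>z. A z \<partial>?\<nu>) \<le> (\<integral>z. B z + (cos \<theta>)\<^sup>2 * S * e \<partial>?\<nu>)"
        "(\<integral>z. B z \<partial>?\<nu>) \<le> (\<integral>z. A z + (cos \<theta>)\<^sup>2 * S * e \<partial>?\<nu>)"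
      using i1 i2 by (intro integral_mono; simp)+
    moreover have "(\<integral>z. B z + c \<partial>?\<nu>) = (\<integral>z. B z \<partial>?\<nu>) + c" "(\<integral>z. A z + c \<partial>?\<nu>) = (\<integral>z. A z \<partial>?\<nu>) + c" for c :: real
      using i1 i2 N.prob_space by simp_all
    ultimately show ?thesis unfolding s1[symmetric] s2[symmetric] by (simp add: abs_le_iff)
  qed
  define V where "V = expectation (\<lambda>\<omega>. (1 - G \<omega>)\<^sup>2)"
  have V: "(\<integral>p. (1 - G (fst p))\<^sup>2 \<partial>?P) = V" "0 \<le> V"
    using pair_fst(2)[of "\<lambda>\<omega>. (1 - G \<omega>)\<^sup>2"] sq1M
    by (auto simp: V_def sq_integrable_def)
  have EY: "(\<integral>p. (Y \<theta> p)\<^sup>2 \<partial>?P) = 1" for \<theta>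
  proof -
    have F2: "sq_integrable M F" by (rule L4_integrable_imp_sq_integrable[OF F(1)])
    then have iF: "integrable M (\<lambda>\<omega>. (F \<omega>)\<^sup>2)" by (simp add: sq_integrable_def)
    have Zm: "(\<integral>z. z \<partial>?\<nu>) = 0" "(\<integral>z. z\<^sup>2 \<partial>?\<nu>) = 1"
      using integral_std_normal_moment_odd[of 0] integral_std_normal_moment_even[of 1]
      by (simp_all add: integral_density)
    note iZ = intZ[of 2]
    have FZ: "integrable ?P (\<lambda>p. F (fst p) * snd p)"
    proof (rule integrable_mult_of_sq_integrable)
      show "sq_integrable ?P (\<lambda>p. F (fst p))"
        using pair_fst(1)[OF iF] by (simp add: sq_integrable_def)
      show "sq_integrable ?P snd"
        using pair_snd(1)[OF iZ] by (simp add: sq_integrable_def)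
    qed
    have FZ0: "(\<integral>p. F (fst p) * snd p \<partial>?P) = 0"
    proof -
      have "(\<integral>p. F (fst p) * snd p \<partial>?P) = (\<integral>\<omega>. \<integral>z. F \<omega> * z \<partial>?\<nu> \<partial>M)"
        using P.integral_fst'[OF FZ] by (simp only: fst_conv snd_conv)
      also have "\<dots> = (\<integral>\<omega>. F \<omega> * (\<integral>z. z \<partial>?\<nu>) \<partial>M)" by (simp only: integral_mult_right_zero)
      finally show ?thesis by (simp add: Zm(1))
    qed
    have FF: "(\<integral>p. (F (fst p))\<^sup>2 \<partial>?P) = 1"
      using pair_fst(2)[OF iF] F(2) by (rule trans)
    have ZZ: "(\<integral>p. (snd p)\<^sup>2 \<partial>?P) = 1"
      using pair_snd(2)[OF iZ] Zm(2) by (rule trans)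
    have "(\<integral>p. (Y \<theta> p)\<^sup>2 \<partial>?P) = (\<integral>p. (cos \<theta>)\<^sup>2 * (F (fst p))\<^sup>2 + (sin \<theta>)\<^sup>2 * (snd p)\<^sup>2 + 2 * cos \<theta> * sin \<theta> * (F (fst p) * snd p) \<partial>?P)"
      by (intro Bochner_Integration.integral_cong) (auto simp: Y_def power2_sum power_mult_distrib)
    also have "\<dots> = (cos \<theta>)\<^sup>2 * (\<integral>p. (F (fst p))\<^sup>2 \<partial>?P) + (sin \<theta>)\<^sup>2 * (\<integral>p. (snd p)\<^sup>2 \<partial>?P)
        + 2 * cos \<theta> * sin \<theta> * (\<integral>p. F (fst p) * snd p \<partial>?P)"
      by (simp only: Bochner_Integration.integral_add integral_mult_right_zero integrable_plus
          integrable_mult_right FZ pair_fst(1)[OF iF]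
          pair_snd(1)[OF iZ])
    also have "\<dots> = 1"
      by (simp only: FF ZZ FZ0 mult_1_right mult_zero_right add_0_right sin_cos_squared_add2)
    finally show ?thesis .
  qed
  have main: "\<bar>\<Psi>' \<theta>\<bar> \<le> S * e + (\<bar>\<phi>2 0\<bar> + S) * sqrt V" for \<theta>
  proof -
    have int2: "integrable ?P (\<lambda>p. \<phi>2 (Y \<theta> p))" by (rule P.sq_integrable_imp_integrable[OF sq2])
    have int2G: "integrable ?P (\<lambda>p. \<phi>2 (Y \<theta> p) * G (fst p))"
      by (intro integrable_mult_of_sq_integrable sq2 sqG)
    have int21: "integrable ?P (\<lambda>p. \<phi>2 (Y \<theta> p) * (1 - G (fst p)))"
      by (intro integrable_mult_of_sq_integrable sq2 sq1)
    define I1 I2 I3 I4 where "I1 = (\<integral>p. \<phi>1 (Y \<theta> p) * F (fst p) \<partial>?P)" and "I2 = (\<integral>p. \<phi>2 (Y \<theta> p) \<partial>?P)"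
      and "I3 = (\<integral>p. \<phi>2 (Y \<theta> p) * G (fst p) \<partial>?P)" and "I4 = (\<integral>p. \<phi>2 (Y \<theta> p) * (1 - G (fst p)) \<partial>?P)"
    have "\<Psi>' \<theta> = (\<integral>p. - sin \<theta> * (\<phi>1 (Y \<theta> p) * F (fst p)) + cos \<theta> * (\<phi>1 (Y \<theta> p) * snd p) \<partial>?P)"
      unfolding \<Psi>'_def by (intro Bochner_Integration.integral_cong) (auto simp: algebra_simps)
    also have "\<dots> = - sin \<theta> * I1 + cos \<theta> * (sin \<theta> * I2)"
      using intF1 intZ1 by (simp add: I1_def I2_def ibp)
    finally have 1: "\<Psi>' \<theta> = - sin \<theta> * I1 + cos \<theta> * (sin \<theta> * I2)" .
    have "I4 = (\<integral>p. \<phi>2 (Y \<theta> p) - \<phi>2 (Y \<theta> p) * G (fst p) \<partial>?P)"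
      unfolding I4_def by (intro Bochner_Integration.integral_cong) (auto simp: algebra_simps)
    then have 2: "I4 = I2 - I3" using int2 int2G by (simp add: I2_def I3_def)
    have 3: "\<Psi>' \<theta> = sin \<theta> * cos \<theta> * I4 + sin \<theta> * (cos \<theta> * I3 - I1)" unfolding 1 2 by (simp add: algebra_simps)
    have "\<bar>cos \<theta> * I3 - I1\<bar> \<le> (cos \<theta>)\<^sup>2 * S * e" using step[of \<theta>] by (simp add: I1_def I3_def)
    also have "\<dots> \<le> 1 * S * e" using S e by (intro mult_right_mono) (auto simp: abs_square_le_1)
    finally have 4: "\<bar>sin \<theta> * (cos \<theta> * I3 - I1)\<bar> \<le> S * e" using trig(2)[of \<theta> "cos \<theta> * I3 - I1"] by simp
    have "\<bar>I4\<bar> \<le> (\<integral>p. \<bar>\<phi>2 (Y \<theta> p) * (1 - G (fst p))\<bar> \<partial>?P)" unfolding I4_def by (rule integral_abs_bound)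
    also have "\<dots> \<le> (\<integral>p. \<bar>\<phi>2 0\<bar> * \<bar>1 * (1 - G (fst p))\<bar> + S * \<bar>Y \<theta> p * (1 - G (fst p))\<bar> \<partial>?P)"
    proof (rule integral_mono)
      show "integrable ?P (\<lambda>p. \<bar>\<phi>2 0\<bar> * \<bar>1 * (1 - G (fst p))\<bar> + S * \<bar>Y \<theta> p * (1 - G (fst p))\<bar>)"
        using integrable_mult_of_sq_integrable[OF sqY sq1, of \<theta>] P.sq_integrable_imp_integrable[OF sq1]
        by (intro integrable_plus integrable_mult_right integrable_abs) simp_all
      show "\<bar>\<phi>2 (Y \<theta> p) * (1 - G (fst p))\<bar> \<le> \<bar>\<phi>2 0\<bar> * \<bar>1 * (1 - G (fst p))\<bar> + S * \<bar>Y \<theta> p * (1 - G (fst p))\<bar>" for p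
      proof -
        have "\<bar>\<phi>2 (Y \<theta> p)\<bar> \<le> \<bar>\<phi>2 0\<bar> + S * \<bar>Y \<theta> p\<bar>" using lip[of "Y \<theta> p" 0] by simp
        from mult_right_mono[OF this abs_ge_zero[of "1 - G (fst p)"]]
        show ?thesis by (simp only: abs_mult distrib_right mult.assoc mult_1_left)
      qed
    qed (use int21 in simp)
    also have "\<dots> = \<bar>\<phi>2 0\<bar> * (\<integral>p. \<bar>1 * (1 - G (fst p))\<bar> \<partial>?P) + S * (\<integral>p. \<bar>Y \<theta> p * (1 - G (fst p))\<bar> \<partial>?P)"
      using integrable_mult_of_sq_integrable[OF sqY sq1, of \<theta>] P.sq_integrable_imp_integrable[OF sq1] by simp
    also have "\<dots> \<le> \<bar>\<phi>2 0\<bar> * sqrt V + S * sqrt V"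
      using integral_Cauchy_Schwarz[OF P.sq_integrable_const[of 1] sq1]
        integral_Cauchy_Schwarz[OF sqY[of \<theta>] sq1] S
      by (intro add_mono mult_left_mono) (auto simp: V EY P.prob_space)
    finally have 5: "\<bar>I4\<bar> \<le> (\<bar>\<phi>2 0\<bar> + S) * sqrt V" by (simp add: algebra_simps)
    have "\<bar>sin \<theta> * cos \<theta> * I4\<bar> \<le> \<bar>I4\<bar>"
      using trig(2)[of \<theta> "cos \<theta> * I4"] trig(1)[of \<theta> I4] by (simp add: mult.assoc)
    with 3 4 5 show ?thesis by linarith
  qed
  have "norm (\<Psi> 0 - \<Psi> (pi / 2)) \<le> (S * e + (\<bar>\<phi>2 0\<bar> + S) * sqrt V) * norm (0 - pi / 2)"
  proof (rule field_differentiable_bound[of UNIV \<Psi> \<Psi>'])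
    show "norm (\<Psi>' z) \<le> S * e + (\<bar>\<phi>2 0\<bar> + S) * sqrt V" for z using main[of z] by simp
  qed (use der in simp_all)
  moreover have "\<Psi> 0 = expectation (\<lambda>\<omega>. \<phi> (F \<omega>))"
  proof -
    have "\<Psi> 0 = (\<integral>\<omega>. \<integral>z. \<phi> (Y 0 (\<omega>, z)) \<partial>?\<nu> \<partial>M)" unfolding \<Psi>_def by (rule P.integral_fst'[OF int0, symmetric])
    moreover have "(\<integral>z. \<phi> (Y 0 (\<omega>, z)) \<partial>?\<nu>) = \<phi> (F \<omega>)" for \<omega>
      unfolding Y_def using N.prob_space by simp
    ultimately show ?thesis by (simp only:)
  qed
  moreover have "\<Psi> (pi / 2) = (\<integral>z. \<phi> z \<partial>?\<nu>)"
  proof -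
    have "\<Psi> (pi / 2) = (\<integral>\<omega>. \<integral>z. \<phi> (Y (pi / 2) (\<omega>, z)) \<partial>?\<nu> \<partial>M)" unfolding \<Psi>_def by (rule P.integral_fst'[OF int0, symmetric])
    moreover have "\<phi> (Y (pi / 2) (\<omega>, z)) = \<phi> z" for \<omega> z
      unfolding Y_def by simp
    ultimately show ?thesis using prob_space by (simp only:) simp
  qed
  ultimately show ?thesis by (simp add: V_def mult_ac)
qed

lemma integrable_growth_times_power:
  assumes "prob_space M" and f: "L4_integrable M f" and g: "L4_integrable M g"
    and h: "continuous_on UNIV h" "\<And>x. \<bar>h x\<bar> \<le> C * (1 + \<bar>x\<bar> ^ k)" and jk: "j + k \<le> 4"
  shows "integrable M (\<lambda>x. h (f x) * (g x) ^ j)"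
proof -
  interpret prob_space M by fact
  have C: "0 \<le> C" using order.trans[OF abs_ge_zero h(2)[of 1]] by simp
  have [measurable]: "f \<in> borel_measurable M" "g \<in> borel_measurable M" "h \<in> borel_measurable borel"
    using f g h by (auto simp: L4_integrable_def intro: borel_measurable_continuous_onI)
  have 1: "\<bar>h a * b ^ j\<bar> \<le> 2 * C * (1 + 8 * a ^ 4 + 8 * b ^ 4)" for a b :: real
  proof -
    let ?u = "\<bar>a\<bar> + \<bar>b\<bar>"
    have "\<bar>h a * b ^ j\<bar> \<le> (C * (1 + \<bar>a\<bar> ^ k)) * \<bar>b\<bar> ^ j"
      unfolding abs_mult power_abs by (intro mult_right_mono h) auto
    also have "\<dots> \<le> (C * (1 + ?u ^ k)) * ?u ^ j"
      using C by (intro mult_mono mult_left_mono add_left_mono power_mono) auto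
    also have "\<dots> = C * (?u ^ j + ?u ^ (j + k))" by (simp add: algebra_simps power_add)
    also have "\<dots> \<le> C * ((1 + 8 * a ^ 4 + 8 * b ^ 4) + (1 + 8 * a ^ 4 + 8 * b ^ 4))"
      using jk C by (intro mult_left_mono add_mono abs_add_power_le) auto
    finally show ?thesis by (simp only: mult_2 distrib_left distrib_right mult_ac)
  qed
  have K: "integrable M (\<lambda>x. 2 * C * (1 + 8 * (f x) ^ 4 + 8 * (g x) ^ 4))"
    using f g by (intro integrable_mult_right integrable_plus) (auto simp: L4_integrable_def)
  show ?thesis by (rule integrable_dominated[OF K _ 1]) measurable
qed

lemma (in prob_space) integrable_power_mult_power:
  assumes f: "L4_integrable M f" and g: "L4_integrable M g" and "k + j \<le> 4"
  shows "integrable M (\<lambda>x. (f x) ^ k * (g x) ^ j)"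
proof (rule integrable_growth_times_power[OF prob_space_axioms f g])
  show "\<bar>x ^ k\<bar> \<le> 1 * (1 + \<bar>x\<bar> ^ k)" for x :: real by (simp add: power_abs)
qed (use assms in \<open>auto intro!: continuous_intros\<close>)

section \<open>Multilinear polynomials in independent variables\<close>

text \<open>A homogeneous sum with a symmetric kernel that vanishes on diagonals is a polynomial without
  repeated variables, so its monomials can be indexed by sets of indices.\<close>

definition multilinear_sum :: "('i \<Rightarrow> 'a \<Rightarrow> real) \<Rightarrow> 'i set \<Rightarrow> ('i set \<Rightarrow> real) \<Rightarrow> 'a \<Rightarrow> real" where
  "multilinear_sum X J a \<omega> = (\<Sum>S\<in>Pow J. a S * (\<Prod>i\<in>S. X i \<omega>))"

lemma sum_Pow_insert:
  assumes "finite K" "k \<notin> K"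
  shows "(\<Sum>R\<in>Pow (insert k K). g R) = (\<Sum>R\<in>Pow K. g R) + (\<Sum>R\<in>Pow K. g (insert k R))"
proof -
  have inj: "inj_on (insert k) (Pow K)" using assms by (auto simp: inj_on_def)
  have "(\<Sum>R\<in>Pow (insert k K). g R) = (\<Sum>R\<in>Pow K \<union> insert k ` Pow K. g R)" by (simp add: Pow_insert)
  also have "\<dots> = (\<Sum>R\<in>Pow K. g R) + (\<Sum>R\<in>insert k ` Pow K. g R)"
    using assms by (intro sum.union_disjoint) auto
  also have "(\<Sum>R\<in>insert k ` Pow K. g R) = (\<Sum>R\<in>Pow K. g (insert k R))" by (simp add: sum.reindex[OF inj])
  finally show ?thesis .
qed

lemma multilinear_sum_insert:
  assumes "finite J" "i \<notin> J"
  shows "multilinear_sum X (insert i J) a \<omega>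
    = multilinear_sum X J a \<omega> + X i \<omega> * multilinear_sum X J (\<lambda>S. a (insert i S)) \<omega>"
proof -
  have "(\<Sum>S\<in>Pow J. a (insert i S) * (\<Prod>j\<in>insert i S. X j \<omega>))
    = (\<Sum>S\<in>Pow J. X i \<omega> * (a (insert i S) * (\<Prod>j\<in>S. X j \<omega>)))"
  proof (intro sum.cong refl)
    fix S assume "S \<in> Pow J"
    then have "finite S" "i \<notin> S" using assms finite_subset by auto
    then show "a (insert i S) * (\<Prod>j\<in>insert i S. X j \<omega>) = X i \<omega> * (a (insert i S) * (\<Prod>j\<in>S. X j \<omega>))" by simp
  qed
  then show ?thesis
    by (simp only: multilinear_sum_def sum_Pow_insert[OF assms] sum_distrib_left)
qed

locale normalized_family = prob_space M for M :: "'a measure" +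
  fixes X :: "'i \<Rightarrow> 'a \<Rightarrow> real" and I :: "'i set" and \<beta> :: real
  assumes finite_I: "finite I" and nonempty_I: "I \<noteq> {}"
    and indep: "indep_vars (\<lambda>_. borel) X I"
    and X_L4: "\<And>i. i \<in> I \<Longrightarrow> L4_integrable M (X i)"
    and mean_X: "\<And>i. i \<in> I \<Longrightarrow> expectation (X i) = 0"
    and var_X: "\<And>i. i \<in> I \<Longrightarrow> expectation (\<lambda>\<omega>. (X i \<omega>)\<^sup>2) = 1"
    and fourth_X: "\<And>i. i \<in> I \<Longrightarrow> expectation (\<lambda>\<omega>. (X i \<omega>) ^ 4) \<le> \<beta>"
begin

lemma measurable_X: "i \<in> I \<Longrightarrow> X i \<in> borel_measurable M"
  using X_L4 by (simp add: L4_integrable_def)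

lemma integrable_X_power: "i \<in> I \<Longrightarrow> k \<le> 4 \<Longrightarrow> integrable M (\<lambda>\<omega>. (X i \<omega>) ^ k)"
  using integrable_power_mult_power[OF X_L4 X_L4, of i i k 0] by simp

lemma beta_ge_1: "1 \<le> \<beta>"
proof -
  obtain i where i: "i \<in> I" using nonempty_I by auto
  have "0 \<le> expectation (\<lambda>\<omega>. ((X i \<omega>)\<^sup>2 - 1)\<^sup>2)" by simp
  also have "\<dots> = expectation (\<lambda>\<omega>. (X i \<omega>) ^ 4 - 2 * (X i \<omega>)\<^sup>2 + 1)"
    by (intro Bochner_Integration.integral_cong) (auto simp: power2_diff)
  also have "\<dots> = expectation (\<lambda>\<omega>. (X i \<omega>) ^ 4) - 1"
    using integrable_X_power[OF i, of 4] integrable_X_power[OF i, of 2] var_X[OF i] prob_space by simp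
  finally show ?thesis using fourth_X[OF i] by simp
qed

text \<open>Independence enters all proofs only through functions of one variable and functions of the
  remaining ones.  Closure of \<open>depends_on\<close> under the arithmetic operations makes it easy to recognise
  the latter.\<close>

definition depends_on :: "'i set \<Rightarrow> ('a \<Rightarrow> real) \<Rightarrow> bool" where
  "depends_on T V \<longleftrightarrow>
     (\<exists>v\<in>borel_measurable (\<Pi>\<^sub>M i\<in>T. borel). \<forall>\<omega>. V \<omega> = v (\<lambda>i\<in>T. X i \<omega>))"

lemma depends_on_const: "depends_on T (\<lambda>_. c)"
  unfolding depends_on_def by (rule bexI[of _ "\<lambda>_. c"]) auto

lemma depends_on_var: "i \<in> T \<Longrightarrow> depends_on T (X i)"
  unfolding depends_on_def by (rule bexI[of _ "\<lambda>x. x i"]) auto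

lemma depends_on_compose:
  assumes "depends_on T V" "g \<in> borel_measurable borel"
  shows "depends_on T (\<lambda>\<omega>. g (V \<omega>))"
proof -
  obtain v where v: "v \<in> borel_measurable (\<Pi>\<^sub>M i\<in>T. borel)" "\<And>\<omega>. V \<omega> = v (\<lambda>i\<in>T. X i \<omega>)"
    using assms(1) by (auto simp: depends_on_def)
  have "(\<lambda>x. g (v x)) \<in> borel_measurable (\<Pi>\<^sub>M i\<in>T. borel)"
    using measurable_compose[OF v(1) assms(2)] .
  then show ?thesis unfolding depends_on_def by (rule bexI[rotated]) (simp add: v(2))
qed

lemma depends_on_binary:
  assumes "depends_on T V" "depends_on T W"
  shows "depends_on T (\<lambda>\<omega>. V \<omega> + W \<omega>)" "depends_on T (\<lambda>\<omega>. V \<omega> * W \<omega>)"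
proof -
  obtain v where v: "v \<in> borel_measurable (\<Pi>\<^sub>M i\<in>T. borel)" "\<And>\<omega>. V \<omega> = v (\<lambda>i\<in>T. X i \<omega>)"
    using assms(1) by (auto simp: depends_on_def)
  obtain w where w: "w \<in> borel_measurable (\<Pi>\<^sub>M i\<in>T. borel)" "\<And>\<omega>. W \<omega> = w (\<lambda>i\<in>T. X i \<omega>)"
    using assms(2) by (auto simp: depends_on_def)
  show "depends_on T (\<lambda>\<omega>. V \<omega> + W \<omega>)" unfolding depends_on_def
    by (rule bexI[of _ "\<lambda>x. v x + w x"]) (use v w in \<open>auto intro!: borel_measurable_add\<close>)
  show "depends_on T (\<lambda>\<omega>. V \<omega> * W \<omega>)" unfolding depends_on_def
    by (rule bexI[of _ "\<lambda>x. v x * w x"]) (use v w in \<open>auto intro!: borel_measurable_times\<close>)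
qed

lemma depends_on_power: "depends_on T V \<Longrightarrow> depends_on T (\<lambda>\<omega>. V \<omega> ^ k)"
  by (rule depends_on_compose[of T V "\<lambda>x. x ^ k"]) auto

lemma depends_on_sum: "(\<And>j. j \<in> J \<Longrightarrow> depends_on T (V j)) \<Longrightarrow> depends_on T (\<lambda>\<omega>. \<Sum>j\<in>J. V j \<omega>)"
  by (induction J rule: infinite_finite_induct) (simp_all add: depends_on_const depends_on_binary)

lemma depends_on_prod: "(\<And>j. j \<in> J \<Longrightarrow> depends_on T (V j)) \<Longrightarrow> depends_on T (\<lambda>\<omega>. \<Prod>j\<in>J. V j \<omega>)"
  by (induction J rule: infinite_finite_induct) (simp_all add: depends_on_const depends_on_binary)

lemma depends_on_multilinear_sum: "J \<subseteq> T \<Longrightarrow> depends_on T (multilinear_sum X J a)"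
  unfolding multilinear_sum_def[abs_def]
  by (intro depends_on_sum depends_on_binary(2)[OF depends_on_const] depends_on_prod depends_on_var) auto

lemma integral_factor:
  assumes i: "i \<in> I" and T: "T \<subseteq> I - {i}" and V: "depends_on T V" "integrable M V"
    and u: "u \<in> borel_measurable borel" "integrable M (\<lambda>\<omega>. u (X i \<omega>))"
  shows "integrable M (\<lambda>\<omega>. u (X i \<omega>) * V \<omega>)"
    and "expectation (\<lambda>\<omega>. u (X i \<omega>) * V \<omega>) = expectation (\<lambda>\<omega>. u (X i \<omega>)) * expectation V"
proof -
  obtain v where v: "v \<in> borel_measurable (\<Pi>\<^sub>M i\<in>T. borel)" "\<And>\<omega>. V \<omega> = v (\<lambda>i\<in>T. X i \<omega>)"
    using V(1) by (auto simp: depends_on_def)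
  have r: "indep_var (\<Pi>\<^sub>M j\<in>{i}. borel) (\<lambda>\<omega>. \<lambda>j\<in>{i}. X j \<omega>) (\<Pi>\<^sub>M j\<in>T. borel) (\<lambda>\<omega>. \<lambda>j\<in>T. X j \<omega>)"
    using i T by (intro indep_var_restrict[OF indep]) auto
  have "(\<lambda>x. x i) \<in> borel_measurable (\<Pi>\<^sub>M j\<in>{i}. borel)" by (rule measurable_component_singleton) simp
  from measurable_compose[OF this u(1)]
  have ui: "(\<lambda>x. u (x i)) \<in> borel_measurable (\<Pi>\<^sub>M j\<in>{i}. borel)" .
  have "indep_var borel ((\<lambda>x. u (x i)) \<circ> (\<lambda>\<omega>. \<lambda>j\<in>{i}. X j \<omega>)) borel (v \<circ> (\<lambda>\<omega>. \<lambda>j\<in>T. X j \<omega>))"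
    by (rule indep_var_compose[OF r ui v(1)])
  moreover have "(\<lambda>x. u (x i)) \<circ> (\<lambda>\<omega>. \<lambda>j\<in>{i}. X j \<omega>) = (\<lambda>\<omega>. u (X i \<omega>))" by (simp add: comp_def)
  moreover have "v \<circ> (\<lambda>\<omega>. \<lambda>j\<in>T. X j \<omega>) = V" by (simp add: comp_def v(2)[symmetric])
  ultimately have iv: "indep_var borel (\<lambda>\<omega>. u (X i \<omega>)) borel V" by simp
  show "integrable M (\<lambda>\<omega>. u (X i \<omega>) * V \<omega>)"
    by (rule indep_var_integrable[OF iv u(2) V(2)])
  show "expectation (\<lambda>\<omega>. u (X i \<omega>) * V \<omega>) = expectation (\<lambda>\<omega>. u (X i \<omega>)) * expectation V"
    by (rule indep_var_lebesgue_integral[OF iv u(2) V(2)])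
qed

lemma integrable_prod:
  fixes u :: "'i \<Rightarrow> real \<Rightarrow> real"
  assumes "A \<subseteq> I" and u: "\<And>i. i \<in> A \<Longrightarrow> u i \<in> borel_measurable borel"
    and "\<And>i. i \<in> A \<Longrightarrow> integrable M (\<lambda>\<omega>. u i (X i \<omega>))"
  shows "integrable M (\<lambda>\<omega>. \<Prod>i\<in>A. u i (X i \<omega>))"
proof -
  have fin: "finite A" using assms(1) finite_I by (rule finite_subset)
  have ind: "indep_vars (\<lambda>_. borel) (\<lambda>i \<omega>. u i (X i \<omega>)) A"
    by (rule indep_vars_compose2[OF indep_vars_subset[OF indep assms(1)] u])
  show ?thesis
  proof (rule indep_vars_integrable[OF fin ind])
    fix i assume "i \<in> A"
    then show "integrable M (\<lambda>\<omega>. u i (X i \<omega>))" by (rule assms(3))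
  qed
qed

lemma L4_monomial:
  assumes "S \<subseteq> I"
  shows "L4_integrable M (\<lambda>\<omega>. \<Prod>i\<in>S. X i \<omega>)"
proof -
  have "integrable M (\<lambda>\<omega>. \<Prod>i\<in>S. (X i \<omega>) ^ 4)"
    using assms by (intro integrable_prod[where u = "\<lambda>_ x. x ^ 4"] integrable_X_power) auto
  moreover have "(\<lambda>\<omega>. \<Prod>i\<in>S. X i \<omega>) \<in> borel_measurable M"
    using assms by (intro borel_measurable_prod measurable_X) auto
  ultimately show ?thesis by (simp add: L4_integrable_def prod_power_distrib)
qed

lemma L4_multilinear_sum:
  assumes "J \<subseteq> I"
  shows "L4_integrable M (multilinear_sum X J a)"
  unfolding multilinear_sum_def[abs_def]
  using assms by (intro L4_integrable_sum L4_integrable_scale L4_monomial) auto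

lemma split_moment:
  assumes i: "i \<in> I" and T: "T \<subseteq> I - {i}"
    and A: "depends_on T A" "L4_integrable M A" and D: "depends_on T D" "L4_integrable M D"
    and "p \<le> 4" "q + r \<le> 4"
  shows "integrable M (\<lambda>\<omega>. (X i \<omega>) ^ p * (A \<omega> ^ q * D \<omega> ^ r))"
    and "expectation (\<lambda>\<omega>. (X i \<omega>) ^ p * (A \<omega> ^ q * D \<omega> ^ r))
      = expectation (\<lambda>\<omega>. (X i \<omega>) ^ p) * expectation (\<lambda>\<omega>. A \<omega> ^ q * D \<omega> ^ r)"
  using assms
  by (intro integral_factor[OF i T, where u = "\<lambda>x. x ^ p"] depends_on_binary depends_on_power
      integrable_power_mult_power integrable_X_power; simp)+

lemma L4_split:
  assumes i: "i \<in> I" and T: "T \<subseteq> I - {i}"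
    and A: "depends_on T A" "L4_integrable M A" and D: "depends_on T D" "L4_integrable M D"
  shows "L4_integrable M (\<lambda>\<omega>. X i \<omega> * D \<omega>)" "L4_integrable M (\<lambda>\<omega>. A \<omega> + X i \<omega> * D \<omega>)"
proof -
  have [measurable]: "X i \<in> borel_measurable M" "D \<in> borel_measurable M"
    using i D by (auto simp: L4_integrable_def measurable_X)
  show XD: "L4_integrable M (\<lambda>\<omega>. X i \<omega> * D \<omega>)"
    using split_moment(1)[OF i T D D, of 4 4 0] by (simp add: L4_integrable_def power_mult_distrib)
  show "L4_integrable M (\<lambda>\<omega>. A \<omega> + X i \<omega> * D \<omega>)" by (rule L4_integrable_add[OF A(2) XD])
qed

text \<open>As \<open>A\<close> and \<open>D\<close> are free of \<open>X i\<close>, moments of \<open>A + X i D\<close> factor term by term; the list \<open>L\<close> holds the coefficient and the exponents of \<open>X i\<close>, \<open>A\<close> and \<open>D\<close> of each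
  term.\<close>

lemma split_expansion:
  assumes i: "i \<in> I" and T: "T \<subseteq> I - {i}"
    and A: "depends_on T A" "L4_integrable M A" and D: "depends_on T D" "L4_integrable M D"
  shows "\<forall>(c, p, q, r)\<in>set L. p \<le> 4 \<and> q + r \<le> 4 \<Longrightarrow>
      integrable M (\<lambda>\<omega>. \<Sum>(c, p, q, r)\<leftarrow>L. c * ((X i \<omega>) ^ p * (A \<omega> ^ q * D \<omega> ^ r))) \<and>
      expectation (\<lambda>\<omega>. \<Sum>(c, p, q, r)\<leftarrow>L. c * ((X i \<omega>) ^ p * (A \<omega> ^ q * D \<omega> ^ r)))
      = (\<Sum>(c, p, q, r)\<leftarrow>L. c * (expectation (\<lambda>\<omega>. (X i \<omega>) ^ p) * expectation (\<lambda>\<omega>. A \<omega> ^ q * D \<omega> ^ r)))"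
proof (induction L)
  case (Cons t L)
  obtain c p q r where t: "t = (c, p, q, r)" by (metis prod_cases4)
  then have pqr: "p \<le> 4" "q + r \<le> 4" using Cons.prems by auto
  let ?f = "\<lambda>\<omega>. c * ((X i \<omega>) ^ p * (A \<omega> ^ q * D \<omega> ^ r))"
    and ?g = "\<lambda>\<omega>. \<Sum>(c, p, q, r)\<leftarrow>L. c * ((X i \<omega>) ^ p * (A \<omega> ^ q * D \<omega> ^ r))"
  have f: "integrable M ?f" by (rule integrable_mult_right[OF split_moment(1)[OF i T A D pqr]])
  have IH: "integrable M ?g" "expectation ?g = (\<Sum>(c, p, q, r)\<leftarrow>L. c * (expectation (\<lambda>\<omega>. (X i \<omega>) ^ p) * expectation (\<lambda>\<omega>. A \<omega> ^ q * D \<omega> ^ r)))"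
    using Cons.IH Cons.prems by simp_all
  have "expectation ?f = c * (expectation (\<lambda>\<omega>. (X i \<omega>) ^ p) * expectation (\<lambda>\<omega>. A \<omega> ^ q * D \<omega> ^ r))"
    by (simp only: integral_mult_right_zero split_moment(2)[OF i T A D pqr])
  moreover have "expectation (\<lambda>\<omega>. ?f \<omega> + ?g \<omega>) = expectation ?f + expectation ?g"
    by (rule Bochner_Integration.integral_add[OF f IH(1)])
  moreover have "integrable M (\<lambda>\<omega>. ?f \<omega> + ?g \<omega>)"
    by (rule integrable_plus[OF f IH(1)])
  ultimately show ?case by (simp only: t list.map sum_list.Cons prod.case IH(2) simp_thms)
qed simp

text \<open>The last two moments are those from which the fourth moment identity is assembled:
  three halves of the fifth minus the fourth leaves only a multiple of \<open>E (D ^ 4)\<close>, as both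
  \<open>E (A\<^sup>2 D\<^sup>2)\<close> and the term with the third moment of \<open>X i\<close> cancel.\<close>

lemma split_moments:
  assumes i: "i \<in> I" and T: "T \<subseteq> I - {i}"
    and A: "depends_on T A" "L4_integrable M A" and D: "depends_on T D" "L4_integrable M D"
  defines "m3 \<equiv> expectation (\<lambda>\<omega>. (X i \<omega>) ^ 3)" and "m4 \<equiv> expectation (\<lambda>\<omega>. (X i \<omega>) ^ 4)"
    and "\<mu> \<equiv> \<lambda>q r. expectation (\<lambda>\<omega>. A \<omega> ^ q * D \<omega> ^ r)"
  shows "expectation (\<lambda>\<omega>. (A \<omega> + X i \<omega> * D \<omega>)\<^sup>2) = \<mu> 2 0 + \<mu> 0 2"
    and "expectation (\<lambda>\<omega>. (A \<omega> + X i \<omega> * D \<omega>) * (X i \<omega> * D \<omega>)) = \<mu> 0 2"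
    and "expectation (\<lambda>\<omega>. (A \<omega> + X i \<omega> * D \<omega>) ^ 4) = \<mu> 4 0 + 6 * \<mu> 2 2 + 4 * m3 * \<mu> 1 3 + m4 * \<mu> 0 4"
    and "expectation (\<lambda>\<omega>. (A \<omega> + X i \<omega> * D \<omega>) ^ 3 * (X i \<omega> * D \<omega>)) = 3 * \<mu> 2 2 + 3 * m3 * \<mu> 1 3 + m4 * \<mu> 0 4"
    and "expectation (\<lambda>\<omega>. (A \<omega> + X i \<omega> * D \<omega>)\<^sup>2 * ((1 + (X i \<omega>)\<^sup>2) * (D \<omega>)\<^sup>2))
      = 2 * \<mu> 2 2 + 2 * m3 * \<mu> 1 3 + (1 + m4) * \<mu> 0 4"
proof -
  have expand: "expectation g = (\<Sum>(c, p, q, r)\<leftarrow>L. c * (expectation (\<lambda>\<omega>. (X i \<omega>) ^ p) * \<mu> q r))"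
    if L: "\<forall>(c, p, q, r)\<in>set L. p \<le> 4 \<and> q + r \<le> 4"
      and g: "\<And>\<omega>. g \<omega> = (\<Sum>(c, p, q, r)\<leftarrow>L. c * ((X i \<omega>) ^ p * (A \<omega> ^ q * D \<omega> ^ r)))" for L g
    using split_expansion[OF i T A D L] unfolding g[abs_def] \<mu>_def by blast
  have m: "expectation (\<lambda>\<omega>. (X i \<omega>) ^ 0) = 1" "expectation (\<lambda>\<omega>. (X i \<omega>) ^ 1) = 0" "expectation (\<lambda>\<omega>. (X i \<omega>) ^ 2) = 1"
    using mean_X[OF i] var_X[OF i] prob_space by simp_all
  note eval_list = list.map sum_list.Cons sum_list.Nil prod.case m m3_def[symmetric] m4_def[symmetric] list.set ball_simps
  show "expectation (\<lambda>\<omega>. (A \<omega> + X i \<omega> * D \<omega>)\<^sup>2) = \<mu> 2 0 + \<mu> 0 2"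
    by (subst expand[of "[(1, 0, 2, 0), (2, 1, 1, 1), (1, 2, 0, 2)]"])
       (simp_all only: eval_list, simp_all add: power2_eq_square algebra_simps)
  show "expectation (\<lambda>\<omega>. (A \<omega> + X i \<omega> * D \<omega>) * (X i \<omega> * D \<omega>)) = \<mu> 0 2"
    by (subst expand[of "[(1, 1, 1, 1), (1, 2, 0, 2)]"])
       (simp_all only: eval_list, simp_all add: power2_eq_square algebra_simps)
  show "expectation (\<lambda>\<omega>. (A \<omega> + X i \<omega> * D \<omega>) ^ 4) = \<mu> 4 0 + 6 * \<mu> 2 2 + 4 * m3 * \<mu> 1 3 + m4 * \<mu> 0 4"
    by (subst expand[of "[(1, 0, 4, 0), (4, 1, 3, 1), (6, 2, 2, 2), (4, 3, 1, 3), (1, 4, 0, 4)]"])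
       (simp_all only: eval_list, simp_all add: eval_nat_numeral algebra_simps)
  show "expectation (\<lambda>\<omega>. (A \<omega> + X i \<omega> * D \<omega>) ^ 3 * (X i \<omega> * D \<omega>)) = 3 * \<mu> 2 2 + 3 * m3 * \<mu> 1 3 + m4 * \<mu> 0 4"
    by (subst expand[of "[(1, 1, 3, 1), (3, 2, 2, 2), (3, 3, 1, 3), (1, 4, 0, 4)]"])
       (simp_all only: eval_list, simp_all add: eval_nat_numeral algebra_simps)
  show "expectation (\<lambda>\<omega>. (A \<omega> + X i \<omega> * D \<omega>)\<^sup>2 * ((1 + (X i \<omega>)\<^sup>2) * (D \<omega>)\<^sup>2))
      = 2 * \<mu> 2 2 + 2 * m3 * \<mu> 1 3 + (1 + m4) * \<mu> 0 4"
    by (subst expand[of "[(1, 0, 2, 2), (1, 2, 2, 2), (2, 1, 1, 3), (2, 3, 1, 3), (1, 2, 0, 4), (1, 4, 0, 4)]"])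
       (simp_all only: eval_list, simp_all add: eval_nat_numeral algebra_simps)
qed


lemma third_moment_square_le:
  assumes "i \<in> I"
  shows "(expectation (\<lambda>\<omega>. (X i \<omega>) ^ 3))\<^sup>2 \<le> \<beta>"
proof -
  have s1: "sq_integrable M (X i)" by (rule L4_integrable_imp_sq_integrable[OF X_L4[OF assms]])
  have s2: "sq_integrable M (\<lambda>\<omega>. (X i \<omega>)\<^sup>2)"
    by (rule sq_integrable_power2_of_L4[OF X_L4[OF assms]])
  have "\<bar>expectation (\<lambda>\<omega>. (X i \<omega>) ^ 3)\<bar> \<le> expectation (\<lambda>\<omega>. \<bar>X i \<omega> * (X i \<omega>)\<^sup>2\<bar>)"
    using integral_abs_bound[of M "\<lambda>\<omega>. (X i \<omega>) ^ 3"] by (simp add: power3_eq_cube power2_eq_square mult.assoc)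
  also have "\<dots> \<le> sqrt (expectation (\<lambda>\<omega>. (X i \<omega>)\<^sup>2)) * sqrt (expectation (\<lambda>\<omega>. ((X i \<omega>)\<^sup>2)\<^sup>2))"
    by (rule integral_Cauchy_Schwarz[OF s1 s2])
  also have "\<dots> \<le> sqrt \<beta>" using var_X[OF assms] fourth_X[OF assms] by simp
  finally have "\<bar>expectation (\<lambda>\<omega>. (X i \<omega>) ^ 3)\<bar>\<^sup>2 \<le> (sqrt \<beta>)\<^sup>2"
    by (intro power_mono) auto
  then show ?thesis using beta_ge_1 by simp
qed

lemma fourth_moment_split_le:
  assumes i: "i \<in> I" and T: "T \<subseteq> I - {i}"
    and A: "depends_on T A" "L4_integrable M A" and D: "depends_on T D" "L4_integrable M D"
  shows "expectation (\<lambda>\<omega>. (A \<omega> + X i \<omega> * D \<omega>) ^ 4)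
    \<le> expectation (\<lambda>\<omega>. (A \<omega>) ^ 4) + 8 * expectation (\<lambda>\<omega>. (A \<omega>)\<^sup>2 * (D \<omega>)\<^sup>2) + 3 * \<beta> * expectation (\<lambda>\<omega>. (D \<omega>) ^ 4)"
proof -
  define m3 where "m3 = expectation (\<lambda>\<omega>. (X i \<omega>) ^ 3)"
  define m4 where "m4 = expectation (\<lambda>\<omega>. (X i \<omega>) ^ 4)"
  define \<mu> where "\<mu> q r = expectation (\<lambda>\<omega>. A \<omega> ^ q * D \<omega> ^ r)" for q r
  have int: "integrable M (\<lambda>\<omega>. A \<omega> ^ q * D \<omega> ^ r)" if "q + r \<le> 4" for q r
    by (rule integrable_power_mult_power[OF A(2) D(2) that])
  have int22: "integrable M (\<lambda>\<omega>. A \<omega> ^ 2 * D \<omega> ^ 2)" and int04: "integrable M (\<lambda>\<omega>. A \<omega> ^ 0 * D \<omega> ^ 4)"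
    by (rule int; simp)+
  have m3: "m3\<^sup>2 \<le> \<beta>" unfolding m3_def by (rule third_moment_square_le[OF i])
  have m4: "m4 \<le> \<beta>" unfolding m4_def by (rule fourth_X[OF i])
  have pos: "0 \<le> \<mu> 0 4" by (simp add: \<mu>_def)
  \<comment> \<open>The odd term is absorbed by \<open>2 a (m\<^sub>3 b) \<le> a\<^sup>2 + (m\<^sub>3 b)\<^sup>2\<close> with \<open>a = A D\<close> and \<open>b = D\<^sup>2\<close>.\<close>
  have "4 * m3 * \<mu> 1 3 = expectation (\<lambda>\<omega>. 4 * m3 * (A \<omega> ^ 1 * D \<omega> ^ 3))"
    by (simp only: \<mu>_def integral_mult_right_zero)
  also have "\<dots> \<le> expectation (\<lambda>\<omega>. 2 * (A \<omega> ^ 2 * D \<omega> ^ 2) + 2 * m3\<^sup>2 * (A \<omega> ^ 0 * D \<omega> ^ 4))"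
  proof (rule integral_mono)
    fix \<omega>
    have "2 * (A \<omega> * D \<omega>) * (m3 * (D \<omega>)\<^sup>2) \<le> (A \<omega> * D \<omega>)\<^sup>2 + (m3 * (D \<omega>)\<^sup>2)\<^sup>2"
      by (rule sum_squares_bound)
    then show "4 * m3 * (A \<omega> ^ 1 * D \<omega> ^ 3) \<le> 2 * (A \<omega> ^ 2 * D \<omega> ^ 2) + 2 * m3\<^sup>2 * (A \<omega> ^ 0 * D \<omega> ^ 4)"
      by (simp add: power_mult_distrib power3_eq_cube power2_eq_square power4_eq_xxxx algebra_simps)
  qed (intro integrable_mult_right integrable_plus int; simp)+
  also have "\<dots> = 2 * \<mu> 2 2 + 2 * m3\<^sup>2 * \<mu> 0 4"
    unfolding \<mu>_def
      Bochner_Integration.integral_add[OF integrable_mult_right[OF int22] integrable_mult_right[OF int04]]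
      integral_mult_right_zero ..
  also have "\<dots> \<le> 2 * \<mu> 2 2 + 2 * \<beta> * \<mu> 0 4"
    using m3 pos by (intro add_left_mono mult_right_mono) auto
  finally have "4 * m3 * \<mu> 1 3 \<le> 2 * \<mu> 2 2 + 2 * \<beta> * \<mu> 0 4" .
  moreover have "m4 * \<mu> 0 4 \<le> \<beta> * \<mu> 0 4" using m4 pos by (rule mult_right_mono)
  moreover have "expectation (\<lambda>\<omega>. (A \<omega> + X i \<omega> * D \<omega>) ^ 4) = \<mu> 4 0 + 6 * \<mu> 2 2 + 4 * m3 * \<mu> 1 3 + m4 * \<mu> 0 4"
    using split_moments(3)[OF i T A D] by (simp only: \<mu>_def m3_def m4_def)
  ultimately have "expectation (\<lambda>\<omega>. (A \<omega> + X i \<omega> * D \<omega>) ^ 4) \<le> \<mu> 4 0 + 8 * \<mu> 2 2 + 3 * \<beta> * \<mu> 0 4"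
    by (simp add: algebra_simps)
  then show ?thesis by (simp add: \<mu>_def)
qed

text \<open>Induction on the number of variables, splitting off one variable as \<open>A + X i D\<close>: the coefficients
  of \<open>D\<close> have degree one less, and the mixed moment \<open>E (A\<^sup>2 D\<^sup>2)\<close> is bounded by Cauchy-Schwarz.
  The constant \<open>16\<close> is what makes the mixed term fit under \<open>2 E (A\<^sup>2) E (D\<^sup>2)\<close>, because
  \<open>4 sqrt K \<le> K\<close> holds exactly from \<open>K = 16\<close> on.\<close>

theorem hypercontractivity:
  assumes "J \<subseteq> I" "\<And>S. S \<subseteq> J \<Longrightarrow> a S \<noteq> 0 \<Longrightarrow> card S \<le> k"
  shows "expectation (\<lambda>\<omega>. (multilinear_sum X J a \<omega>) ^ 4)
    \<le> (16 * \<beta>) ^ k * (expectation (\<lambda>\<omega>. (multilinear_sum X J a \<omega>)\<^sup>2))\<^sup>2"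
proof -
  have "finite J" using assms(1) finite_I by (rule finite_subset)
  then show ?thesis using assms
  proof (induction J arbitrary: a k rule: finite_induct)
    case empty
    have "1 * (a {}) ^ 4 \<le> (16 * \<beta>) ^ k * (a {}) ^ 4"
      using beta_ge_1 by (intro mult_right_mono one_le_power) auto
    then show ?case by (simp add: multilinear_sum_def prob_space)
  next
    case (insert i J)
    define K where "K = 16 * \<beta>"
    have K: "16 \<le> K" using beta_ge_1 by (simp add: K_def)
    let ?A = "multilinear_sum X J a" and ?D = "multilinear_sum X J (\<lambda>S. a (insert i S))"
    have J: "J \<subseteq> I" and i: "i \<in> I" and T: "J \<subseteq> I - {i}" using insert by auto
    have A: "depends_on J ?A" "L4_integrable M ?A" and D: "depends_on J ?D" "L4_integrable M ?D"
      using J by (auto intro: depends_on_multilinear_sum L4_multilinear_sum)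
    have split: "multilinear_sum X (insert i J) a = (\<lambda>\<omega>. ?A \<omega> + X i \<omega> * ?D \<omega>)"
      by (rule ext) (rule multilinear_sum_insert[OF insert(1,2)])
    define p where "p = expectation (\<lambda>\<omega>. (?A \<omega>)\<^sup>2)"
    define q where "q = expectation (\<lambda>\<omega>. (?D \<omega>)\<^sup>2)"
    define r where "r = expectation (\<lambda>\<omega>. (?A \<omega>)\<^sup>2 * (?D \<omega>)\<^sup>2)"
    have pqr: "0 \<le> p" "0 \<le> q" "0 \<le> r" by (auto simp: p_def q_def r_def)
    have second: "expectation (\<lambda>\<omega>. (?A \<omega> + X i \<omega> * ?D \<omega>)\<^sup>2) = p + q"
      using split_moments(1)[OF i T A D] by (simp add: p_def q_def)
    have A4: "expectation (\<lambda>\<omega>. (?A \<omega>) ^ 4) \<le> K ^ k * p\<^sup>2"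
      unfolding K_def p_def
    proof (rule insert.IH[OF J])
      fix S assume "S \<subseteq> J" "a S \<noteq> 0"
      then show "card S \<le> k" using insert.prems(2)[of S] by blast
    qed
    show ?case
    proof (cases k)
      case 0
      have "a (insert i S) = 0" if "S \<subseteq> J" for S
      proof (rule ccontr)
        assume "a (insert i S) \<noteq> 0"
        then have "card (insert i S) \<le> 0" using insert.prems(2)[of "insert i S"] that 0 by auto
        moreover have "finite S" using that insert(1) finite_subset by blast
        ultimately show False by simp
      qed
      then have "?D \<omega> = 0" for \<omega> by (simp add: multilinear_sum_def)
      then have F: "multilinear_sum X (insert i J) a = ?A" by (simp add: split)
      show ?thesis unfolding F using A4 by (simp add: K_def p_def)
    next
      case (Suc l)
      have D4: "expectation (\<lambda>\<omega>. (?D \<omega>) ^ 4) \<le> K ^ l * q\<^sup>2"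
        unfolding K_def q_def
      proof (rule insert.IH[OF J])
        fix S assume S: "S \<subseteq> J" "a (insert i S) \<noteq> 0"
        then have "card (insert i S) \<le> Suc l" using insert.prems(2)[of "insert i S"] Suc by auto
        moreover have "finite S" "i \<notin> S" using S insert(1,2) finite_subset by auto
        ultimately show "card S \<le> l" by simp
      qed
      have sA: "sq_integrable M (\<lambda>\<omega>. (?A \<omega>)\<^sup>2)" and sD: "sq_integrable M (\<lambda>\<omega>. (?D \<omega>)\<^sup>2)"
        by (rule sq_integrable_power2_of_L4[OF A(2)], rule sq_integrable_power2_of_L4[OF D(2)])
      have "r \<le> sqrt (expectation (\<lambda>\<omega>. (?A \<omega>) ^ 4)) * sqrt (expectation (\<lambda>\<omega>. (?D \<omega>) ^ 4))"
        using integral_Cauchy_Schwarz[OF sA sD] by (simp add: r_def)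
      also have "\<dots> \<le> sqrt (K ^ k * p\<^sup>2) * sqrt (K ^ l * q\<^sup>2)"
        using A4 D4 K by (intro mult_mono real_sqrt_le_mono real_sqrt_ge_zero) auto
      also have "\<dots> = sqrt (K * (K ^ l * p * q)\<^sup>2)"
        by (simp add: Suc power_mult_distrib power2_eq_square mult_ac flip: real_sqrt_mult)
      also have "\<dots> = sqrt K * (K ^ l * p * q)" using K pqr by (simp add: real_sqrt_mult)
      finally have r: "r \<le> sqrt K * (K ^ l * p * q)" .
      have "4 * sqrt K \<le> sqrt K * sqrt K"
        using K real_le_rsqrt[of 4 K] by (intro mult_right_mono) auto
      then have sK: "4 * sqrt K \<le> K" using K by simp
      have "8 * r \<le> 2 * (4 * sqrt K) * (K ^ l * p * q)" using r by simp
      also have "\<dots> \<le> 2 * K * (K ^ l * p * q)" using sK pqr K by (intro mult_right_mono mult_left_mono) auto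
      finally have 8: "8 * r \<le> K ^ k * (2 * p * q)" by (simp add: Suc mult_ac)
      have "3 * \<beta> * expectation (\<lambda>\<omega>. (?D \<omega>) ^ 4) \<le> K * (K ^ l * q\<^sup>2)"
        using beta_ge_1 D4 by (intro mult_mono) (auto simp: K_def)
      then have 3: "3 * \<beta> * expectation (\<lambda>\<omega>. (?D \<omega>) ^ 4) \<le> K ^ k * q\<^sup>2" by (simp add: Suc)
      have "expectation (\<lambda>\<omega>. (?A \<omega> + X i \<omega> * ?D \<omega>) ^ 4) \<le> K ^ k * p\<^sup>2 + K ^ k * (2 * p * q) + K ^ k * q\<^sup>2"
        using fourth_moment_split_le[OF i T A D] A4 8 3 unfolding r_def by linarith
      also have "\<dots> = K ^ k * (p + q)\<^sup>2" by (simp add: power2_sum algebra_simps)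
      finally show ?thesis unfolding split second K_def .
    qed
  qed
qed

text \<open>Expanding \<open>h\<close> to first and \<open>h'\<close> to zeroth order around \<open>A\<close>, the value of \<open>F\<close> at \<open>X i = 0\<close>,
  both expectations become \<open>E (D\<^sup>2 h'(A))\<close> up to third order terms, because \<open>X i\<close> is centered and
  \<open>X i\<^sup>2\<close> as well as the weight \<open>1 - \<kappa> + \<kappa> * X i\<^sup>2\<close> have mean one.  The weight \<open>\<kappa> = 0\<close> suits
  polynomials of degree one, the weight \<open>\<kappa> = 1/2\<close> those of higher degree.\<close>

lemma stein_term_bound:
  fixes h h' :: "real \<Rightarrow> real" and \<kappa> L :: real
  assumes i: "i \<in> I" and T: "T \<subseteq> I - {i}"
    and A: "depends_on T A" "L4_integrable M A" and D: "depends_on T D" "L4_integrable M D"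
    and h: "\<And>x. (h has_real_derivative h' x) (at x)" and lip: "\<And>x y. \<bar>h' x - h' y\<bar> \<le> L * \<bar>x - y\<bar>"
    and \<kappa>: "0 \<le> \<kappa>" "\<kappa> \<le> 1"
  defines "F \<equiv> \<lambda>\<omega>. A \<omega> + X i \<omega> * D \<omega>"
  shows "integrable M (\<lambda>\<omega>. X i \<omega> * D \<omega> * h (F \<omega>))"
    and "integrable M (\<lambda>\<omega>. h' (F \<omega>) * ((1 - \<kappa> + \<kappa> * (X i \<omega>)\<^sup>2) * (D \<omega>)\<^sup>2))"
    and "\<bar>expectation (\<lambda>\<omega>. X i \<omega> * D \<omega> * h (F \<omega>))
        - expectation (\<lambda>\<omega>. h' (F \<omega>) * ((1 - \<kappa> + \<kappa> * (X i \<omega>)\<^sup>2) * (D \<omega>)\<^sup>2))\<bar>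
      \<le> L * (2 * \<beta> * expectation (\<lambda>\<omega>. \<bar>D \<omega>\<bar> ^ 3))"
proof -
  define w where "w x = 1 - \<kappa> + \<kappa> * x\<^sup>2" for x :: real
  have w0: "0 \<le> w x" for x using \<kappa> by (simp add: w_def)
  have L: "0 \<le> L" using order.trans[OF abs_ge_zero lip[of 1 0]] by simp
  have ch: "continuous_on UNIV h" using h by (meson DERIV_isCont continuous_at_imp_continuous_on)
  have ch': "continuous_on UNIV h'" by (rule lipschitz_imp_continuous[OF lip])
  note g' = lipschitz_linear_growth[OF lip]
  note g = abs_le_of_derivative_growth[OF h g']
  have XD: "L4_integrable M (\<lambda>\<omega>. X i \<omega> * D \<omega>)" and F: "L4_integrable M F"
    unfolding F_def by (rule L4_split[OF i T A D])+
  have ih: "integrable M (\<lambda>\<omega>. h (f \<omega>) * (k \<omega>) ^ 1)" if "L4_integrable M f" "L4_integrable M k" for f k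
    by (rule integrable_growth_times_power[OF prob_space_axioms that ch g]) simp
  have ih': "integrable M (\<lambda>\<omega>. h' (f \<omega>) * (k \<omega>) ^ 2)" if "L4_integrable M f" "L4_integrable M k" for f k
    by (rule integrable_growth_times_power[OF prob_space_axioms that ch' g']) simp
  show i1: "integrable M (\<lambda>\<omega>. X i \<omega> * D \<omega> * h (F \<omega>))"
    using ih[OF F XD] by (simp add: mult_ac)
  have "integrable M (\<lambda>\<omega>. (1 - \<kappa>) * (h' (F \<omega>) * (D \<omega>)\<^sup>2) + \<kappa> * (h' (F \<omega>) * (X i \<omega> * D \<omega>)\<^sup>2))"
    by (intro integrable_plus integrable_mult_right ih' F D(2) XD)
  then show i2: "integrable M (\<lambda>\<omega>. h' (F \<omega>) * ((1 - \<kappa> + \<kappa> * (X i \<omega>)\<^sup>2) * (D \<omega>)\<^sup>2))"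
    by (rule Bochner_Integration.integrable_cong[THEN iffD1, rotated -1]) (auto simp: power_mult_distrib algebra_simps)
  have [measurable]: "h \<in> borel_measurable borel" "h' \<in> borel_measurable borel"
    using ch ch' by (auto intro: borel_measurable_continuous_onI)
  have dDh: "depends_on T (\<lambda>\<omega>. h (A \<omega>) * D \<omega> ^ 1)" and dDh': "depends_on T (\<lambda>\<omega>. h' (A \<omega>) * D \<omega> ^ 2)"
    by (intro depends_on_binary(2) depends_on_power D(1) depends_on_compose[OF A(1)]; measurable)+
  have dD3: "depends_on T (\<lambda>\<omega>. \<bar>D \<omega>\<bar> ^ 3)"
    by (rule depends_on_compose[OF D(1)]) measurable
  have iD3: "integrable M (\<lambda>\<omega>. \<bar>D \<omega>\<bar> ^ 3)"
    using integrable_abs[OF integrable_power_mult_power[OF D(2) D(2), of 3 0]] by (simp add: power_abs)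
  have x0: "expectation (\<lambda>\<omega>. X i \<omega> * (h (A \<omega>) * D \<omega> ^ 1)) = 0"
      "integrable M (\<lambda>\<omega>. X i \<omega> * (h (A \<omega>) * D \<omega> ^ 1))"
    using integral_factor[OF i T dDh ih[OF A(2) D(2)], of "\<lambda>x. x"] integrable_X_power[OF i, of 1] mean_X[OF i]
    by simp_all
  have x2: "expectation (\<lambda>\<omega>. (X i \<omega>)\<^sup>2 * (h' (A \<omega>) * D \<omega> ^ 2)) = expectation (\<lambda>\<omega>. h' (A \<omega>) * D \<omega> ^ 2)"
      "integrable M (\<lambda>\<omega>. (X i \<omega>)\<^sup>2 * (h' (A \<omega>) * D \<omega> ^ 2))"
    using integral_factor[OF i T dDh' ih'[OF A(2) D(2)], of "\<lambda>x. x\<^sup>2"] integrable_X_power[OF i, of 2] var_X[OF i]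
    by simp_all
  \<comment> \<open>The low order terms of the expansion, which have mean zero.\<close>
  define P where "P c \<omega> = X i \<omega> * (h (A \<omega>) * D \<omega> ^ 1) + c * ((X i \<omega>)\<^sup>2 * (h' (A \<omega>) * D \<omega> ^ 2)) - c * (h' (A \<omega>) * D \<omega> ^ 2)" for c \<omega>
  have iP: "integrable M (P c)" "expectation (P c) = 0" for c
  proof -
    note ii = x0(2) integrable_mult_right[OF x2(2), of c] integrable_mult_right[OF ih'[OF A(2) D(2)], of c]
    show "integrable M (P c)" unfolding P_def[abs_def]
      by (intro Bochner_Integration.integrable_diff integrable_plus ii)
    have "expectation (P c) = 0 + c * expectation (\<lambda>\<omega>. h' (A \<omega>) * D \<omega> ^ 2) - c * expectation (\<lambda>\<omega>. h' (A \<omega>) * D \<omega> ^ 2)"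
      unfolding P_def[abs_def] Bochner_Integration.integral_diff[OF integrable_plus[OF ii(1,2)] ii(3)]
        Bochner_Integration.integral_add[OF ii(1,2)] integral_mult_right_zero x0(1) x2(1) ..
    then show "expectation (P c) = 0" by simp
  qed
  define U where "U x = \<bar>x\<bar> ^ 3 + w x * \<bar>x\<bar>" for x :: real
  have Ule: "U x \<le> (1 + \<kappa>) * ((x\<^sup>2 + x ^ 4) / 2) + (1 - \<kappa>) * ((1 + x\<^sup>2) / 2)" for x
  proof -
    have "2 * 1 * \<bar>x\<bar> \<le> 1\<^sup>2 + \<bar>x\<bar>\<^sup>2" "2 * \<bar>x\<bar> * x\<^sup>2 \<le> \<bar>x\<bar>\<^sup>2 + (x\<^sup>2)\<^sup>2" by (rule sum_squares_bound)+
    then have 1: "\<bar>x\<bar> \<le> (1 + x\<^sup>2) / 2" and 3: "\<bar>x\<bar> ^ 3 \<le> (x\<^sup>2 + x ^ 4) / 2"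
      by (simp_all add: power3_eq_cube power2_eq_square power4_eq_xxxx algebra_simps)
    have "U x = (1 + \<kappa>) * \<bar>x\<bar> ^ 3 + (1 - \<kappa>) * \<bar>x\<bar>"
      by (simp add: U_def w_def power3_eq_cube power2_eq_square algebra_simps abs_mult_self_eq)
    also have "\<dots> \<le> (1 + \<kappa>) * ((x\<^sup>2 + x ^ 4) / 2) + (1 - \<kappa>) * ((1 + x\<^sup>2) / 2)"
      using 1 3 \<kappa> by (intro add_mono mult_left_mono) auto
    finally show ?thesis .
  qed
  have U0: "0 \<le> U x" for x using w0 by (simp add: U_def)
  have mU: "U \<in> borel_measurable borel" unfolding U_def[abs_def] w_def[abs_def] by measurable
  have [measurable]: "X i \<in> borel_measurable M" by (rule measurable_X[OF i])
  define V where "V \<omega> = (1 + \<kappa>) * (((X i \<omega>)\<^sup>2 + (X i \<omega>) ^ 4) / 2) + (1 - \<kappa>) * ((1 + (X i \<omega>)\<^sup>2) / 2)" for \<omega>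
  have iV: "integrable M V"
    unfolding V_def[abs_def] using integrable_X_power[OF i, of 2] integrable_X_power[OF i, of 4]
    by (intro integrable_plus integrable_mult_right Bochner_Integration.integrable_divide_zero) simp_all
  have iU: "integrable M (\<lambda>\<omega>. U (X i \<omega>))"
  proof (rule integrable_dominated[OF iV])
    show "(\<lambda>\<omega>. U (X i \<omega>)) \<in> borel_measurable M" by (rule measurable_compose[OF measurable_X[OF i] mU])
    show "\<bar>U (X i \<omega>)\<bar> \<le> V \<omega>" for \<omega>
      using Ule[of "X i \<omega>"] by (simp only: V_def abs_of_nonneg U0)
  qed
  have EU: "expectation (\<lambda>\<omega>. U (X i \<omega>)) \<le> 2 * \<beta>"
  proof -
    have "expectation (\<lambda>\<omega>. U (X i \<omega>)) \<le> expectation V"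
      by (rule integral_mono[OF iU iV]) (simp only: V_def Ule)
    also have "\<dots> = (1 + \<kappa>) * ((1 + expectation (\<lambda>\<omega>. (X i \<omega>) ^ 4)) / 2) + (1 - \<kappa>)"
      unfolding V_def[abs_def] using integrable_X_power[OF i, of 2] integrable_X_power[OF i, of 4] var_X[OF i] prob_space
      by simp
    also have "\<dots> \<le> (1 + \<kappa>) * \<beta> + (1 - \<kappa>) * \<beta>"
      using \<kappa> beta_ge_1 fourth_X[OF i] mult_left_mono[of 1 \<beta> "1 - \<kappa>"] by (intro add_mono mult_left_mono) auto
    finally show ?thesis by (simp add: algebra_simps)
  qed
  note iUD = integral_factor[OF i T dD3 iD3 mU iU]
  \<comment> \<open>Taylor expansion around the value \<open>A\<close> of \<open>F\<close> at \<open>X i = 0\<close>.\<close>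
  have taylor: "\<bar>X i \<omega> * D \<omega> * h (F \<omega>) - h' (F \<omega>) * (w (X i \<omega>) * (D \<omega>)\<^sup>2)
      - P (1 - \<kappa>) \<omega>\<bar> \<le> L * (U (X i \<omega>) * \<bar>D \<omega>\<bar> ^ 3)" for \<omega>
  proof -
    define x where "x = X i \<omega>"
    define b where "b = D \<omega>"
    define c where "c = A \<omega>"
    have "\<bar>h (c + x * b) - h c - x * b * h' c\<bar> \<le> L * \<bar>x * b\<bar>\<^sup>2"
    proof -
      have "norm ((\<lambda>t. h t - t * h' c) (c + x * b) - (\<lambda>t. h t - t * h' c) c) \<le> (L * \<bar>x * b\<bar>) * norm ((c + x * b) - c)"
      proof (rule field_differentiable_bound[where S = "cball c \<bar>x * b\<bar>" and f' = "\<lambda>t. h' t - h' c"])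
        show "((\<lambda>t. h t - t * h' c) has_field_derivative h' t - h' c) (at t within cball c \<bar>x * b\<bar>)" for t
          by (rule has_field_derivative_at_within) (auto intro!: derivative_eq_intros h)
        show "norm (h' t - h' c) \<le> L * \<bar>x * b\<bar>" if "t \<in> cball c \<bar>x * b\<bar>" for t
        proof -
          have "\<bar>t - c\<bar> \<le> \<bar>x * b\<bar>" using that by (simp add: dist_real_def abs_minus_commute)
          then show ?thesis using order.trans[OF lip[of t c] mult_left_mono[OF _ L]] by simp
        qed
      qed (auto simp: dist_real_def)
      then show ?thesis by (simp add: power2_eq_square algebra_simps)
    qed
    then have 1: "\<bar>x * b\<bar> * \<bar>h (c + x * b) - h c - x * b * h' c\<bar> \<le> \<bar>x * b\<bar> * (L * \<bar>x * b\<bar>\<^sup>2)"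
      by (rule mult_left_mono) simp
    have 2: "w x * b\<^sup>2 * \<bar>h' (c + x * b) - h' c\<bar> \<le> w x * b\<^sup>2 * (L * \<bar>x * b\<bar>)"
      using lip[of "c + x * b" c] w0[of x] by (intro mult_left_mono) auto
    have "x * b * h (c + x * b) - h' (c + x * b) * (w x * b\<^sup>2)
        - (x * (h c * b ^ 1) + (1 - \<kappa>) * (x\<^sup>2 * (h' c * b ^ 2)) - (1 - \<kappa>) * (h' c * b ^ 2))
      = x * b * (h (c + x * b) - h c - x * b * h' c) - w x * b\<^sup>2 * (h' (c + x * b) - h' c)"
      by (simp add: w_def algebra_simps power2_eq_square)
    also have "\<bar>\<dots>\<bar> \<le> \<bar>x * b\<bar> * \<bar>h (c + x * b) - h c - x * b * h' c\<bar> + w x * b\<^sup>2 * \<bar>h' (c + x * b) - h' c\<bar>"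
    proof -
      have "\<bar>w x\<bar> = w x" using w0[of x] by simp
      then show ?thesis
        using abs_triangle_ineq4[of "x * b * (h (c + x * b) - h c - x * b * h' c)" "w x * b\<^sup>2 * (h' (c + x * b) - h' c)"]
        by (simp only: abs_mult power2_abs abs_power2)
    qed
    also have "\<dots> \<le> \<bar>x * b\<bar> * (L * \<bar>x * b\<bar>\<^sup>2) + w x * b\<^sup>2 * (L * \<bar>x * b\<bar>)" by (rule add_mono[OF 1 2])
    also have "\<dots> = L * (U x * \<bar>b\<bar> ^ 3)"
      by (simp add: U_def abs_mult power_mult_distrib power3_eq_cube power2_eq_square algebra_simps abs_mult_self_eq)
    finally show ?thesis by (simp only: x_def b_def c_def F_def P_def)
  qed
  have w: "1 - \<kappa> + \<kappa> * (X i \<omega>)\<^sup>2 = w (X i \<omega>)" for \<omega> by (simp add: w_def)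
  let ?R = "\<lambda>\<omega>. X i \<omega> * D \<omega> * h (F \<omega>) - h' (F \<omega>) * (w (X i \<omega>) * (D \<omega>)\<^sup>2) - P (1 - \<kappa>) \<omega>"
  note i2' = i2[unfolded w]
  have "\<bar>expectation (\<lambda>\<omega>. X i \<omega> * D \<omega> * h (F \<omega>)) - expectation (\<lambda>\<omega>. h' (F \<omega>) * (w (X i \<omega>) * (D \<omega>)\<^sup>2)) - expectation (P (1 - \<kappa>))\<bar>
    = \<bar>expectation (\<lambda>\<omega>. ?R \<omega>)\<bar>"
    by (simp only: Bochner_Integration.integral_diff Bochner_Integration.integrable_diff i1 i2' iP(1))
  also have "\<dots> \<le> expectation (\<lambda>\<omega>. \<bar>?R \<omega>\<bar>)"
    by (rule integral_abs_bound)
  also have "\<dots> \<le> expectation (\<lambda>\<omega>. L * (U (X i \<omega>) * \<bar>D \<omega>\<bar> ^ 3))"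
    by (rule integral_mono[OF integrable_abs[OF Bochner_Integration.integrable_diff[OF Bochner_Integration.integrable_diff[OF i1 i2'] iP(1)]]
      integrable_mult_right[OF iUD(1)] taylor])
  also have "\<dots> = L * (expectation (\<lambda>\<omega>. U (X i \<omega>)) * expectation (\<lambda>\<omega>. \<bar>D \<omega>\<bar> ^ 3))"
    by (simp only: integral_mult_right_zero iUD(2))
  also have "\<dots> \<le> L * (2 * \<beta> * expectation (\<lambda>\<omega>. \<bar>D \<omega>\<bar> ^ 3))"
    using L EU by (intro mult_left_mono mult_right_mono) auto
  finally show "\<bar>expectation (\<lambda>\<omega>. X i \<omega> * D \<omega> * h (F \<omega>))
        - expectation (\<lambda>\<omega>. h' (F \<omega>) * ((1 - \<kappa> + \<kappa> * (X i \<omega>)\<^sup>2) * (D \<omega>)\<^sup>2))\<bar>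
      \<le> L * (2 * \<beta> * expectation (\<lambda>\<omega>. \<bar>D \<omega>\<bar> ^ 3))"
    unfolding w iP(2) by simp
qed

end

section \<open>Spectral bound for the carre du champ\<close>

lemma prod_one_plus_expand:
  fixes y :: "'i \<Rightarrow> real"
  assumes "finite K"
  shows "(\<Prod>i\<in>K. 1 + y i) = (\<Sum>R\<in>Pow K. \<Prod>i\<in>R. y i)"
  using assms
proof (induction K rule: finite_induct)
  case (insert k K)
  have "(\<Sum>R\<in>Pow K. \<Prod>i\<in>insert k R. y i) = (\<Sum>R\<in>Pow K. y k * (\<Prod>i\<in>R. y i))"
  proof (intro sum.cong refl)
    fix R assume "R \<in> Pow K"
    then have "finite R" "k \<notin> R" using insert finite_subset by auto
    then show "(\<Prod>i\<in>insert k R. y i) = y k * (\<Prod>i\<in>R. y i)" by simp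
  qed
  then show ?case using insert by (simp add: sum_Pow_insert distrib_right flip: sum_distrib_left)
qed simp

text \<open>In the application \<open>K\<close> is the set of the variables common to two monomials and \<open>1 + y i\<close> is \<open>(X i)\<^sup>2\<close>:
  weighting the expansion of their product by eigenvalues amounts to a sum over the common variables.\<close>

lemma weighted_prod_one_plus_expand:
  fixes y :: "'i \<Rightarrow> real"
  assumes "finite K"
  shows "(\<Sum>R\<in>Pow K. (2 * real (card K) - real (card R)) * (\<Prod>i\<in>R. y i))
    = (\<Sum>i\<in>K. (2 + y i) * (\<Prod>j\<in>K - {i}. 1 + y j))"
  using assms
proof (induction K rule: finite_induct)
  case (insert k K)
  let ?g = "\<lambda>R. (2 * real (card (insert k K)) - real (card R)) * (\<Prod>i\<in>R. y i)"
  let ?f = "\<lambda>R. (2 * real (card K) - real (card R)) * (\<Prod>i\<in>R. y i)"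
  have kK: "card (insert k K) = Suc (card K)" using insert by simp
  have "(\<Sum>R\<in>Pow (insert k K). ?g R)
    = (\<Sum>R\<in>Pow K. ?g R)
      + (\<Sum>R\<in>Pow K. ?g (insert k R))"
    by (rule sum_Pow_insert[OF insert(1,2)])
  also have "(\<Sum>R\<in>Pow K. ?g R)
    = (\<Sum>R\<in>Pow K. ?f R + 2 * (\<Prod>i\<in>R. y i))"
    by (intro sum.cong refl) (simp add: kK algebra_simps)
  also have "(\<Sum>R\<in>Pow K. ?g (insert k R))
    = (\<Sum>R\<in>Pow K. y k * ?f R + y k * (\<Prod>i\<in>R. y i))"
  proof (intro sum.cong refl)
    fix R assume "R \<in> Pow K"
    then have "finite R" "k \<notin> R" using insert finite_subset by auto
    then show "?g (insert k R) = y k * ?f R + y k * (\<Prod>i\<in>R. y i)"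
      by (simp add: kK algebra_simps)
  qed
  also have "(\<Sum>R\<in>Pow K. ?f R + 2 * (\<Prod>i\<in>R. y i)) + (\<Sum>R\<in>Pow K. y k * ?f R + y k * (\<Prod>i\<in>R. y i))
     = (1 + y k) * (\<Sum>R\<in>Pow K. ?f R) + (2 + y k) * (\<Prod>i\<in>K. 1 + y i)"
    unfolding sum.distrib sum_distrib_left[symmetric] prod_one_plus_expand[OF insert(1)] by (simp only: distrib_right mult_1_left add_ac)
  also have "\<dots> = (2 + y k) * (\<Prod>i\<in>K. 1 + y i) + (\<Sum>i\<in>K. (2 + y i) * ((1 + y k) * (\<Prod>j\<in>K - {i}. 1 + y j)))"
    unfolding insert.IH sum_distrib_left by (simp add: mult.left_commute)
  also have "(\<Sum>i\<in>K. (2 + y i) * ((1 + y k) * (\<Prod>j\<in>K - {i}. 1 + y j))) = (\<Sum>i\<in>K. (2 + y i) * (\<Prod>j\<in>insert k K - {i}. 1 + y j))"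
  proof (intro sum.cong refl)
    fix i assume "i \<in> K"
    then have "insert k K - {i} = insert k (K - {i})" using insert by auto
    moreover have "finite (K - {i})" "k \<notin> K - {i}" using insert by auto
    ultimately show "(2 + y i) * ((1 + y k) * (\<Prod>j\<in>K - {i}. 1 + y j)) = (2 + y i) * (\<Prod>j\<in>insert k K - {i}. 1 + y j)" by simp
  qed
  also have "(2 + y k) * (\<Prod>i\<in>K. 1 + y i) + \<dots> = (\<Sum>i\<in>insert k K. (2 + y i) * (\<Prod>j\<in>insert k K - {i}. 1 + y j))"
    using insert by simp
  finally show ?case .
qed simp

lemma prod_mult_prod_eq:
  fixes x :: "'i \<Rightarrow> real"
  assumes "finite S" "finite T"
  shows "(\<Prod>i\<in>S. x i) * (\<Prod>i\<in>T. x i) = (\<Prod>i\<in>(S - T) \<union> (T - S). x i) * (\<Prod>i\<in>S \<inter> T. (x i)\<^sup>2)"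
proof -
  have S: "(\<Prod>i\<in>S. x i) = (\<Prod>i\<in>S - T. x i) * (\<Prod>i\<in>S \<inter> T. x i)"
    using assms by (subst prod.union_disjoint[symmetric]) (auto intro!: prod.cong)
  have T: "(\<Prod>i\<in>T. x i) = (\<Prod>i\<in>T - S. x i) * (\<Prod>i\<in>S \<inter> T. x i)"
    using assms by (subst prod.union_disjoint[symmetric]) (auto intro!: prod.cong)
  have U: "(\<Prod>i\<in>(S - T) \<union> (T - S). x i) = (\<Prod>i\<in>S - T. x i) * (\<Prod>i\<in>T - S. x i)"
    using assms by (intro prod.union_disjoint) auto
  show ?thesis unfolding S T U by (simp add: power2_eq_square prod.distrib mult_ac)
qed

text \<open>Grouping by \<open>key\<close> yields orthogonal functions \<open>G k\<close>; the two sides are then the sums of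
  \<open>(l k)\<^sup>2 E (G k)\<^sup>2\<close> and of \<open>\<Lambda> * l k * E (G k)\<^sup>2\<close>.\<close>

lemma orthogonal_family_multiplier_le:
  fixes g :: "'j \<Rightarrow> 'a \<Rightarrow> real" and key :: "'j \<Rightarrow> 'k" and l :: "'k \<Rightarrow> real"
  assumes fin: "finite J" and g: "\<And>j. j \<in> J \<Longrightarrow> sq_integrable M (g j)"
    and orth: "\<And>i j. i \<in> J \<Longrightarrow> j \<in> J \<Longrightarrow> key i \<noteq> key j \<Longrightarrow> (\<integral>x. g i x * g j x \<partial>M) = 0"
    and l: "\<And>j. j \<in> J \<Longrightarrow> 0 \<le> l (key j) \<and> l (key j) \<le> \<Lambda>"
  shows "(\<integral>x. (\<Sum>j\<in>J. l (key j) * g j x)\<^sup>2 \<partial>M)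
    \<le> \<Lambda> * (\<integral>x. (\<Sum>j\<in>J. l (key j) * g j x) * (\<Sum>j\<in>J. g j x) \<partial>M)"
proof -
  define G where "G k x = (\<Sum>j\<in>{j\<in>J. key j = k}. g j x)" for k x
  let ?K = "key ` J"
  have finK: "finite ?K" using fin by simp
  have sqG: "sq_integrable M (G k)" for k
    unfolding G_def[abs_def] by (rule sq_integrable_sum) (use g in blast)
  have group: "(\<Sum>j\<in>J. c (key j) * g j x) = (\<Sum>k\<in>?K. c k * G k x)" for c x
  proof -
    have "(\<Sum>k\<in>?K. c k * G k x) = (\<Sum>k\<in>?K. \<Sum>j\<in>{j\<in>J. key j = k}. c (key j) * g j x)"
      unfolding G_def sum_distrib_left by (intro sum.cong refl) auto
    also have "\<dots> = (\<Sum>j\<in>J. c (key j) * g j x)" by (rule sum.group[OF fin finK]) simp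
    finally show ?thesis by simp
  qed
  have orthG: "(\<integral>x. G k x * G k' x \<partial>M) = 0" if "k \<noteq> k'" for k k'
  proof -
    have "(\<integral>x. G k x * G k' x \<partial>M) = (\<integral>x. (\<Sum>i\<in>{j\<in>J. key j = k}. \<Sum>j\<in>{j\<in>J. key j = k'}. g i x * g j x) \<partial>M)"
      unfolding G_def sum_product ..
    also have "\<dots> = (\<Sum>i\<in>{j\<in>J. key j = k}. \<Sum>j\<in>{j\<in>J. key j = k'}. \<integral>x. g i x * g j x \<partial>M)"
    proof (subst expectation_sum)
      show "integrable M (\<lambda>x. \<Sum>j\<in>{j\<in>J. key j = k'}. g i x * g j x)" if "i \<in> {j\<in>J. key j = k}" for i
        using that by (intro Bochner_Integration.integrable_sum integrable_mult_of_sq_integrable g) auto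
      show "(\<Sum>i\<in>{j\<in>J. key j = k}. \<integral>x. (\<Sum>j\<in>{j\<in>J. key j = k'}. g i x * g j x) \<partial>M)
        = (\<Sum>i\<in>{j\<in>J. key j = k}. \<Sum>j\<in>{j\<in>J. key j = k'}. \<integral>x. g i x * g j x \<partial>M)"
        by (intro sum.cong refl expectation_sum integrable_mult_of_sq_integrable g) auto
    qed
    also have "\<dots> = 0" using orth that by (intro sum.neutral ballI) auto
    finally show ?thesis .
  qed
  have bilinear: "(\<integral>x. (\<Sum>k\<in>?K. c k * G k x) * (\<Sum>k\<in>?K. d k * G k x) \<partial>M) = (\<Sum>k\<in>?K. c k * d k * (\<integral>x. (G k x)\<^sup>2 \<partial>M))" for c d
  proof -
    have "(\<integral>x. (\<Sum>k\<in>?K. c k * G k x) * (\<Sum>k\<in>?K. d k * G k x) \<partial>M)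
      = (\<integral>x. (\<Sum>k\<in>?K. \<Sum>k'\<in>?K. (c k * d k') * (G k x * G k' x)) \<partial>M)"
      unfolding sum_product by (simp only: mult_ac)
    also have "\<dots> = (\<Sum>k\<in>?K. \<integral>x. (\<Sum>k'\<in>?K. (c k * d k') * (G k x * G k' x)) \<partial>M)"
      by (intro expectation_sum Bochner_Integration.integrable_sum integrable_mult_right
          integrable_mult_of_sq_integrable sqG)
    also have "\<dots> = (\<Sum>k\<in>?K. \<Sum>k'\<in>?K. (c k * d k') * (\<integral>x. G k x * G k' x \<partial>M))"
      by (subst expectation_sum)
         (intro integrable_mult_right integrable_mult_of_sq_integrable sqG, simp)
    also have "\<dots> = (\<Sum>k\<in>?K. \<Sum>k'\<in>?K. if k' = k then c k * d k * (\<integral>x. (G k x)\<^sup>2 \<partial>M) else 0)"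
      by (intro sum.cong refl) (auto simp: orthG power2_eq_square)
    also have "\<dots> = (\<Sum>k\<in>?K. c k * d k * (\<integral>x. (G k x)\<^sup>2 \<partial>M))"
      using finK by (intro sum.cong refl) (simp only: sum.delta if_True)
    finally show ?thesis .
  qed
  have one: "(\<Sum>j\<in>J. g j x) = (\<Sum>k\<in>?K. 1 * G k x)" for x using group[of "\<lambda>_. 1" x] by simp
  have "(\<integral>x. (\<Sum>j\<in>J. l (key j) * g j x)\<^sup>2 \<partial>M) = (\<Sum>k\<in>?K. l k * l k * (\<integral>x. (G k x)\<^sup>2 \<partial>M))"
    unfolding power2_eq_square[of "sum _ _"] group by (rule bilinear)
  also have "\<dots> \<le> (\<Sum>k\<in>?K. \<Lambda> * (l k * 1 * (\<integral>x. (G k x)\<^sup>2 \<partial>M)))"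
  proof (rule sum_mono)
    fix k assume "k \<in> ?K"
    then have "0 \<le> l k" "l k \<le> \<Lambda>" using l by auto
    then have "l k * l k \<le> \<Lambda> * l k" by (intro mult_right_mono)
    from mult_right_mono[OF this, of "\<integral>x. (G k x)\<^sup>2 \<partial>M"]
    show "l k * l k * (\<integral>x. (G k x)\<^sup>2 \<partial>M) \<le> \<Lambda> * (l k * 1 * (\<integral>x. (G k x)\<^sup>2 \<partial>M))" by (simp add: mult.assoc)
  qed
  also have "\<dots> = \<Lambda> * (\<integral>x. (\<Sum>k\<in>?K. l k * G k x) * (\<Sum>k\<in>?K. 1 * G k x) \<partial>M)"
    by (subst bilinear) (rule sum_distrib_left[symmetric])
  finally show ?thesis unfolding group one .
qed

context normalized_family
begin

text \<open>The square of a multilinear polynomial contains some variables twice.  Writing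
  \<open>(X i)\<^sup>2 = 1 + ((X i)\<^sup>2 - 1)\<close>, it becomes a combination of products of centered functions of
  distinct variables; \<open>R\<close> is the set of the variables that enter through \<open>(X i)\<^sup>2 - 1\<close>.\<close>

definition centered_monomial :: "'i set \<Rightarrow> 'i set \<Rightarrow> 'a \<Rightarrow> real" where
  "centered_monomial R A \<omega> = (\<Prod>i\<in>A. if i \<in> R then (X i \<omega>)\<^sup>2 - 1 else X i \<omega>)"

lemma centered_factor:
  fixes R :: "'i set"
  assumes "i \<in> I"
  defines "v \<equiv> \<lambda>x::real. if i \<in> R then x\<^sup>2 - 1 else x"
  shows "v \<in> borel_measurable borel" "integrable M (\<lambda>\<omega>. (v (X i \<omega>))\<^sup>2)"
    "integrable M (\<lambda>\<omega>. v (X i \<omega>))" "expectation (\<lambda>\<omega>. v (X i \<omega>)) = 0"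
proof -
  note int = integrable_X_power[OF assms(1)]
  show "v \<in> borel_measurable borel" unfolding v_def by measurable
  have "integrable M (\<lambda>\<omega>. (X i \<omega>) ^ 4 + (1 - 2 * (X i \<omega>)\<^sup>2))"
    by (intro integrable_plus Bochner_Integration.integrable_diff integrable_mult_right int integrable_const) auto
  moreover have "((X i \<omega>)\<^sup>2 - 1)\<^sup>2 = (X i \<omega>) ^ 4 + (1 - 2 * (X i \<omega>)\<^sup>2)" for \<omega>
    by (simp add: power2_diff)
  ultimately show "integrable M (\<lambda>\<omega>. (v (X i \<omega>))\<^sup>2)" using int[of 2] by (cases "i \<in> R") (simp_all add: v_def)
  show "integrable M (\<lambda>\<omega>. v (X i \<omega>))" using int[of 2] int[of 1] by (cases "i \<in> R") (simp_all add: v_def)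
  show "expectation (\<lambda>\<omega>. v (X i \<omega>)) = 0"
    using int[of 2] mean_X[OF assms(1)] var_X[OF assms(1)] prob_space by (cases "i \<in> R") (simp_all add: v_def)
qed

lemma sq_integrable_centered_monomial:
  assumes "A \<subseteq> I"
  shows "sq_integrable M (centered_monomial R A)"
proof -
  have "integrable M (\<lambda>\<omega>. \<Prod>i\<in>A. (if i \<in> R then (X i \<omega>)\<^sup>2 - 1 else X i \<omega>)\<^sup>2)"
    by (rule integrable_prod[OF assms, where u = "\<lambda>i x. (if i \<in> R then x\<^sup>2 - 1 else x)\<^sup>2"])
       (use assms centered_factor(2) in \<open>auto simp: subset_eq\<close>)
  moreover have "(\<lambda>\<omega>. \<Prod>i\<in>A. if i \<in> R then (X i \<omega>)\<^sup>2 - 1 else X i \<omega>) \<in> borel_measurable M"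
  proof (rule borel_measurable_prod)
    fix i assume "i \<in> A"
    then have "X i \<in> borel_measurable M" using assms measurable_X by auto
    then show "(\<lambda>\<omega>. if i \<in> R then (X i \<omega>)\<^sup>2 - 1 else X i \<omega>) \<in> borel_measurable M" by simp
  qed
  ultimately show ?thesis by (simp add: sq_integrable_def centered_monomial_def[abs_def] prod_power_distrib)
qed

lemma depends_on_centered_monomial: "A \<subseteq> T \<Longrightarrow> depends_on T (centered_monomial R A)"
  unfolding centered_monomial_def[abs_def]
proof (rule depends_on_prod)
  fix j assume "A \<subseteq> T" "j \<in> A"
  then have "depends_on T (X j)" by (intro depends_on_var) auto
  then show "depends_on T (\<lambda>\<omega>. if j \<in> R then (X j \<omega>)\<^sup>2 - 1 else X j \<omega>)"
    by (rule depends_on_compose[where g = "\<lambda>x. if j \<in> R then x\<^sup>2 - 1 else x"]) measurable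
qed

lemma centered_monomials_orthogonal:
  assumes "A \<subseteq> I" "B \<subseteq> I" "A \<noteq> B"
  shows "expectation (\<lambda>\<omega>. centered_monomial R A \<omega> * centered_monomial Q B \<omega>) = 0"
proof -
  have main: "expectation (\<lambda>\<omega>. centered_monomial R A \<omega> * centered_monomial Q B \<omega>) = 0"
    if A: "A \<subseteq> I" and B: "B \<subseteq> I" and i: "i \<in> A" "i \<notin> B" for A B R Q i
  proof -
    have iI: "i \<in> I" and finA: "finite A" using A i finite_I finite_subset by auto
    let ?v = "\<lambda>x::real. if i \<in> R then x\<^sup>2 - 1 else x"
    let ?V = "\<lambda>\<omega>. centered_monomial R (A - {i}) \<omega> * centered_monomial Q B \<omega>"
    have split: "centered_monomial R A \<omega> * centered_monomial Q B \<omega> = ?v (X i \<omega>) * ?V \<omega>" for \<omega>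
      unfolding centered_monomial_def by (simp add: prod.remove[OF finA i(1)])
    have dV: "depends_on (I - {i}) ?V"
      using A B i by (intro depends_on_binary(2) depends_on_centered_monomial) auto
    have iV: "integrable M ?V"
      using A B by (intro integrable_mult_of_sq_integrable sq_integrable_centered_monomial) auto
    show ?thesis
      unfolding split integral_factor(2)[OF iI subset_refl dV iV centered_factor(1,3)[OF iI]] centered_factor(4)[OF iI]
      by simp
  qed
  show ?thesis
  proof (cases "\<exists>i. i \<in> A \<and> i \<notin> B")
    case True
    then show ?thesis using main assms by blast
  next
    case False
    then obtain i where "i \<in> B" "i \<notin> A" using assms by auto
    then show ?thesis using main[of B A i Q R] assms by (simp add: mult.commute)
  qed
qed

definition homogeneous :: "nat \<Rightarrow> ('i set \<Rightarrow> real) \<Rightarrow> bool" where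
  "homogeneous d a \<longleftrightarrow> (\<forall>S\<subseteq>I. a S \<noteq> 0 \<longrightarrow> card S = d)"

lemma homogeneousD: "homogeneous d a \<Longrightarrow> S \<subseteq> I \<Longrightarrow> a S \<noteq> 0 \<Longrightarrow> card S = d"
  by (simp add: homogeneous_def)

definition partial :: "('i set \<Rightarrow> real) \<Rightarrow> 'i \<Rightarrow> 'a \<Rightarrow> real" where
  "partial a i = multilinear_sum X (I - {i}) (\<lambda>S. a (insert i S))"

lemma partial_properties:
  shows "depends_on (I - {i}) (partial a i)" "L4_integrable M (partial a i)"
    "depends_on (I - {i}) (multilinear_sum X (I - {i}) a)" "L4_integrable M (multilinear_sum X (I - {i}) a)"
  unfolding partial_def by (intro depends_on_multilinear_sum L4_multilinear_sum; auto)+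

lemma multilinear_sum_split:
  assumes "i \<in> I"
  shows "multilinear_sum X I a \<omega> = multilinear_sum X (I - {i}) a \<omega> + X i \<omega> * partial a i \<omega>"
  using multilinear_sum_insert[of "I - {i}" i X a \<omega>] assms finite_I by (simp add: insert_absorb partial_def)

lemma partial_eq:
  assumes i: "i \<in> I" and hom: "homogeneous d a"
  shows "partial a i \<omega> = (\<Sum>S\<in>{S\<in>Pow I. card S = d}. if i \<in> S then a S * (\<Prod>j\<in>S - {i}. X j \<omega>) else 0)"
proof -
  let ?c = "\<lambda>S. if i \<in> S then a S * (\<Prod>j\<in>S - {i}. X j \<omega>) else 0"
  have "partial a i \<omega> = (\<Sum>S\<in>{S\<in>Pow I. i \<in> S}. a S * (\<Prod>j\<in>S - {i}. X j \<omega>))"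
    unfolding partial_def multilinear_sum_def
    by (rule sum.reindex_bij_witness[of _ "\<lambda>S. S - {i}" "insert i"])
       (use i in \<open>auto simp: insert_absorb intro!: prod.cong\<close>)
  also have "\<dots> = (\<Sum>S\<in>Pow I. ?c S)"
    by (rule sum.inter_filter) (simp add: finite_I)
  also have "\<dots> = (\<Sum>S\<in>{S\<in>Pow I. card S = d}. ?c S)"
    using finite_I hom unfolding homogeneous_def by (intro sum.mono_neutral_right) auto
  finally show ?thesis .
qed

lemma multilinear_sum_homogeneous:
  assumes hom: "homogeneous d a"
  shows "multilinear_sum X I a \<omega> = (\<Sum>S\<in>{S\<in>Pow I. card S = d}. a S * (\<Prod>j\<in>S. X j \<omega>))"
  unfolding multilinear_sum_def using finite_I hom unfolding homogeneous_def by (intro sum.mono_neutral_right) auto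

lemma euler_identity:
  assumes hom: "homogeneous d a"
  shows "(\<Sum>i\<in>I. X i \<omega> * partial a i \<omega>) = real d * multilinear_sum X I a \<omega>"
proof -
  let ?c = "\<lambda>i S. if i \<in> S then a S * (\<Prod>j\<in>S. X j \<omega>) else 0"
  let ?\<S> = "{S\<in>Pow I. card S = d}"
  have "(\<Sum>i\<in>I. X i \<omega> * partial a i \<omega>)
    = (\<Sum>i\<in>I. \<Sum>S\<in>?\<S>. ?c i S)"
  proof (intro sum.cong refl)
    fix i assume i: "i \<in> I"
    show "X i \<omega> * partial a i \<omega> = (\<Sum>S\<in>?\<S>. ?c i S)"
      unfolding partial_eq[OF i hom] sum_distrib_left
    proof (intro sum.cong refl)
      fix S assume "S \<in> ?\<S>"
      then have "finite S" using finite_I finite_subset by auto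
      then show "X i \<omega> * (if i \<in> S then a S * (\<Prod>j\<in>S - {i}. X j \<omega>) else 0) = (?c i S)"
        by (simp add: prod.remove)
    qed
  qed
  also have "\<dots> = (\<Sum>S\<in>?\<S>. \<Sum>i\<in>I. ?c i S)" by (rule sum.swap)
  also have "\<dots> = (\<Sum>S\<in>?\<S>. real d * (a S * (\<Prod>j\<in>S. X j \<omega>)))"
  proof (intro sum.cong refl)
    fix S assume "S \<in> ?\<S>"
    then have "{i\<in>I. i \<in> S} = S" "card S = d" by auto
    then show "(\<Sum>i\<in>I. ?c i S) = real d * (a S * (\<Prod>j\<in>S. X j \<omega>))"
      using finite_I by (simp flip: sum.inter_filter)
  qed
  also have "\<dots> = real d * multilinear_sum X I a \<omega>"
    unfolding multilinear_sum_homogeneous[OF hom] sum_distrib_left ..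
  finally show ?thesis .
qed

text \<open>Let \<open>L\<close> be the generator that resamples each variable at rate one, so that a centered monomial
  in \<open>k\<close> variables is an eigenfunction with eigenvalue \<open>- k\<close>.  For \<open>F\<close> homogeneous of degree \<open>d\<close>, the
  carre du champ \<open>(L (F\<^sup>2) - 2 F L F) / 2\<close> equals \<open>(L + 2 d) (F\<^sup>2) / 2\<close>, and a computation in each variable
  gives the formula below.\<close>

definition carre_du_champ :: "('i set \<Rightarrow> real) \<Rightarrow> 'a \<Rightarrow> real" where
  "carre_du_champ a \<omega> = 1 / 2 * (\<Sum>i\<in>I. (1 + (X i \<omega>)\<^sup>2) * (partial a i \<omega>)\<^sup>2)"

lemma centered_monomial_factor:
  assumes "S \<subseteq> I" "T \<subseteq> I" "R \<subseteq> S \<inter> T"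
  shows "centered_monomial R ((S - T) \<union> (T - S) \<union> R) \<omega>
    = (\<Prod>i\<in>(S - T) \<union> (T - S). X i \<omega>) * (\<Prod>i\<in>R. (X i \<omega>)\<^sup>2 - 1)"
proof -
  have fin: "finite S" "finite T" "finite R" using assms finite_I by (auto intro: finite_subset)
  have "centered_monomial R ((S - T) \<union> (T - S) \<union> R) \<omega>
    = centered_monomial R ((S - T) \<union> (T - S)) \<omega> * centered_monomial R R \<omega>"
    unfolding centered_monomial_def using assms fin by (intro prod.union_disjoint) auto
  moreover have "centered_monomial R ((S - T) \<union> (T - S)) \<omega> = (\<Prod>i\<in>(S - T) \<union> (T - S). X i \<omega>)"
    unfolding centered_monomial_def using assms by (intro prod.cong) auto
  ultimately show ?thesis by (simp add: centered_monomial_def)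
qed

lemma monomial_product_expansion:
  assumes "S \<subseteq> I" "T \<subseteq> I"
  shows "(\<Prod>i\<in>S. X i \<omega>) * (\<Prod>i\<in>T. X i \<omega>)
    = (\<Sum>R\<in>Pow (S \<inter> T). centered_monomial R ((S - T) \<union> (T - S) \<union> R) \<omega>)"
proof -
  have fin: "finite S" "finite T" "finite (S \<inter> T)" using assms finite_I by (auto intro: finite_subset)
  have "(\<Sum>R\<in>Pow (S \<inter> T). centered_monomial R ((S - T) \<union> (T - S) \<union> R) \<omega>)
    = (\<Sum>R\<in>Pow (S \<inter> T). (\<Prod>i\<in>(S - T) \<union> (T - S). X i \<omega>) * (\<Prod>i\<in>R. (X i \<omega>)\<^sup>2 - 1))"
    using assms by (intro sum.cong refl centered_monomial_factor) auto
  also have "\<dots> = (\<Prod>i\<in>(S - T) \<union> (T - S). X i \<omega>) * (\<Prod>i\<in>S \<inter> T. 1 + ((X i \<omega>)\<^sup>2 - 1))"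
    unfolding prod_one_plus_expand[OF fin(3)] sum_distrib_left ..
  finally show ?thesis by (simp add: prod_mult_prod_eq[OF fin(1,2)])
qed

lemma weighted_monomial_product_expansion:
  assumes S: "S \<subseteq> I" "card S = d" and T: "T \<subseteq> I" "card T = d"
  shows "(\<Sum>R\<in>Pow (S \<inter> T). (2 * real d - real (card ((S - T) \<union> (T - S) \<union> R))) / 2
        * centered_monomial R ((S - T) \<union> (T - S) \<union> R) \<omega>)
    = (\<Sum>i\<in>S \<inter> T. 1 / 2 * (1 + (X i \<omega>)\<^sup>2) * ((\<Prod>j\<in>S - {i}. X j \<omega>) * (\<Prod>j\<in>T - {i}. X j \<omega>)))"
proof -
  let ?K = "S \<inter> T" and ?U = "(S - T) \<union> (T - S)"
  let ?y = "\<lambda>i. (X i \<omega>)\<^sup>2 - 1" and ?u = "\<Prod>i\<in>(S - T) \<union> (T - S). X i \<omega>"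
  have fin: "finite S" "finite T" "finite ?K" using assms finite_I by (auto intro: finite_subset)
  have cS: "card (S - T) + card ?K = d"
    using fin S by (subst card_Un_disjoint[symmetric]) (auto intro!: arg_cong[where f = card])
  have cT: "card (T - S) + card ?K = d"
    using fin T by (subst card_Un_disjoint[symmetric]) (auto intro!: arg_cong[where f = card])
  have "(\<Sum>R\<in>Pow ?K. (2 * real d - real (card (?U \<union> R))) / 2 * centered_monomial R (?U \<union> R) \<omega>)
    = (\<Sum>R\<in>Pow ?K. 1 / 2 * ?u * ((2 * real (card ?K) - real (card R)) * (\<Prod>i\<in>R. ?y i)))"
  proof (intro sum.cong refl)
    fix R assume "R \<in> Pow ?K"
    then have R: "R \<subseteq> ?K" "finite R" using fin finite_subset by auto
    have "card (?U \<union> R) = card ?U + card R" using R fin by (intro card_Un_disjoint) auto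
    moreover have "card ?U = card (S - T) + card (T - S)" using fin by (intro card_Un_disjoint) auto
    ultimately have "2 * real d - real (card (?U \<union> R)) = 2 * real (card ?K) - real (card R)"
      using cS cT by simp
    then show "(2 * real d - real (card (?U \<union> R))) / 2 * centered_monomial R (?U \<union> R) \<omega>
      = 1 / 2 * ?u * ((2 * real (card ?K) - real (card R)) * (\<Prod>i\<in>R. ?y i))"
      by (simp add: centered_monomial_factor[OF S(1) T(1) R(1)])
  qed
  also have "\<dots> = 1 / 2 * ?u * (\<Sum>i\<in>?K. (2 + ?y i) * (\<Prod>j\<in>?K - {i}. 1 + ?y j))"
    unfolding sum_distrib_left[symmetric] weighted_prod_one_plus_expand[OF fin(3)] ..
  also have "\<dots> = (\<Sum>i\<in>?K. 1 / 2 * (1 + (X i \<omega>)\<^sup>2) * ((\<Prod>j\<in>S - {i}. X j \<omega>) * (\<Prod>j\<in>T - {i}. X j \<omega>)))"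
    unfolding sum_distrib_left
  proof (intro sum.cong refl)
    fix i assume i: "i \<in> ?K"
    then have U: "(S - {i} - (T - {i})) \<union> (T - {i} - (S - {i})) = ?U" and K: "(S - {i}) \<inter> (T - {i}) = ?K - {i}" by auto
    have "(\<Prod>j\<in>S - {i}. X j \<omega>) * (\<Prod>j\<in>T - {i}. X j \<omega>) = ?u * (\<Prod>j\<in>?K - {i}. (X j \<omega>)\<^sup>2)"
      using prod_mult_prod_eq[of "S - {i}" "T - {i}" "\<lambda>j. X j \<omega>"] fin unfolding U K by simp
    then show "1 / 2 * ?u * ((2 + ?y i) * (\<Prod>j\<in>?K - {i}. 1 + ?y j))
      = 1 / 2 * (1 + (X i \<omega>)\<^sup>2) * ((\<Prod>j\<in>S - {i}. X j \<omega>) * (\<Prod>j\<in>T - {i}. X j \<omega>))"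
      by simp
  qed
  finally show ?thesis .
qed

text \<open>The centered monomials in \<open>F\<^sup>2\<close> involve at most \<open>2 d\<close> variables.  Passing from \<open>F\<^sup>2\<close> to its carre du
  champ multiplies those in \<open>k\<close> variables by \<open>(2 d - k) / 2\<close>, a number between \<open>0\<close> and \<open>d\<close>, and
  monomials in different sets of variables are orthogonal.\<close>

lemma carre_du_champ_spectral_bound:
  assumes hom: "homogeneous d a"
  shows "expectation (\<lambda>\<omega>. (carre_du_champ a \<omega>)\<^sup>2)
    \<le> real d * expectation (\<lambda>\<omega>. carre_du_champ a \<omega> * (multilinear_sum X I a \<omega>)\<^sup>2)"
proof -
  define \<S> where "\<S> = {S\<in>Pow I. card S = d}"
  have fin\<S>: "finite \<S>" using finite_I by (simp add: \<S>_def)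
  have \<S>: "S \<subseteq> I" "card S = d" "finite S" if "S \<in> \<S>" for S
    using that finite_I finite_subset by (auto simp: \<S>_def)
  define J where "J = (SIGMA p:\<S> \<times> \<S>. Pow (fst p \<inter> snd p))"
  define key where "key t = (fst (fst t) - snd (fst t)) \<union> (snd (fst t) - fst (fst t)) \<union> snd t" for t :: "('i set \<times> 'i set) \<times> 'i set"
  define g where "g t \<omega> = a (fst (fst t)) * a (snd (fst t)) * centered_monomial (snd t) (key t) \<omega>" for t \<omega>
  define l where "l A = (2 * real d - real (card A)) / 2" for A :: "'i set"
  have finJ: "finite J"
    unfolding J_def using fin\<S> \<S>(3) by (intro finite_SigmaI finite_cartesian_product) auto
  have keyI: "key t \<subseteq> I" if "t \<in> J" for t using that \<S>(1) unfolding J_def key_def by fastforce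
  have sumJ: "(\<Sum>t\<in>J. f t) = (\<Sum>S\<in>\<S>. \<Sum>T\<in>\<S>. \<Sum>R\<in>Pow (S \<inter> T). f ((S, T), R))" for f :: "_ \<Rightarrow> real"
  proof -
    have "(\<Sum>t\<in>J. f t) = (\<Sum>p\<in>\<S> \<times> \<S>. \<Sum>R\<in>Pow (fst p \<inter> snd p). f (p, R))"
      unfolding J_def using fin\<S> \<S>(3) by (subst sum.Sigma) (auto simp: case_prod_beta')
    also have "\<dots> = (\<Sum>S\<in>\<S>. \<Sum>T\<in>\<S>. \<Sum>R\<in>Pow (S \<inter> T). f ((S, T), R))"
      by (simp add: sum.cartesian_product case_prod_beta')
    finally show ?thesis .
  qed
  have F2: "(multilinear_sum X I a \<omega>)\<^sup>2 = (\<Sum>t\<in>J. g t \<omega>)" for \<omega>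
  proof -
    have "(multilinear_sum X I a \<omega>)\<^sup>2 = (\<Sum>S\<in>\<S>. \<Sum>T\<in>\<S>. a S * a T * ((\<Prod>i\<in>S. X i \<omega>) * (\<Prod>i\<in>T. X i \<omega>)))"
      unfolding multilinear_sum_homogeneous[OF hom] power2_eq_square sum_product \<S>_def
      by (intro sum.cong refl) simp
    also have "\<dots> = (\<Sum>t\<in>J. g t \<omega>)"
      unfolding sumJ
    proof (intro sum.cong refl)
      fix S T assume "S \<in> \<S>" "T \<in> \<S>"
      then show "a S * a T * ((\<Prod>i\<in>S. X i \<omega>) * (\<Prod>i\<in>T. X i \<omega>)) = (\<Sum>R\<in>Pow (S \<inter> T). g ((S, T), R) \<omega>)"
        by (simp add: monomial_product_expansion \<S>(1) g_def key_def sum_distrib_left)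
    qed
    finally show ?thesis .
  qed
  have \<Gamma>: "carre_du_champ a \<omega> = (\<Sum>t\<in>J. l (key t) * g t \<omega>)" for \<omega>
  proof -
    let ?c = "\<lambda>i S T. 1 / 2 * (1 + (X i \<omega>)\<^sup>2) * ((\<Prod>j\<in>S - {i}. X j \<omega>) * (\<Prod>j\<in>T - {i}. X j \<omega>))"
    let ?e = "\<lambda>i S T. if i \<in> S \<inter> T then a S * a T * ?c i S T else 0"
    have "carre_du_champ a \<omega> = (\<Sum>i\<in>I. \<Sum>S\<in>\<S>. \<Sum>T\<in>\<S>. ?e i S T)"
      unfolding carre_du_champ_def sum_distrib_left
    proof (intro sum.cong refl)
      fix i assume i: "i \<in> I"
      show "1 / 2 * ((1 + (X i \<omega>)\<^sup>2) * (partial a i \<omega>)\<^sup>2) = (\<Sum>S\<in>\<S>. \<Sum>T\<in>\<S>. ?e i S T)"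
        unfolding partial_eq[OF i hom] \<S>_def[symmetric] power2_eq_square[of "sum _ _"] sum_product
        unfolding sum_distrib_left by (intro sum.cong refl) auto
    qed
    also have "\<dots> = (\<Sum>S\<in>\<S>. \<Sum>T\<in>\<S>. \<Sum>i\<in>I. ?e i S T)"
    proof -
      have "(\<Sum>i\<in>I. \<Sum>S\<in>\<S>. \<Sum>T\<in>\<S>. ?e i S T)
        = (\<Sum>S\<in>\<S>. \<Sum>i\<in>I. \<Sum>T\<in>\<S>. ?e i S T)" by (rule sum.swap)
      also have "\<dots> = (\<Sum>S\<in>\<S>. \<Sum>T\<in>\<S>. \<Sum>i\<in>I. ?e i S T)"
        by (intro sum.cong refl sum.swap)
      finally show ?thesis .
    qed
    also have "\<dots> = (\<Sum>t\<in>J. l (key t) * g t \<omega>)"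
      unfolding sumJ
    proof (intro sum.cong refl)
      fix S T assume ST: "S \<in> \<S>" "T \<in> \<S>"
      have "{i\<in>I. i \<in> S \<inter> T} = S \<inter> T" using \<S>(1) ST by auto
      then have "(\<Sum>i\<in>I. ?e i S T) = (\<Sum>i\<in>S \<inter> T. a S * a T * ?c i S T)"
        using sum.inter_filter[OF finite_I, of "\<lambda>i. a S * a T * ?c i S T" "\<lambda>i. i \<in> S \<inter> T"] by simp
      also have "\<dots> = a S * a T * (\<Sum>R\<in>Pow (S \<inter> T). l (key ((S, T), R)) * centered_monomial R (key ((S, T), R)) \<omega>)"
        using weighted_monomial_product_expansion[OF \<S>(1,2)[OF ST(1)] \<S>(1,2)[OF ST(2)], of \<omega>]
        unfolding sum_distrib_left[symmetric] by (simp only: l_def key_def fst_conv snd_conv)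
      also have "\<dots> = (\<Sum>R\<in>Pow (S \<inter> T). l (key ((S, T), R)) * g ((S, T), R) \<omega>)"
        unfolding sum_distrib_left by (intro sum.cong refl) (simp add: g_def)
      finally show "(\<Sum>i\<in>I. ?e i S T)
        = (\<Sum>R\<in>Pow (S \<inter> T). l (key ((S, T), R)) * g ((S, T), R) \<omega>)" .
    qed
    finally show ?thesis .
  qed
  show ?thesis
    unfolding \<Gamma> F2
  proof (rule orthogonal_family_multiplier_le[where key = key and l = l, OF finJ])
    show "sq_integrable M (g t)" if "t \<in> J" for t
      unfolding g_def[abs_def] by (intro sq_integrable_scale sq_integrable_centered_monomial keyI that)
    show "expectation (\<lambda>\<omega>. g s \<omega> * g t \<omega>) = 0" if "s \<in> J" "t \<in> J" "key s \<noteq> key t" for s t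
    proof -
      have "expectation (\<lambda>\<omega>. g s \<omega> * g t \<omega>) = expectation (\<lambda>\<omega>. (a (fst (fst s)) * a (snd (fst s)) * (a (fst (fst t)) * a (snd (fst t))))
          * (centered_monomial (snd s) (key s) \<omega> * centered_monomial (snd t) (key t) \<omega>))"
        unfolding g_def by (simp only: mult_ac)
      then show ?thesis
        using centered_monomials_orthogonal[OF keyI[OF that(1)] keyI[OF that(2)] that(3)] by simp
    qed
    show "0 \<le> l (key t) \<and> l (key t) \<le> real d" if "t \<in> J" for t
    proof -
      obtain S T R where t: "t = ((S, T), R)" by (metis prod.collapse)
      then have ST: "S \<in> \<S>" "T \<in> \<S>" "R \<subseteq> S \<inter> T" using that by (auto simp: J_def)
      then have "card (key t) \<le> card (S \<union> T)" using \<S>(3) by (intro card_mono) (auto simp: key_def t)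
      also have "\<dots> \<le> d + d" using card_Un_le[of S T] \<S>(2) ST by simp
      finally show ?thesis by (simp add: l_def)
    qed
  qed
qed

end

section \<open>Normal approximation of homogeneous polynomials\<close>

context normalized_family
begin

abbreviation chaos :: "('i set \<Rightarrow> real) \<Rightarrow> 'a \<Rightarrow> real" where
  "chaos a \<equiv> multilinear_sum X I a"

lemma split_function:
  "i \<in> I \<Longrightarrow> chaos a = (\<lambda>\<omega>. multilinear_sum X (I - {i}) a \<omega> + X i \<omega> * partial a i \<omega>)"
  by (rule ext) (rule multilinear_sum_split)

lemma L4_chaos: "L4_integrable M (chaos a)"
  by (rule L4_multilinear_sum) simp

lemma L4_X_partial: "i \<in> I \<Longrightarrow> L4_integrable M (\<lambda>\<omega>. X i \<omega> * partial a i \<omega>)"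
  using L4_split(1)[OF _ subset_refl partial_properties(3,4,1,2)] .

lemma sum_partial_second_moments:
  assumes hom: "homogeneous d a"
  shows "(\<Sum>i\<in>I. expectation (\<lambda>\<omega>. (partial a i \<omega>)\<^sup>2)) = real d * expectation (\<lambda>\<omega>. (chaos a \<omega>)\<^sup>2)"
proof -
  let ?t = "\<lambda>i. expectation (\<lambda>\<omega>. (partial a i \<omega>)\<^sup>2)"
  have "real d * expectation (\<lambda>\<omega>. (chaos a \<omega>)\<^sup>2) = expectation (\<lambda>\<omega>. \<Sum>i\<in>I. chaos a \<omega> * (X i \<omega> * partial a i \<omega>))"
    unfolding sum_distrib_left[symmetric] euler_identity[OF hom] integral_mult_right_zero[symmetric]
    by (simp only: power2_eq_square mult_ac)
  also have "\<dots> = (\<Sum>i\<in>I. expectation (\<lambda>\<omega>. chaos a \<omega> * (X i \<omega> * partial a i \<omega>)))"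
    by (intro expectation_sum integrable_mult_of_sq_integrable L4_integrable_imp_sq_integrable L4_chaos L4_X_partial)
  also have "\<dots> = (\<Sum>i\<in>I. ?t i)"
  proof (intro sum.cong refl)
    fix i assume i: "i \<in> I"
    show "expectation (\<lambda>\<omega>. chaos a \<omega> * (X i \<omega> * partial a i \<omega>)) = ?t i"
      unfolding split_function[OF i] split_moments(2)[OF i subset_refl partial_properties(3,4,1,2)] by simp
  qed
  finally show ?thesis by simp
qed

lemma carre_du_champ_term:
  "(1 + (X i \<omega>)\<^sup>2) * (partial a i \<omega>)\<^sup>2 = (partial a i \<omega>)\<^sup>2 + (X i \<omega> * partial a i \<omega>)\<^sup>2"
  by (simp add: power_mult_distrib algebra_simps)

lemma sq_integrable_carre_du_champ_term:
  assumes "i \<in> I"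
  shows "sq_integrable M (\<lambda>\<omega>. (1 + (X i \<omega>)\<^sup>2) * (partial a i \<omega>)\<^sup>2)"
  unfolding carre_du_champ_term
  by (intro sq_integrable_add sq_integrable_power2_of_L4 L4_X_partial partial_properties(2) assms)

lemma sq_integrable_carre_du_champ: "sq_integrable M (carre_du_champ a)"
  unfolding carre_du_champ_def[abs_def]
  by (intro sq_integrable_scale sq_integrable_sum sq_integrable_carre_du_champ_term)

lemma expectation_carre_du_champ:
  assumes hom: "homogeneous d a"
  shows "expectation (carre_du_champ a) = real d * expectation (\<lambda>\<omega>. (chaos a \<omega>)\<^sup>2)"
proof -
  let ?t = "\<lambda>i. expectation (\<lambda>\<omega>. (partial a i \<omega>)\<^sup>2)"
  have "expectation (carre_du_champ a) = 1 / 2 * (\<Sum>i\<in>I. expectation (\<lambda>\<omega>. (1 + (X i \<omega>)\<^sup>2) * (partial a i \<omega>)\<^sup>2))"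
    unfolding carre_du_champ_def[abs_def] integral_mult_right_zero
    by (subst expectation_sum)
       (intro sq_integrable_imp_integrable sq_integrable_carre_du_champ_term, simp_all)
  also have "(\<Sum>i\<in>I. expectation (\<lambda>\<omega>. (1 + (X i \<omega>)\<^sup>2) * (partial a i \<omega>)\<^sup>2)) = (\<Sum>i\<in>I. 2 * ?t i)"
  proof (intro sum.cong refl)
    fix i assume i: "i \<in> I"
    note D = partial_properties(1)[of i a] partial_properties(2)[of a i]
    have m: "expectation (\<lambda>\<omega>. (X i \<omega> * partial a i \<omega>)\<^sup>2) = ?t i"
      using split_moment(2)[OF i subset_refl D D, of 2 2 0] var_X[OF i] by (simp add: power_mult_distrib)
    have "expectation (\<lambda>\<omega>. (partial a i \<omega>)\<^sup>2 + (X i \<omega> * partial a i \<omega>)\<^sup>2)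
      = ?t i + expectation (\<lambda>\<omega>. (X i \<omega> * partial a i \<omega>)\<^sup>2)"
      by (intro Bochner_Integration.integral_add sq_integrable_imp_integrable sq_integrable_power2_of_L4 L4_X_partial[OF i] D(2))
    then show "expectation (\<lambda>\<omega>. (1 + (X i \<omega>)\<^sup>2) * (partial a i \<omega>)\<^sup>2) = 2 * ?t i"
      unfolding carre_du_champ_term m by simp
  qed
  finally show ?thesis using sum_partial_second_moments[OF hom] by (simp flip: sum_distrib_left)
qed

text \<open>For a diffusion this identity holds without the sum of the fourth moments of the partial derivatives;
  that sum is the price of discreteness, and for normalised polynomials it is small when all
  influences are small.\<close>

lemma carre_du_champ_fourth_moment:
  assumes hom: "homogeneous d a"
  shows "3 * expectation (\<lambda>\<omega>. carre_du_champ a \<omega> * (chaos a \<omega>)\<^sup>2)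
    = real d * expectation (\<lambda>\<omega>. (chaos a \<omega>) ^ 4)
      + (\<Sum>i\<in>I. (3 + expectation (\<lambda>\<omega>. (X i \<omega>) ^ 4)) / 2 * expectation (\<lambda>\<omega>. (partial a i \<omega>) ^ 4))"
proof -
  let ?e = "expectation (\<lambda>\<omega>. carre_du_champ a \<omega> * (chaos a \<omega>)\<^sup>2)"
  let ?q = "\<lambda>i. expectation (\<lambda>\<omega>. (chaos a \<omega>)\<^sup>2 * ((1 + (X i \<omega>)\<^sup>2) * (partial a i \<omega>)\<^sup>2))"
  let ?p = "\<lambda>i. expectation (\<lambda>\<omega>. (chaos a \<omega>) ^ 3 * (X i \<omega> * partial a i \<omega>))"
  let ?r = "\<lambda>i. (3 + expectation (\<lambda>\<omega>. (X i \<omega>) ^ 4)) / 2 * expectation (\<lambda>\<omega>. (partial a i \<omega>) ^ 4)"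
  have sqF: "sq_integrable M (\<lambda>\<omega>. (chaos a \<omega>)\<^sup>2)" by (rule sq_integrable_power2_of_L4[OF L4_chaos])
  have eq\<Gamma>: "?e
    = 1 / 2 * (\<Sum>i\<in>I. ?q i)"
  proof -
    have "?e
      = expectation (\<lambda>\<omega>. 1 / 2 * (\<Sum>i\<in>I. (chaos a \<omega>)\<^sup>2 * ((1 + (X i \<omega>)\<^sup>2) * (partial a i \<omega>)\<^sup>2)))"
      unfolding carre_du_champ_def sum_distrib_left[symmetric] by (simp only: mult_ac)
    also have "\<dots> = 1 / 2 * (\<Sum>i\<in>I. ?q i)"
      unfolding integral_mult_right_zero
      by (subst expectation_sum)
         (intro integrable_mult_of_sq_integrable sqF sq_integrable_carre_du_champ_term, simp_all)
    finally show ?thesis .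
  qed
  have sqFXD: "sq_integrable M (\<lambda>\<omega>. chaos a \<omega> * (X i \<omega> * partial a i \<omega>))" if "i \<in> I" for i
    by (rule sq_integrable_mult_of_L4[OF L4_chaos L4_X_partial[OF that]])
  have eqF: "real d * expectation (\<lambda>\<omega>. (chaos a \<omega>) ^ 4)
    = (\<Sum>i\<in>I. ?p i)"
  proof -
    have "real d * (chaos a \<omega>) ^ 4 = (\<Sum>i\<in>I. (chaos a \<omega>)\<^sup>2 * (chaos a \<omega> * (X i \<omega> * partial a i \<omega>)))" for \<omega>
      unfolding sum_distrib_left[symmetric] euler_identity[OF hom] by (simp add: power2_eq_square power4_eq_xxxx)
    then have "real d * expectation (\<lambda>\<omega>. (chaos a \<omega>) ^ 4)
      = expectation (\<lambda>\<omega>. \<Sum>i\<in>I. (chaos a \<omega>)\<^sup>2 * (chaos a \<omega> * (X i \<omega> * partial a i \<omega>)))"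
      unfolding integral_mult_right_zero[symmetric] by (simp only:)
    also have "\<dots> = (\<Sum>i\<in>I. expectation (\<lambda>\<omega>. (chaos a \<omega>)\<^sup>2 * (chaos a \<omega> * (X i \<omega> * partial a i \<omega>))))"
      by (intro expectation_sum integrable_mult_of_sq_integrable sqF sqFXD)
    finally show ?thesis by (simp only: power3_eq_cube power2_eq_square mult.assoc)
  qed
  have summand: "3 / 2 * ?q i
    = ?p i
      + ?r i" if i: "i \<in> I" for i
    unfolding split_function[OF i] split_moments(4,5)[OF i subset_refl partial_properties(3,4,1,2)]
    by (simp add: field_simps)
  have "3 * ?e
    = (\<Sum>i\<in>I. 3 / 2 * ?q i)"
    unfolding eq\<Gamma> sum_distrib_left[symmetric] by simp
  also have "\<dots> = (\<Sum>i\<in>I. ?p i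
      + ?r i)"
    by (intro sum.cong refl summand)
  finally show ?thesis unfolding sum.distrib eqF .
qed

text \<open>The carre du champ divided by \<open>d\<close> has mean one, so its variance is the second moment minus one.
  The spectral bound replaces the second moment by \<open>E (\<Gamma> F\<^sup>2)\<close>, and the fourth moment identity evaluates
  that as a third of \<open>E (F ^ 4)\<close> plus the correction.\<close>

theorem carre_du_champ_variance_bound:
  assumes hom: "homogeneous d a" and d: "1 \<le> d" and unit: "expectation (\<lambda>\<omega>. (chaos a \<omega>)\<^sup>2) = 1"
  shows "expectation (\<lambda>\<omega>. (1 - carre_du_champ a \<omega> / real d)\<^sup>2)
    \<le> (expectation (\<lambda>\<omega>. (chaos a \<omega>) ^ 4) - 3) / 3
      + (3 + \<beta>) / (6 * real d) * (\<Sum>i\<in>I. expectation (\<lambda>\<omega>. (partial a i \<omega>) ^ 4))"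
proof -
  let ?v = "expectation (\<lambda>\<omega>. (1 - carre_du_champ a \<omega> / real d)\<^sup>2)"
  define p where "p = expectation (\<lambda>\<omega>. (carre_du_champ a \<omega>)\<^sup>2)"
  define q where "q = expectation (\<lambda>\<omega>. carre_du_champ a \<omega> * (chaos a \<omega>)\<^sup>2)"
  define r where "r = expectation (\<lambda>\<omega>. (chaos a \<omega>) ^ 4)"
  define s where "s = (\<Sum>i\<in>I. expectation (\<lambda>\<omega>. (partial a i \<omega>) ^ 4))"
  have d0: "0 < real d" using d by simp
  have i\<Gamma>: "integrable M (carre_du_champ a)" by (rule sq_integrable_imp_integrable[OF sq_integrable_carre_du_champ])
  have i\<Gamma>2: "integrable M (\<lambda>\<omega>. (carre_du_champ a \<omega>)\<^sup>2)" using sq_integrable_carre_du_champ[of a] by (simp add: sq_integrable_def)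
  have "?v
    = expectation (\<lambda>\<omega>. 1 - 2 / real d * carre_du_champ a \<omega> + 1 / (real d)\<^sup>2 * (carre_du_champ a \<omega>)\<^sup>2)"
    by (intro Bochner_Integration.integral_cong refl) (simp add: power2_diff power_divide)
  also have "\<dots> = 1 - 2 / real d * expectation (carre_du_champ a) + 1 / (real d)\<^sup>2 * p"
    using i\<Gamma> i\<Gamma>2 prob_space by (simp add: p_def)
  also have "\<dots> = p / (real d)\<^sup>2 - 1" using d0 by (simp add: expectation_carre_du_champ[OF hom] unit)
  also have "\<dots> \<le> real d * q / (real d)\<^sup>2 - 1"
    using carre_du_champ_spectral_bound[OF hom] by (intro diff_right_mono divide_right_mono) (simp_all add: p_def q_def)
  also have "\<dots> = 3 * q / (3 * real d) - 1" using d0 by (simp add: power2_eq_square)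
  also have "3 * q \<le> real d * r + (3 + \<beta>) / 2 * s"
    unfolding q_def r_def s_def carre_du_champ_fourth_moment[OF hom] sum_distrib_left
    using fourth_X by (intro add_left_mono sum_mono mult_right_mono divide_right_mono add_left_mono) auto
  finally have "?v \<le> (real d * r + (3 + \<beta>) / 2 * s) / (3 * real d) - 1"
    using d0 by (simp add: divide_right_mono)
  also have "\<dots> = (r - 3) / 3 + (3 + \<beta>) / (6 * real d) * s" using d0 by (simp add: field_simps)
  finally show ?thesis by (simp only: r_def s_def)
qed

text \<open>For \<open>\<kappa> = 1/2\<close> this is the normalised carre du champ.  In degree one its fluctuations would bring
  in \<open>\<phi>''(0)\<close>, whereas \<open>\<kappa> = 0\<close> gives the constant \<open>1\<close> when the second moment is one.\<close>

definition weighted_gradient :: "real \<Rightarrow> nat \<Rightarrow> ('i set \<Rightarrow> real) \<Rightarrow> 'a \<Rightarrow> real" where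
  "weighted_gradient \<kappa> d a \<omega> = 1 / real d * (\<Sum>i\<in>I. (1 - \<kappa> + \<kappa> * (X i \<omega>)\<^sup>2) * (partial a i \<omega>)\<^sup>2)"

lemma sq_integrable_weighted_gradient: "sq_integrable M (weighted_gradient \<kappa> d a)"
proof -
  have eq: "(1 - \<kappa> + \<kappa> * (X i \<omega>)\<^sup>2) * (partial a i \<omega>)\<^sup>2 = (1 - \<kappa>) * (partial a i \<omega>)\<^sup>2 + \<kappa> * (X i \<omega> * partial a i \<omega>)\<^sup>2" for i \<omega>
    by (simp add: power_mult_distrib algebra_simps)
  show ?thesis unfolding weighted_gradient_def[abs_def] eq
    by (intro sq_integrable_scale sq_integrable_sum sq_integrable_add sq_integrable_power2_of_L4 L4_X_partial partial_properties(2))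
qed

text \<open>Euler's identity writes \<open>d F\<close> as the sum of the \<open>X i D i\<close>, to which the one variable bound applies.\<close>

lemma stein_bound:
  fixes h h' :: "real \<Rightarrow> real"
  assumes hom: "homogeneous d a" and d: "1 \<le> d"
    and h: "\<And>x. (h has_real_derivative h' x) (at x)" and lip: "\<And>x y. \<bar>h' x - h' y\<bar> \<le> L * \<bar>x - y\<bar>"
    and \<kappa>: "0 \<le> \<kappa>" "\<kappa> \<le> 1"
  shows "\<bar>expectation (\<lambda>\<omega>. chaos a \<omega> * h (chaos a \<omega>)) - expectation (\<lambda>\<omega>. h' (chaos a \<omega>) * weighted_gradient \<kappa> d a \<omega>)\<bar>
    \<le> L * (2 * \<beta> / real d * (\<Sum>i\<in>I. expectation (\<lambda>\<omega>. \<bar>partial a i \<omega>\<bar> ^ 3)))"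
proof -
  let ?l = "expectation (\<lambda>\<omega>. chaos a \<omega> * h (chaos a \<omega>))"
  let ?r = "expectation (\<lambda>\<omega>. h' (chaos a \<omega>) * weighted_gradient \<kappa> d a \<omega>)"
  let ?u = "\<lambda>i \<omega>. X i \<omega> * partial a i \<omega> * h (chaos a \<omega>)"
  let ?w = "\<lambda>i \<omega>. (1 - \<kappa> + \<kappa> * (X i \<omega>)\<^sup>2) * (partial a i \<omega>)\<^sup>2"
  have d0: "0 < real d" using d by simp
  have st: "integrable M (\<lambda>\<omega>. ?u i \<omega>)"
      "integrable M (\<lambda>\<omega>. h' (chaos a \<omega>) * ?w i \<omega>)"
      "\<bar>expectation (\<lambda>\<omega>. ?u i \<omega>) - expectation (\<lambda>\<omega>. h' (chaos a \<omega>) * ?w i \<omega>)\<bar>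
        \<le> L * (2 * \<beta> * expectation (\<lambda>\<omega>. \<bar>partial a i \<omega>\<bar> ^ 3))" if i: "i \<in> I" for i
    unfolding split_function[OF i]
    by (rule stein_term_bound[OF i subset_refl partial_properties(3,4,1,2) h lip \<kappa>])+
  have 1: "real d * ?l = (\<Sum>i\<in>I. expectation (\<lambda>\<omega>. ?u i \<omega>))"
  proof -
    have "real d * (chaos a \<omega> * h (chaos a \<omega>)) = (\<Sum>i\<in>I. ?u i \<omega>)" for \<omega>
      unfolding sum_distrib_right[symmetric] euler_identity[OF hom] by simp
    then have "real d * ?l = expectation (\<lambda>\<omega>. \<Sum>i\<in>I. ?u i \<omega>)"
      unfolding integral_mult_right_zero[symmetric] by (simp only:)
    also have "\<dots> = (\<Sum>i\<in>I. expectation (\<lambda>\<omega>. ?u i \<omega>))"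
      by (intro expectation_sum st(1))
    finally show ?thesis .
  qed
  have 2: "real d * ?r = (\<Sum>i\<in>I. expectation (\<lambda>\<omega>. h' (chaos a \<omega>) * ?w i \<omega>))"
  proof -
    have "real d * (h' (chaos a \<omega>) * weighted_gradient \<kappa> d a \<omega>) = (\<Sum>i\<in>I. h' (chaos a \<omega>) * ?w i \<omega>)" for \<omega>
      unfolding sum_distrib_left[symmetric] weighted_gradient_def using d0 by simp
    then have "real d * ?r = expectation (\<lambda>\<omega>. \<Sum>i\<in>I. h' (chaos a \<omega>) * ?w i \<omega>)"
      unfolding integral_mult_right_zero[symmetric] by (simp only:)
    also have "\<dots> = (\<Sum>i\<in>I. expectation (\<lambda>\<omega>. h' (chaos a \<omega>) * ?w i \<omega>))"
      by (intro expectation_sum st(2))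
    finally show ?thesis .
  qed
  have "real d * \<bar>?l - ?r\<bar>
    = \<bar>real d * ?l - real d * ?r\<bar>"
    using d0 by (simp add: abs_mult flip: right_diff_distrib)
  also have "\<dots> = \<bar>\<Sum>i\<in>I. expectation (\<lambda>\<omega>. ?u i \<omega>) - expectation (\<lambda>\<omega>. h' (chaos a \<omega>) * ?w i \<omega>)\<bar>"
    unfolding 1 2 sum_subtractf ..
  also have "\<dots> \<le> (\<Sum>i\<in>I. L * (2 * \<beta> * expectation (\<lambda>\<omega>. \<bar>partial a i \<omega>\<bar> ^ 3)))"
    by (rule order.trans[OF sum_abs]) (intro sum_mono st(3))
  also have "\<dots> = real d * (L * (2 * \<beta> / real d * (\<Sum>i\<in>I. expectation (\<lambda>\<omega>. \<bar>partial a i \<omega>\<bar> ^ 3))))"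
    using d0 by (simp flip: sum_distrib_left)
  finally show ?thesis using d0 by (simp only: mult_le_cancel_left_pos)
qed

lemma partial_moment_bounds:
  assumes hom: "homogeneous d a" and d: "1 \<le> d" and i: "i \<in> I"
    and \<tau>: "expectation (\<lambda>\<omega>. (partial a i \<omega>)\<^sup>2) \<le> \<tau>"
  defines "K \<equiv> (16 * \<beta>) ^ (d - 1)"
  shows "expectation (\<lambda>\<omega>. (partial a i \<omega>) ^ 4) \<le> K * \<tau> * expectation (\<lambda>\<omega>. (partial a i \<omega>)\<^sup>2)"
    and "expectation (\<lambda>\<omega>. \<bar>partial a i \<omega>\<bar> ^ 3) \<le> sqrt (K * \<tau>) * expectation (\<lambda>\<omega>. (partial a i \<omega>)\<^sup>2)"
proof -
  define t where "t = expectation (\<lambda>\<omega>. (partial a i \<omega>)\<^sup>2)"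
  have t0: "0 \<le> t" by (simp add: t_def)
  have K0: "0 \<le> K" using beta_ge_1 by (simp add: K_def)
  have "expectation (\<lambda>\<omega>. (partial a i \<omega>) ^ 4) \<le> K * t\<^sup>2"
    unfolding partial_def K_def t_def
  proof (rule hypercontractivity)
    fix S assume S: "S \<subseteq> I - {i}" "a (insert i S) \<noteq> 0"
    then have "card (insert i S) = d" using i by (intro homogeneousD[OF hom]) auto
    moreover have "finite S" "i \<notin> S" using S finite_I finite_subset by auto
    ultimately show "card S \<le> d - 1" by simp
  qed auto
  also have "\<dots> \<le> K * (\<tau> * t)"
    using \<tau>[folded t_def] t0 K0 by (simp add: power2_eq_square mult_left_mono mult_right_mono)
  finally show four: "expectation (\<lambda>\<omega>. (partial a i \<omega>) ^ 4) \<le> K * \<tau> * expectation (\<lambda>\<omega>. (partial a i \<omega>)\<^sup>2)"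
    by (simp add: t_def mult.assoc)
  have s1: "sq_integrable M (partial a i)" by (rule L4_integrable_imp_sq_integrable[OF partial_properties(2)])
  have s2: "sq_integrable M (\<lambda>\<omega>. (partial a i \<omega>)\<^sup>2)" by (rule sq_integrable_power2_of_L4[OF partial_properties(2)])
  have "expectation (\<lambda>\<omega>. \<bar>partial a i \<omega>\<bar> ^ 3) = expectation (\<lambda>\<omega>. \<bar>partial a i \<omega> * (partial a i \<omega>)\<^sup>2\<bar>)"
    by (simp add: abs_mult power3_eq_cube power2_eq_square mult_ac)
  also have "\<dots> \<le> sqrt t * sqrt (expectation (\<lambda>\<omega>. (partial a i \<omega>) ^ 4))"
    using integral_Cauchy_Schwarz[OF s1 s2] by (simp add: t_def)
  also have "\<dots> \<le> sqrt t * sqrt (K * \<tau> * t)"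
    using four t0 by (intro mult_left_mono real_sqrt_le_mono) (auto simp: t_def)
  also have "\<dots> = sqrt (K * \<tau>) * t" using t0 by (simp add: real_sqrt_mult)
  finally show "expectation (\<lambda>\<omega>. \<bar>partial a i \<omega>\<bar> ^ 3) \<le> sqrt (K * \<tau>) * expectation (\<lambda>\<omega>. (partial a i \<omega>)\<^sup>2)"
    by (simp add: t_def)
qed

text \<open>Both errors are small when \<open>\<tau>\<close> is: the second moments of the partial derivatives add up to \<open>d\<close>,
  so a sum of higher moments, each at most a power of \<open>\<tau>\<close> times the second moment, costs only that
  power of \<open>\<tau>\<close>.\<close>

theorem normal_approximation:
  fixes \<phi> \<phi>1 \<phi>2 :: "real \<Rightarrow> real"
  assumes hom: "homogeneous d a" and d: "1 \<le> d" and unit: "expectation (\<lambda>\<omega>. (chaos a \<omega>)\<^sup>2) = 1"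
    and \<tau>: "\<And>i. i \<in> I \<Longrightarrow> expectation (\<lambda>\<omega>. (partial a i \<omega>)\<^sup>2) \<le> \<tau>"
    and d0: "\<And>x. (\<phi> has_real_derivative \<phi>1 x) (at x)"
    and d1: "\<And>x. (\<phi>1 has_real_derivative \<phi>2 x) (at x)"
    and lip: "\<And>x y. \<bar>\<phi>2 x - \<phi>2 y\<bar> \<le> S * \<bar>x - y\<bar>"
  defines "K \<equiv> (16 * \<beta>) ^ (d - 1)"
  defines "V \<equiv> if d = 1 then 0 else \<bar>expectation (\<lambda>\<omega>. (chaos a \<omega>) ^ 4) - 3\<bar> / 3 + (3 + \<beta>) / 6 * (K * \<tau>)"
  shows "\<bar>expectation (\<lambda>\<omega>. \<phi> (chaos a \<omega>)) - (\<integral>z. \<phi> z \<partial>std_normal_distribution)\<bar>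
    \<le> pi / 2 * (S * (2 * \<beta> * sqrt (K * \<tau>)) + (\<bar>\<phi>2 0\<bar> + S) * sqrt V)"
proof -
  define \<kappa> :: real where "\<kappa> = (if d = 1 then 0 else 1 / 2)"
  have \<kappa>: "0 \<le> \<kappa>" "\<kappa> \<le> 1" by (simp_all add: \<kappa>_def)
  have dpos: "0 < real d" using d by simp
  have S0: "0 \<le> S" using order.trans[OF abs_ge_zero lip[of 1 0]] by simp
  have tot: "(\<Sum>i\<in>I. expectation (\<lambda>\<omega>. (partial a i \<omega>)\<^sup>2)) = real d"
    using sum_partial_second_moments[OF hom] unit by simp
  have third: "(\<Sum>i\<in>I. expectation (\<lambda>\<omega>. \<bar>partial a i \<omega>\<bar> ^ 3)) \<le> sqrt (K * \<tau>) * real d"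
    unfolding tot[symmetric] sum_distrib_left K_def
    by (intro sum_mono partial_moment_bounds(2)[OF hom d _ \<tau>])
  have fourth: "(\<Sum>i\<in>I. expectation (\<lambda>\<omega>. (partial a i \<omega>) ^ 4)) \<le> K * \<tau> * real d"
    unfolding tot[symmetric] sum_distrib_left K_def
    by (intro sum_mono partial_moment_bounds(1)[OF hom d _ \<tau>])
  have stein: "\<bar>expectation (\<lambda>\<omega>. chaos a \<omega> * h (chaos a \<omega>)) - expectation (\<lambda>\<omega>. h' (chaos a \<omega>) * weighted_gradient \<kappa> d a \<omega>)\<bar>
      \<le> L * (2 * \<beta> * sqrt (K * \<tau>))"
    if h: "\<And>x. (h has_real_derivative h' x) (at x)" and hl: "\<And>x y. \<bar>h' x - h' y\<bar> \<le> L * \<bar>x - y\<bar>" for h h' L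
  proof -
    have L: "0 \<le> L" using order.trans[OF abs_ge_zero hl[of 1 0]] by simp
    note stein_bound[OF hom d h hl \<kappa>]
    also have "L * (2 * \<beta> / real d * (\<Sum>i\<in>I. expectation (\<lambda>\<omega>. \<bar>partial a i \<omega>\<bar> ^ 3)))
      \<le> L * (2 * \<beta> / real d * (sqrt (K * \<tau>) * real d))"
      using L third beta_ge_1 dpos by (intro mult_left_mono) auto
    also have "\<dots> = L * (2 * \<beta> * sqrt (K * \<tau>))" using dpos by simp
    finally show ?thesis .
  qed
  have V: "expectation (\<lambda>\<omega>. (1 - weighted_gradient \<kappa> d a \<omega>)\<^sup>2) \<le> V"
  proof (cases "d = 1")
    case True
    have const: "\<exists>c. \<forall>\<omega>. partial a i \<omega> = c" if i: "i \<in> I" for i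
    proof -
      have "a (insert i S) = 0" if "S \<subseteq> I - {i}" "S \<noteq> {}" for S
      proof (rule ccontr)
        assume "a (insert i S) \<noteq> 0"
        then have "card (insert i S) = 1" using homogeneousD[OF hom, of "insert i S"] i that True by auto
        moreover have "finite S" "i \<notin> S" using that finite_I finite_subset by auto
        ultimately show False using that(2) by simp
      qed
      then have "multilinear_sum X (I - {i}) (\<lambda>S. a (insert i S)) \<omega> = (\<Sum>S\<in>{{}}. a (insert i S) * (\<Prod>i\<in>S. X i \<omega>))" for \<omega>
        unfolding multilinear_sum_def using finite_I by (intro sum.mono_neutral_right) auto
      then show ?thesis by (simp add: partial_def)
    qed
    have "weighted_gradient \<kappa> d a \<omega> = 1" for \<omega>
    proof -
      have "(\<Sum>i\<in>I. (partial a i \<omega>)\<^sup>2) = (\<Sum>i\<in>I. expectation (\<lambda>\<omega>. (partial a i \<omega>)\<^sup>2))"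
      proof (intro sum.cong refl)
        fix i assume "i \<in> I"
        then obtain c where "\<And>\<omega>. partial a i \<omega> = c" using const by blast
        then show "(partial a i \<omega>)\<^sup>2 = expectation (\<lambda>\<omega>. (partial a i \<omega>)\<^sup>2)" by (simp add: prob_space)
      qed
      then show ?thesis unfolding weighted_gradient_def tot using True by (simp add: \<kappa>_def)
    qed
    then show ?thesis using True by (simp add: V_def)
  next
    case False
    have "weighted_gradient \<kappa> d a \<omega> = carre_du_champ a \<omega> / real d" for \<omega>
      unfolding weighted_gradient_def carre_du_champ_def sum_distrib_left sum_divide_distrib
      using False by (intro sum.cong refl) (simp add: \<kappa>_def field_simps)
    then have "expectation (\<lambda>\<omega>. (1 - weighted_gradient \<kappa> d a \<omega>)\<^sup>2)
      \<le> (expectation (\<lambda>\<omega>. (chaos a \<omega>) ^ 4) - 3) / 3 + (3 + \<beta>) / (6 * real d) * (\<Sum>i\<in>I. expectation (\<lambda>\<omega>. (partial a i \<omega>) ^ 4))"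
      using carre_du_champ_variance_bound[OF hom d unit] by simp
    also have "\<dots> \<le> \<bar>expectation (\<lambda>\<omega>. (chaos a \<omega>) ^ 4) - 3\<bar> / 3 + (3 + \<beta>) / (6 * real d) * (K * \<tau> * real d)"
      using fourth beta_ge_1 by (intro add_mono mult_left_mono divide_right_mono) auto
    also have "\<dots> = V" using False dpos by (simp add: V_def)
    finally show ?thesis .
  qed
  have "\<bar>expectation (\<lambda>\<omega>. \<phi> (chaos a \<omega>)) - (\<integral>z. \<phi> z \<partial>std_normal_distribution)\<bar>
    \<le> pi / 2 * (S * (2 * \<beta> * sqrt (K * \<tau>)) + (\<bar>\<phi>2 0\<bar> + S) * sqrt (expectation (\<lambda>\<omega>. (1 - weighted_gradient \<kappa> d a \<omega>)\<^sup>2)))"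
    by (rule smart_path_bound[OF L4_chaos unit sq_integrable_weighted_gradient d0 d1 lip stein])
  also have "\<dots> \<le> pi / 2 * (S * (2 * \<beta> * sqrt (K * \<tau>)) + (\<bar>\<phi>2 0\<bar> + S) * sqrt V)"
    using V S0 by (intro mult_left_mono add_left_mono real_sqrt_le_mono) auto
  finally show ?thesis .
qed

end

section \<open>From kernels to multilinear polynomials\<close>

lemma (in normalized_family) second_moment_multilinear_sum:
  assumes "J \<subseteq> I"
  shows "expectation (\<lambda>\<omega>. (multilinear_sum X J b \<omega>)\<^sup>2) = (\<Sum>S\<in>Pow J. (b S)\<^sup>2)"
proof -
  have "finite J" using assms finite_I by (rule finite_subset)
  then show ?thesis using assms
  proof (induction J arbitrary: b rule: finite_induct)
    case empty
    show ?case by (simp add: multilinear_sum_def prob_space)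
  next
    case (insert i J)
    have J: "J \<subseteq> I" and i: "i \<in> I" and T: "J \<subseteq> I - {i}" using insert by auto
    let ?D = "multilinear_sum X J (\<lambda>S. b (insert i S))"
    have "expectation (\<lambda>\<omega>. (multilinear_sum X J b \<omega> + X i \<omega> * ?D \<omega>)\<^sup>2)
      = expectation (\<lambda>\<omega>. (multilinear_sum X J b \<omega>)\<^sup>2) + expectation (\<lambda>\<omega>. (?D \<omega>)\<^sup>2)"
      using split_moments(1)[OF i T depends_on_multilinear_sum[OF subset_refl] L4_multilinear_sum[OF J]
        depends_on_multilinear_sum[OF subset_refl] L4_multilinear_sum[OF J]] by simp
    then show ?case
      unfolding multilinear_sum_insert[OF insert(1,2)] sum_Pow_insert[OF insert(1,2)] insert.IH[OF J] .
  qed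
qed

lemma finite_index_tuples: "finite (index_tuples N d)"
  unfolding index_tuples_def by (rule finite_lists_length_eq) simp

lemma sum_index_tuples_by_support:
  fixes g :: "nat list \<Rightarrow> real"
  assumes "\<And>js. js \<in> index_tuples N k \<Longrightarrow> \<not> distinct js \<Longrightarrow> g js = 0"
  shows "(\<Sum>js\<in>index_tuples N k. g js) = (\<Sum>S\<in>{S\<in>Pow {1..N}. card S = k}. \<Sum>js\<in>permutations_of_set S. g js)"
proof -
  let ?D = "{js\<in>index_tuples N k. distinct js}" and ?\<S> = "{S\<in>Pow {1..N}. card S = k}"
  have "(\<Sum>js\<in>index_tuples N k. g js) = (\<Sum>js\<in>?D. g js)"
    using assms by (intro sum.mono_neutral_right finite_index_tuples) auto
  also have "\<dots> = (\<Sum>S\<in>?\<S>. \<Sum>js\<in>{js\<in>?D. set js = S}. g js)"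
  proof (rule sum.group[symmetric])
    show "set ` ?D \<subseteq> ?\<S>" by (auto simp: index_tuples_def distinct_card)
  qed (use finite_index_tuples in auto)
  also have "\<dots> = (\<Sum>S\<in>?\<S>. \<Sum>js\<in>permutations_of_set S. g js)"
  proof (intro sum.cong refl)
    fix S assume "S \<in> ?\<S>"
    then show "{js\<in>?D. set js = S} = permutations_of_set S"
      by (auto simp: permutations_of_set_def index_tuples_def distinct_card[symmetric])
  qed
  finally show ?thesis .
qed

lemma prod_nth_distinct:
  fixes y :: "nat \<Rightarrow> real"
  assumes "distinct js" "length js = d"
  shows "(\<Prod>k<d. y (js ! k)) = (\<Prod>i\<in>set js. y i)"
proof -
  have "bij_betw ((!) js) {..<d} (set js)" using assms by (auto intro: bij_betw_nth)
  then show ?thesis by (rule prod.reindex_bij_betw)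
qed

lemma symmetric_kernel_permutation_invariant:
  assumes "symmetric_kernel N d f" "S \<subseteq> {1..N}" "card S = d"
    and xs: "xs \<in> permutations_of_set S" and ys: "ys \<in> permutations_of_set S"
  shows "f xs = f ys"
proof -
  have len: "length xs = d" "length ys = d"
    using xs ys assms(3) by (simp_all add: length_finite_permutations_of_set)
  have "mset xs = mset ys"
    using xs ys by (auto simp: permutations_of_set_def set_eq_iff_mset_eq_distinct[symmetric])
  then obtain p where p: "p permutes {..<length ys}" "permute_list p ys = xs"
    by (metis mset_eq_permutation)
  have "ys \<in> index_tuples N d" using ys assms(2) len by (auto simp: permutations_of_set_def index_tuples_def)
  then show ?thesis using assms(1) p len by (auto simp: symmetric_kernel_def)
qed

definition support_coeff :: "nat \<Rightarrow> nat \<Rightarrow> (nat list \<Rightarrow> real) \<Rightarrow> nat set \<Rightarrow> real" where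
  "support_coeff N d f S =
     (if S \<subseteq> {1..N} \<and> card S = d then \<Sum>js\<in>permutations_of_set S. f js else 0)"

lemma support_coeff_eq:
  assumes "symmetric_kernel N d f" "S \<subseteq> {1..N}" "card S = d" "xs \<in> permutations_of_set S"
  shows "support_coeff N d f S = fact d * f xs"
proof -
  have fin: "finite S" using assms(2) by (rule finite_subset) simp
  have "(\<Sum>js\<in>permutations_of_set S. f js) = (\<Sum>js\<in>permutations_of_set S. f xs)"
    using symmetric_kernel_permutation_invariant[OF assms(1-3) _ assms(4)] by (intro sum.cong refl) blast
  then show ?thesis using assms fin by (simp add: support_coeff_def)
qed

lemma vanishes_if_not_distinct:
  assumes "vanishes_on_diagonals N d f" "js \<in> index_tuples N d" "\<not> distinct js"
  shows "f js = 0"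
proof -
  obtain k j where "k < length js" "j < length js" "k \<noteq> j" "js ! k = js ! j"
    using assms(3) by (auto simp: distinct_conv_nth)
  moreover have "length js = d" using assms(2) by (simp add: index_tuples_def)
  ultimately show ?thesis using assms(1,2) unfolding vanishes_on_diagonals_def by blast
qed

lemma homogeneous_sum_eq_multilinear_sum:
  assumes "vanishes_on_diagonals N d f"
  shows "homogeneous_sum d N f X \<omega> = multilinear_sum X {1..N} (support_coeff N d f) \<omega>"
proof -
  have "homogeneous_sum d N f X \<omega>
    = (\<Sum>S\<in>{S\<in>Pow {1..N}. card S = d}. \<Sum>js\<in>permutations_of_set S. f js * (\<Prod>k<d. X (js ! k) \<omega>))"
    unfolding homogeneous_sum_def
    by (rule sum_index_tuples_by_support) (simp add: vanishes_if_not_distinct[OF assms])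
  also have "\<dots> = (\<Sum>S\<in>{S\<in>Pow {1..N}. card S = d}. support_coeff N d f S * (\<Prod>i\<in>S. X i \<omega>))"
  proof (intro sum.cong refl)
    fix S assume S: "S \<in> {S\<in>Pow {1..N}. card S = d}"
    have "(\<Prod>k<d. X (js ! k) \<omega>) = (\<Prod>i\<in>S. X i \<omega>)" if "js \<in> permutations_of_set S" for js
    proof -
      have "distinct js" "set js = S" using that by (auto simp: permutations_of_set_def)
      then show ?thesis using prod_nth_distinct[of js d "\<lambda>i. X i \<omega>"] S distinct_card[of js] by simp
    qed
    then have "(\<Sum>js\<in>permutations_of_set S. f js * (\<Prod>k<d. X (js ! k) \<omega>)) = (\<Sum>js\<in>permutations_of_set S. f js * (\<Prod>i\<in>S. X i \<omega>))"
      by (intro sum.cong refl) simp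
    then show "(\<Sum>js\<in>permutations_of_set S. f js * (\<Prod>k<d. X (js ! k) \<omega>)) = support_coeff N d f S * (\<Prod>i\<in>S. X i \<omega>)"
      using S by (simp add: support_coeff_def sum_distrib_right)
  qed
  also have "\<dots> = multilinear_sum X {1..N} (support_coeff N d f) \<omega>"
    unfolding multilinear_sum_def by (intro sum.mono_neutral_left) (auto simp: support_coeff_def)
  finally show ?thesis .
qed

text \<open>The \<open>d!\<close> orderings of a set of indices all carry the same kernel value \<open>f\<close>, so the squared coefficient
  is \<open>(d!)\<^sup>2 f\<^sup>2\<close>, while the influence counts each set \<open>(d - 1)!\<close> times.  Sets \<open>S\<close> that contain \<open>i\<close>
  contribute nothing to the influence because the kernel vanishes on diagonals.\<close>

lemma sum_support_coeff_eq_influence: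
  assumes sym: "symmetric_kernel N d f" and van: "vanishes_on_diagonals N d f" and d: "1 \<le> d" and i: "i \<in> {1..N}"
  shows "(\<Sum>S\<in>Pow ({1..N} - {i}). (support_coeff N d f (insert i S))\<^sup>2) = (fact d)\<^sup>2 * influence d N f i"
proof -
  let ?I = "{1..N}"
  let ?g = "\<lambda>js. (f (i # js))\<^sup>2"
  let ?T = "{S\<in>Pow (?I - {i}). card S = d - 1}"
  let ?c = "\<lambda>S. (support_coeff N d f (insert i S))\<^sup>2"
  let ?h = "\<lambda>S. (fact d)\<^sup>2 / fact (d - 1) * (\<Sum>js\<in>permutations_of_set S. ?g js)"
  have zero: "f (i # js) = 0" if "js \<in> index_tuples N (d - 1)" "\<not> distinct (i # js)" for js
    by (rule vanishes_if_not_distinct[OF van]) (use that i d in \<open>auto simp: index_tuples_def\<close>)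
  have coeff_sq: "?c S = ?h S"
    if S: "S \<subseteq> ?I - {i}" "card S = d - 1" for S
  proof -
    have fin: "finite S" using S(1) by (rule finite_subset) simp
    have "i \<notin> S" using S(1) by auto
    then have iS: "insert i S \<subseteq> ?I" "card (insert i S) = d"
      using S i d card_insert_disjoint[OF fin] by auto
    have "(\<Sum>js\<in>permutations_of_set S. ?g js) = (\<Sum>js\<in>permutations_of_set S. ?c S / (fact d)\<^sup>2)"
    proof (intro sum.cong refl)
      fix js assume "js \<in> permutations_of_set S"
      then have "i # js \<in> permutations_of_set (insert i S)" using S by (auto simp: permutations_of_set_def)
      from support_coeff_eq[OF sym iS this] show "?g js = ?c S / (fact d)\<^sup>2"
        by (simp add: power_mult_distrib)
    qed
    also have "\<dots> = fact (d - 1) * (?c S / (fact d)\<^sup>2)" using fin S by simp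
    finally show ?thesis by simp
  qed
  have "(\<Sum>S\<in>Pow (?I - {i}). ?c S)
    = (\<Sum>S\<in>?T. ?c S)"
  proof (intro sum.mono_neutral_right ballI)
    fix S assume S: "S \<in> Pow (?I - {i}) - ?T"
    then have "finite S" "i \<notin> S" using finite_subset[of S "?I - {i}"] by auto
    then have "card (insert i S) \<noteq> d" using S by auto
    then show "?c S = 0" by (simp add: support_coeff_def)
  qed auto
  also have "\<dots> = (\<Sum>S\<in>?T. ?h S)"
    by (intro sum.cong refl coeff_sq) auto
  also have "\<dots> = (\<Sum>S\<in>{S\<in>Pow ?I. card S = d - 1}. ?h S)"
  proof (intro sum.mono_neutral_left ballI)
    fix S assume S: "S \<in> {S\<in>Pow ?I. card S = d - 1} - ?T"
    then have "i \<in> S" by auto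
    have "?g js = 0" if "js \<in> permutations_of_set S" for js
    proof -
      have "js \<in> index_tuples N (d - 1)" "i \<in> set js"
        using that S \<open>i \<in> S\<close> by (auto simp: permutations_of_set_def index_tuples_def distinct_card[symmetric])
      then show ?thesis using zero[of js] by simp
    qed
    then show "?h S = 0" by simp
  qed auto
  also have "\<dots> = (fact d)\<^sup>2 / fact (d - 1) * (\<Sum>js\<in>index_tuples N (d - 1). ?g js)"
    unfolding sum_distrib_left[symmetric]
    by (subst sum_index_tuples_by_support) (simp_all add: zero)
  finally show ?thesis by (simp add: influence_def)
qed

section \<open>Numerical constants and conclusion\<close>

lemma C_star_lower_bound:
  assumes "1 \<le> d" "0 \<le> sup_norm ((deriv ^^ 3) \<phi>)"
  shows "6 * (\<bar>(deriv ^^ 2) \<phi> 0\<bar> + sup_norm ((deriv ^^ 3) \<phi>)) \<le> C_star d \<phi>"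
proof -
  define c where "c = \<bar>(deriv ^^ 2) \<phi> 0\<bar>"
  define S where "S = sup_norm ((deriv ^^ 3) \<phi>)"
  define m where "m = max (3 / 2 * c + S / 3 * (2 * sqrt 2 / sqrt pi)) (2 * \<bar>deriv \<phi> 0\<bar> + 1 / 3 * S)"
  have c: "0 \<le> c" and S: "0 \<le> S" using assms by (auto simp: c_def S_def)
  have "sqrt pi \<le> sqrt 4" using pi_less_4 by (intro real_sqrt_le_mono) simp
  then have "sqrt pi \<le> 2" by simp
  moreover have s2: "1 \<le> sqrt 2" by simp
  ultimately have "sqrt pi \<le> 2 * sqrt 2" by linarith
  then have "1 \<le> 2 * sqrt 2 / sqrt pi" by simp
  then have "S / 3 * 1 \<le> S / 3 * (2 * sqrt 2 / sqrt pi)" using S by (intro mult_left_mono) auto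
  then have "(c + S) / 3 \<le> 3 / 2 * c + S / 3 * (2 * sqrt 2 / sqrt pi)" using c by argo
  then have m: "(c + S) / 3 \<le> m" unfolding m_def by (rule max.coboundedI1)
  have p5: "(5::real) \<le> 5 powr (3 * real d / 2)" using assms powr_mono[of 1 "3 * real d / 2" 5] by simp
  have "4 * 1 * (1 + 5) \<le> 4 * sqrt 2 * (1 + 5 powr (3 * real d / 2))"
    using s2 p5 by (intro mult_mono add_left_mono) auto
  from mult_mono[OF this m] have "4 * 1 * (1 + 5) * ((c + S) / 3) \<le> 4 * sqrt 2 * (1 + 5 powr (3 * real d / 2)) * m"
    using c S by simp
  moreover have "C_star d \<phi> = 4 * sqrt 2 * (1 + 5 powr (3 * real d / 2)) * m"
    by (simp add: C_star_def m_def c_def S_def)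
  ultimately show ?thesis using c S unfolding c_def[symmetric] S_def[symmetric] by argo
qed

lemma first_error_constant:
  fixes \<beta> :: real
  assumes "1 \<le> d" "1 \<le> \<beta>"
  shows "pi / 2 * (2 * \<beta> * sqrt ((16 * \<beta>) ^ (d - 1))) \<le> (30 * \<beta>) ^ d"
proof -
  let ?K = "(16 * \<beta>) ^ (d - 1)"
  have K: "1 \<le> ?K" using assms by (intro one_le_power) auto
  have "sqrt ?K \<le> ?K"
  proof (rule real_le_lsqrt)
    show "?K \<le> ?K\<^sup>2" using K by (rule self_le_power) simp
  qed (use K in linarith)+
  also have "?K \<le> (30 * \<beta>) ^ (d - 1)" using assms by (intro power_mono) auto
  finally have "pi * \<beta> * sqrt ?K \<le> 4 * \<beta> * (30 * \<beta>) ^ (d - 1)"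
    using pi_less_4 assms K by (intro mult_mono) auto
  also have "\<dots> \<le> 30 * \<beta> * (30 * \<beta>) ^ (d - 1)" using assms by (intro mult_right_mono) auto
  also have "\<dots> = (30 * \<beta>) ^ d" using assms by (cases d) auto
  finally show ?thesis by simp
qed

text \<open>The influences of a normalised kernel are at most \<open>1\<close>, so that the square root obtained from the
  variance bound is below the fourth root.\<close>

lemma second_error_constant:
  fixes \<alpha> \<beta> m :: real
  assumes d: "1 \<le> d" and \<beta>: "1 \<le> \<beta>" and \<alpha>: "\<alpha> = max 3 \<beta>" and m: "0 \<le> m" "m \<le> 1"
  shows "sqrt ((3 + \<beta>) / 6 * ((16 * \<beta>) ^ (d - 1) * ((fact d)\<^sup>2 * m)))
    \<le> 4 * sqrt 2 * 144 powr (real d - 1 / 2) * \<alpha> powr (real d / 2) * sqrt (real d) * fact d * root 4 m"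
proof -
  let ?E = "4 * sqrt 2 * sqrt (real d) * 144 powr (real d - 1 / 2)"
  let ?c = "(3 + \<beta>) / 6 * (16 * \<beta>) ^ (d - 1)"
  have \<alpha>3: "3 \<le> \<alpha>" "\<beta> \<le> \<alpha>" using \<alpha> by auto
  have "(3 + \<beta>) / 6 * (16 * \<beta>) ^ (d - 1) \<le> \<alpha> * (16 * \<alpha>) ^ (d - 1)"
    using \<alpha>3 \<beta> by (intro mult_mono power_mono) auto
  also have "\<dots> = 16 ^ (d - 1) * \<alpha> ^ d" using d by (cases d) (auto simp: power_mult_distrib)
  finally have "sqrt ?c \<le> sqrt (16 ^ (d - 1) * \<alpha> ^ d)" by (rule real_sqrt_le_mono)
  also have "\<dots> = 4 ^ (d - 1) * \<alpha> powr (real d / 2)"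
  proof -
    have "sqrt (16 ^ (d - 1)) = sqrt ((4 ^ (d - 1))\<^sup>2)" by (simp add: power_even_eq[symmetric] flip: power_mult) (simp add: power_mult mult.commute)
    then have 16: "sqrt (16 ^ (d - 1)) = 4 ^ (d - 1)" by simp
    have "sqrt (\<alpha> ^ d) = (\<alpha> powr real d) powr (1 / 2)" using \<alpha>3 by (simp add: powr_realpow powr_half_sqrt)
    then have "sqrt (\<alpha> ^ d) = \<alpha> powr (real d / 2)" by (simp add: powr_powr)
    then show ?thesis using 16 by (simp add: real_sqrt_mult)
  qed
  also have "\<dots> \<le> (?E) * \<alpha> powr (real d / 2)"
  proof (rule mult_right_mono)
    have "(4::real) ^ (d - 1) \<le> 144 ^ (d - 1)" by (intro power_mono) auto
    also have "\<dots> = 144 powr (real d - 1)" using d by (simp add: powr_realpow[symmetric] of_nat_diff)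
    also have "\<dots> \<le> 144 powr (real d - 1 / 2)" by (intro powr_mono) auto
    finally have p: "(4::real) ^ (d - 1) \<le> 144 powr (real d - 1 / 2)" .
    have "1 * 1 \<le> 4 * sqrt 2 * sqrt (real d)" using d by (intro mult_mono) (auto simp: order.trans[of 1 "4 * 1"])
    then have "1 * 144 powr (real d - 1 / 2) \<le> (4 * sqrt 2 * sqrt (real d)) * 144 powr (real d - 1 / 2)"
      by (intro mult_right_mono) auto
    then show "4 ^ (d - 1) \<le> ?E"
      unfolding mult_1_left by (rule order.trans[OF p])
  qed simp
  finally have 1: "sqrt ?c
    \<le> ?E * \<alpha> powr (real d / 2)" .
  have 2: "sqrt m \<le> root 4 m"
  proof -
    have "root 4 m = sqrt (sqrt m)" using real_root_mult_exp[of 2 2 m] by (simp add: sqrt_def)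
    moreover have "sqrt m * sqrt m \<le> 1 * sqrt m" using m by (intro mult_right_mono) auto
    ultimately show ?thesis using real_sqrt_le_mono[of "sqrt m * sqrt m" "sqrt m"] m by simp
  qed
  have "sqrt ((3 + \<beta>) / 6 * ((16 * \<beta>) ^ (d - 1) * ((fact d)\<^sup>2 * m)))
    = sqrt ?c * (fact d * sqrt m)"
  proof -
    define c where "c = (3 + \<beta>) / 6 * (16 * \<beta>) ^ (d - 1)"
    have c: "(3 + \<beta>) / 6 * ((16 * \<beta>) ^ (d - 1) * ((fact d)\<^sup>2 * m)) = c * ((fact d)\<^sup>2 * m)"
      by (simp only: c_def mult.assoc)
    show ?thesis unfolding c unfolding c_def[symmetric] by (simp add: real_sqrt_mult)
  qed
  also have "\<dots> \<le> (?E * \<alpha> powr (real d / 2)) * (fact d * root 4 m)"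
    using 1 2 m by (intro mult_mono) auto
  finally show ?thesis by (simp only: mult_ac)
qed

text \<open>The bound of the approximation theorem splits into the term with \<open>S\<close> alone, which is below the first
  term of the claim, and the term with the variance bound \<open>V\<close>, which is below the second one.  The
  constants of the claim leave ample room for both.\<close>

theorem theorem5p1:
  fixes M :: "'a measure" and X :: "nat \<Rightarrow> 'a \<Rightarrow> real"
    and M' :: "'b measure" and Z :: "'b \<Rightarrow> real"
    and \<alpha> \<beta> B :: real and N d :: nat
    and f :: "nat list \<Rightarrow> real" and \<phi> :: "real \<Rightarrow> real"
  assumes "prob_space M"
    and "prob_space.indep_vars M (\<lambda>_. borel) X {1..}"
    and "\<And>i. i \<ge> 1 \<Longrightarrow> integrable M (X i)"
    and "\<And>i. i \<ge> 1 \<Longrightarrow> prob_space.expectation M (X i) = 0"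
    and "\<And>i. i \<ge> 1 \<Longrightarrow> integrable M (\<lambda>\<omega>. (X i \<omega>) ^ 2)"
    and "\<And>i. i \<ge> 1 \<Longrightarrow> prob_space.variance M (X i) = 1"
    and "\<And>i. i \<ge> 1 \<Longrightarrow> integrable M (\<lambda>\<omega>. (X i \<omega>) ^ 4)"
    and "bdd_above ((\<lambda>i. prob_space.expectation M (\<lambda>\<omega>. (X i \<omega>) ^ 4)) ` {1..})"
    and "\<beta> = (SUP i\<in>{1..}. prob_space.expectation M (\<lambda>\<omega>. (X i \<omega>) ^ 4))"
    and "\<alpha> = max 3 \<beta>"
    and "N \<ge> 1" and "d \<ge> 1"
    and "symmetric_kernel N d f"
    and "vanishes_on_diagonals N d f"
    and "prob_space.expectation M (\<lambda>\<omega>. (homogeneous_sum d N f X \<omega>) ^ 2) = 1"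
    and "thrice_differentiable \<phi>"
    and "bdd_above (range (\<lambda>x. \<bar>(deriv ^^ 3) \<phi> x\<bar>))"
    and "sup_norm ((deriv ^^ 3) \<phi>) \<le> B"
    and "prob_space M'"
    and "distributed M' lborel Z std_normal_density"
  shows "\<bar>prob_space.expectation M (\<lambda>\<omega>. \<phi> (homogeneous_sum d N f X \<omega>))
            - prob_space.expectation M' (\<lambda>\<omega>. \<phi> (Z \<omega>))\<bar>
    \<le> B * (30 * \<beta>) ^ d * fact d * sqrt (max_influence d N f)
      + C_star d \<phi> * sqrt ((real d - 1) / (3 * real d)) *
        (sqrt \<bar>prob_space.expectation M (\<lambda>\<omega>. (homogeneous_sum d N f X \<omega>) ^ 4) - 3\<bar>
         + 4 * sqrt 2 * 144 powr (real d - 1 / 2) * \<alpha> powr (real d / 2) * sqrt (real d) * fact d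
           * root 4 (max_influence d N f))"
proof -
  interpret prob_space M by fact
  define S where "S = sup_norm ((deriv ^^ 3) \<phi>)"
  define m where "m = max_influence d N f"
  define \<tau> where "\<tau> = (fact d)\<^sup>2 * m"
  define a where "a = support_coeff N d f"
  let ?Q = "\<lambda>\<omega>. homogeneous_sum d N f X \<omega>"
  have sup: "expectation (\<lambda>\<omega>. (X i \<omega>) ^ 4) \<le> \<beta>" if "i \<ge> 1" for i
    unfolding assms(9) using that by (intro cSUP_upper assms(8)) auto
  interpret family: normalized_family M X "{1..N}" \<beta>
  proof
    show "indep_vars (\<lambda>_. borel) X {1..N}" by (rule indep_vars_subset[OF assms(2)]) auto
    fix i assume "i \<in> {1..N}"
    then have i: "i \<ge> 1" by simp
    show "L4_integrable M (X i)"
      using assms(3)[OF i] assms(7)[OF i] by (auto simp: L4_integrable_def)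
    show "expectation (X i) = 0" by (rule assms(4)[OF i])
    show "expectation (\<lambda>\<omega>. (X i \<omega>)\<^sup>2) = 1" using assms(6)[OF i] assms(4)[OF i] by simp
    show "expectation (\<lambda>\<omega>. (X i \<omega>) ^ 4) \<le> \<beta>" by (rule sup[OF i])
  qed (use assms(11) in auto)
  note \<beta> = family.beta_ge_1
  have Q: "?Q = multilinear_sum X {1..N} a"
    by (rule ext) (simp add: a_def homogeneous_sum_eq_multilinear_sum[OF assms(14)])
  have hom: "family.homogeneous d a"
    unfolding family.homogeneous_def a_def by (metis support_coeff_def)
  have unit: "expectation (\<lambda>\<omega>. (multilinear_sum X {1..N} a \<omega>)\<^sup>2) = 1"
    using assms(15) unfolding Q .
  \<comment> \<open>The partial derivatives have second moments \<open>(d!)\<^sup>2 Inf\<^sub>i\<close>, which add up to \<open>d\<close>.\<close>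
  have partial: "expectation (\<lambda>\<omega>. (family.partial a i \<omega>)\<^sup>2) = (fact d)\<^sup>2 * influence d N f i" if i: "i \<in> {1..N}" for i
    unfolding family.partial_def a_def family.second_moment_multilinear_sum[OF Diff_subset]
    by (rule sum_support_coeff_eq_influence[OF assms(13,14,12) i])
  have inf_le: "influence d N f i \<le> m" if "i \<in> {1..N}" for i
    unfolding m_def max_influence_def using that by (intro Max_ge) auto
  have \<tau>: "expectation (\<lambda>\<omega>. (family.partial a i \<omega>)\<^sup>2) \<le> \<tau>" if "i \<in> {1..N}" for i
    unfolding partial[OF that] \<tau>_def using inf_le[OF that] by (intro mult_left_mono) auto
  have m: "0 \<le> m" "m \<le> 1"
  proof -
    have "m \<in> influence d N f ` {1..N}" unfolding m_def max_influence_def using assms(11) by (intro Max_in) auto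
    then obtain i where i: "i \<in> {1..N}" "m = influence d N f i" by auto
    show "0 \<le> m" unfolding i(2) influence_def by (intro mult_nonneg_nonneg sum_nonneg) auto
    have "(fact d)\<^sup>2 * m = expectation (\<lambda>\<omega>. (family.partial a i \<omega>)\<^sup>2)" unfolding partial[OF i(1)] i(2) ..
    also have "\<dots> \<le> (\<Sum>i\<in>{1..N}. expectation (\<lambda>\<omega>. (family.partial a i \<omega>)\<^sup>2))"
      using i(1) by (intro member_le_sum) auto
    also have "\<dots> = real d" using family.sum_partial_second_moments[OF hom] unit by simp
    also have "\<dots> \<le> fact d" using fact_ge_self[of d] by (metis of_nat_fact of_nat_le_iff)
    also have "\<dots> \<le> (fact d)\<^sup>2 * 1" using fact_ge_1[of d, where 'a = real] self_le_power[of "fact d :: real" 2] by simp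
    finally show "m \<le> 1" by simp
  qed
  have diff: "((deriv ^^ k) \<phi> has_real_derivative (deriv ^^ Suc k) \<phi> x) (at x)" if "k < 3" for k x
  proof -
    have "(deriv ^^ k) \<phi> differentiable (at x)" using assms(16) that unfolding thrice_differentiable_def by blast
    then show ?thesis by (simp add: DERIV_deriv_iff_real_differentiable)
  qed
  have d0: "(\<phi> has_real_derivative deriv \<phi> x) (at x)" for x using diff[of 0 x] by simp
  have d1: "(deriv \<phi> has_real_derivative (deriv ^^ 2) \<phi> x) (at x)" for x using diff[of 1 x] by (simp add: numeral_2_eq_2)
  have d2: "((deriv ^^ 2) \<phi> has_real_derivative (deriv ^^ 3) \<phi> x) (at x)" for x using diff[of 2 x] by (simp add: eval_nat_numeral)
  have S: "\<bar>(deriv ^^ 3) \<phi> x\<bar> \<le> S" for x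
    unfolding S_def sup_norm_def by (rule cSUP_upper2[OF assms(17)]) auto
  have S0: "0 \<le> S" by (rule order.trans[OF abs_ge_zero S])
  have lip: "\<bar>(deriv ^^ 2) \<phi> x - (deriv ^^ 2) \<phi> y\<bar> \<le> S * \<bar>x - y\<bar>" for x y
  proof -
    have "norm ((deriv ^^ 2) \<phi> x - (deriv ^^ 2) \<phi> y) \<le> S * norm (x - y)"
    proof (rule field_differentiable_bound[of UNIV _ "(deriv ^^ 3) \<phi>"])
      show "norm ((deriv ^^ 3) \<phi> z) \<le> S" for z using S[of z] by simp
      show "((deriv ^^ 2) \<phi> has_field_derivative (deriv ^^ 3) \<phi> z) (at z within UNIV)" for z by (rule d2)
    qed simp_all
    then show ?thesis by simp
  qed
  have EZ: "prob_space.expectation M' (\<lambda>\<omega>. \<phi> (Z \<omega>)) = (\<integral>z. \<phi> z \<partial>std_normal_distribution)"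
  proof -
    have "continuous_on UNIV \<phi>" using d0 by (meson DERIV_isCont continuous_at_imp_continuous_on)
    then have meas: "\<phi> \<in> borel_measurable lborel" by (simp add: borel_measurable_continuous_onI)
    have Z: "Z \<in> measurable M' lborel" using assms(20) by (rule distributed_measurable)
    show ?thesis
      unfolding distributed_distr_eq_density[OF assms(20), symmetric] by (rule integral_distr[OF Z meas, symmetric])
  qed
  define K where "K = (16 * \<beta>) ^ (d - 1)"
  define \<kappa> where "\<kappa> = \<bar>expectation (\<lambda>\<omega>. (?Q \<omega>) ^ 4) - 3\<bar>"
  define V where "V = (if d = 1 then 0 else \<kappa> / 3 + (3 + \<beta>) / 6 * (K * \<tau>))"
  define c where "c = \<bar>(deriv ^^ 2) \<phi> 0\<bar>"
  have K0: "0 \<le> K" using \<beta> by (simp add: K_def)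
  have approx: "\<bar>expectation (\<lambda>\<omega>. \<phi> (?Q \<omega>)) - prob_space.expectation M' (\<lambda>\<omega>. \<phi> (Z \<omega>))\<bar>
      \<le> pi / 2 * (S * (2 * \<beta> * sqrt (K * \<tau>)) + (c + S) * sqrt V)"
    unfolding EZ Q V_def \<kappa>_def K_def c_def
    by (rule family.normal_approximation[OF hom assms(12) unit \<tau> d0 d1 lip])
  have first: "pi / 2 * (S * (2 * \<beta> * sqrt (K * \<tau>))) \<le> B * (30 * \<beta>) ^ d * fact d * sqrt m"
  proof -
    have "sqrt (K * \<tau>) = sqrt K * (fact d * sqrt m)" by (simp add: \<tau>_def real_sqrt_mult)
    then have "pi / 2 * (S * (2 * \<beta> * sqrt (K * \<tau>))) = S * (pi / 2 * (2 * \<beta> * sqrt K)) * (fact d * sqrt m)"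
      by (simp add: mult_ac)
    also have "\<dots> \<le> B * (30 * \<beta>) ^ d * (fact d * sqrt m)"
      using first_error_constant[OF assms(12) \<beta>] assms(18) S0 \<beta> m K0 unfolding S_def[symmetric] K_def[symmetric]
      by (intro mult_right_mono mult_mono) auto
    finally show ?thesis by (simp only: mult.assoc)
  qed
  let ?E = "4 * sqrt 2 * 144 powr (real d - 1 / 2) * \<alpha> powr (real d / 2) * sqrt (real d) * fact d * root 4 m"
  let ?q = "sqrt ((real d - 1) / (3 * real d))"
  let ?R = "sqrt \<kappa> + ?E"
  have C: "6 * (c + S) \<le> C_star d \<phi>"
    using C_star_lower_bound[OF assms(12)] S0 by (simp add: c_def S_def)
  have second: "pi / 2 * ((c + S) * sqrt V) \<le> C_star d \<phi> * ?q * ?R"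
  proof (cases "d = 1")
    case True
    \<comment> \<open>Both sides vanish.\<close>
    then show ?thesis by (simp add: V_def)
  next
    case False
    with assms(12) have d: "2 \<le> d" by simp
    have cS: "0 \<le> c + S" using S0 by (simp add: c_def)
    have "sqrt V \<le> sqrt (\<kappa> / 3) + sqrt ((3 + \<beta>) / 6 * (K * \<tau>))"
      unfolding V_def using False K0 \<beta> m by (auto simp: \<kappa>_def \<tau>_def intro!: sqrt_add_le_add_sqrt)
    also have "\<dots> \<le> ?R"
    proof (rule add_mono)
      show "sqrt (\<kappa> / 3) \<le> sqrt \<kappa>" by (intro real_sqrt_le_mono) (simp add: \<kappa>_def)
      show "sqrt ((3 + \<beta>) / 6 * (K * \<tau>)) \<le> ?E"
        unfolding K_def \<tau>_def by (rule second_error_constant[OF assms(12) \<beta> assms(10) m])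
    qed
    finally have VR: "sqrt V \<le> ?R" .
    have V0: "0 \<le> sqrt V" using K0 \<beta> m by (simp add: V_def \<kappa>_def \<tau>_def)
    \<comment> \<open>For \<open>d \<ge> 2\<close> the factor \<open>(d - 1) / (3 d)\<close> is at least \<open>1/6\<close>.\<close>
    have "sqrt ((1 / 3)\<^sup>2) \<le> ?q"
      using d by (intro real_sqrt_le_mono) (simp add: field_simps power2_eq_square)
    then have q: "1 / 3 \<le> ?q" by simp
    have "6 * (c + S) * (1 / 3) \<le> C_star d \<phi> * ?q"
      using C q cS by (intro mult_mono) auto
    moreover have "pi / 2 * (c + S) \<le> 2 * (c + S)" using pi_less_4 cS by (intro mult_right_mono) auto
    ultimately have "pi / 2 * (c + S) \<le> C_star d \<phi> * ?q" by argo
    moreover have "0 \<le> C_star d \<phi> * ?q"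
    proof (rule order.trans[OF _ calculation])
      show "0 \<le> pi / 2 * (c + S)" using cS by simp
    qed
    ultimately have "pi / 2 * (c + S) * sqrt V \<le> C_star d \<phi> * ?q * ?R"
      using mult_mono[OF _ VR _ V0] by blast
    then show ?thesis by (simp only: mult.assoc)
  qed
  have "pi / 2 * (S * (2 * \<beta> * sqrt (K * \<tau>)) + (c + S) * sqrt V)
    = pi / 2 * (S * (2 * \<beta> * sqrt (K * \<tau>))) + pi / 2 * ((c + S) * sqrt V)" by (rule distrib_left)
  with approx first second show ?thesis unfolding \<kappa>_def m_def by linarith
qed

end
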